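(* Let $\theta^{(0)},\eta^{(0)}\in X$. Let $(\zeta(t))_{t\ge0}$ be the sparse inversion flow and, for $\lambda>0$, $(\theta(t))_{t\ge0}$ its stochastic approximation with switching rate $\lambda$, with $\zeta(0)=\theta(0)=\theta^{(0)}$. Let $(\xi(t))_{t\ge0}$ be the discrete Allen--Cahn equation and, for $\lambda>0$, $(\eta(t))_{t\ge0}$ its stochastic approximation with switching rate $\lambda$, with $\xi(0)=\eta(0)=\eta^{(0)}$. Then $$(\theta(t))_{t\ge0}\Rightarrow(\zeta(t))_{t\ge0}\qquad\text{and}\qquad(\eta(t))_{t\ge0}\Rightarrow(\xi(t))_{t\ge0},\qquad\text{as }\lambda\to\infty,$$ where $\Rightarrow$ means convergence in the weak sense probabilistically and uniformly in time $t\ge0$, that is, weak convergence of the laws of the processes (as random paths), with closeness of paths measured uniformly over all $t\ge0$.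
   Context: Let $n,m\in\mathbb{N}$ and $X=\mathbb{R}^n$. For $\lambda>0$ let $(\boldsymbol{i}(t))_{t\ge0}$ be a right-continuous continuous-time Markov process on $\{0,1\}$ with transition rate matrix $\begin{pmatrix}-\lambda&\lambda\\ \lambda&-\lambda\end{pmatrix}$ (no condition is imposed on its initial state). Sparse inversion. Let $b\in\mathbb{R}^m$, $A\in\mathbb{R}^{m\times n}$ with $\mathrm{rank}(A)=n$, $\Phi_{\rm d}(\theta)=\frac12\|A\theta-b\|_2^2$, $\Phi_{\rm r}(\theta)=\|\theta\|_1$, and $\partial\Phi_{\rm r}(\theta)=S(\theta_1)\times\cdots\times S(\theta_n)$ with $S(s)=\{1\}$ if $s>0$, $S(s)=\{-1\}$ if $s<0$, $S(0)=[-1,1]$. The sparse inversion flow is the unique locally absolutely continuous solution of $$\frac{\mathrm{d}\zeta(t)}{\mathrm{d}t}\in-\tfrac12\nabla\Phi_{\rm d}(\zeta(t))-\tfrac12\partial\Phi_{\rm r}(\zeta(t))\quad(t>0).$$ Its stochastic approximation $(\theta(t))_{t\ge0}$ has continuous paths and is obtained by following, on the intervals between consecutive jumps of $\boldsymbol{i}$, the unique solution of $\frac{\mathrm{d}\theta}{\mathrm{d}t}=-\nabla\Phi_{\rm d}(\theta)$ when $\boldsymbol{i}(t)=0$ and of $\frac{\mathrm{d}\theta}{\mathrm{d}t}\in-\partial\Phi_{\rm r}(\theta)$ when $\boldsymbol{i}(t)=1$. Classification. Let $\alpha,\varepsilon>0$, $X'$ a subspace of $X$, $d\in X'$, $P_{X'}:X\to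 X'$ the canonical projection, $\boldsymbol{P}=\alpha P_{X'}^TP_{X'}$, $\boldsymbol{d}=\alpha P_{X'}^Td$, and let $\nabla'$ be a linear map (discrete gradient) on $X$ such that $\triangle'=-\nabla'^T\nabla'\in\mathbb{R}^{n\times n}$ is symmetric and strictly negative definite. Let $W(s)=-s-1$ for $s\le-1$, $W(s)=-\frac{s^2}{2}+\frac12$ for $s\in(-1,1)$, $W(s)=s-1$ for $s\ge1$, with (proximal) subdifferential $\partial W(s)=\{-1\}$ for $s<-1$, $\{-s\}$ for $s\in(-1,1)$, $\{1\}$ for $s>1$, $[-1,1]$ for $s\in\{-1,1\}$; for $\xi\in X$, $\partial W(\xi):=\partial W(\xi_1)\times\cdots\times\partial W(\xi_n)$. The discrete Allen--Cahn equation is the unique locally Lipschitz continuous solution of $$\frac{\mathrm{d}\xi(t)}{\mathrm{d}t}\in-\tfrac12\boldsymbol{P}\xi(t)+\tfrac12\boldsymbol{d}+\tfrac{\varepsilon}{2}\triangle'\xi(t)-\tfrac{1}{2\varepsilon}\partial W(\xi(t))\quad(t\ge0).$$ Its stochastic approximation $(\eta(t))_{t\ge0}$ has continuous paths and is obtained by following, on the intervals between consecutive jumps of $\boldsymbol{i}$, the unique solution of $\frac{\mathrm{d}\eta}{\mathrm{d}t}=-\boldsymbol{P}\eta+\boldsymbol{d}+\varepsilon\triangle'\eta$ when $\boldsymbol{i}(t)=0$ and of $\frac{\mathrm{d}\eta}{\mathrm{d}t}\in-\varepsilon^{-1}\partial W(\eta)$ when $\boldsymbol{i}(t)=1$.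
   Formalization: Closeness of paths is measured uniformly on every bounded interval [0,T] (metric: integral of e^{-t} min{1, sup over [0,t]}), not by the supremum over all t≥0, for which the claim fails because arbitrarily long holding times occur at each fixed rate. *)

theory Defs
  imports "HOL-Probability.Probability"
begin

section \<open>Markov jump processes with a finite state space\<close>

primrec rate_power :: "'s set \<Rightarrow> ('s \<Rightarrow> 's \<Rightarrow> real) \<Rightarrow> nat \<Rightarrow> 's \<Rightarrow> 's \<Rightarrow> real" where
  "rate_power S Q 0 j k = of_bool (j = k)"
| "rate_power S Q (Suc r) j k = (\<Sum>l\<in>S. Q j l * rate_power S Q r l k)"

text \<open>The entries of the matrix exponential of \<open>h Q\<close>, as an explicit series because the
  type of square matrices is not a normed algebra in the library.\<close>

definition transition_prob :: "'s set \<Rightarrow> ('s \<Rightarrow> 's \<Rightarrow> real) \<Rightarrow> real \<Rightarrow> 's \<Rightarrow> 's \<Rightarrow> real" where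
  "transition_prob S Q h j k = (\<Sum>r. h ^ r / fact r * rate_power S Q r j k)"

definition process_past :: "'w measure \<Rightarrow> (real \<Rightarrow> 'w \<Rightarrow> 's) \<Rightarrow> real \<Rightarrow> 'w measure" where
  "process_past M X s = sigma (space M) {X u -` B \<inter> space M | u B. 0 \<le> u \<and> u \<le> s}"

definition markov_jump_process ::
  "'w measure \<Rightarrow> 's set \<Rightarrow> ('s \<Rightarrow> 's \<Rightarrow> real) \<Rightarrow> (real \<Rightarrow> 'w \<Rightarrow> 's) \<Rightarrow> bool" where
  "markov_jump_process M S Q X \<longleftrightarrow>
     prob_space M \<and>
     (\<forall>t\<ge>0. X t \<in> M \<rightarrow>\<^sub>M count_space S) \<and>
     (\<forall>\<omega>\<in>space M. \<forall>t\<ge>0. \<forall>\<^sub>F s in at_right t. X s \<omega> = X t \<omega>) \<and>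
     (\<forall>s\<ge>0. \<forall>h\<ge>0. \<forall>k\<in>S. AE \<omega> in M.
        real_cond_exp M (process_past M X s) (\<lambda>\<omega>. indicator {k} (X (s + h) \<omega>)) \<omega>
          = transition_prob S Q h (X s \<omega>) k)"

definition switching_rates :: "real \<Rightarrow> nat \<Rightarrow> nat \<Rightarrow> real" where
  "switching_rates l j k = (if j = k then - l else l)"


section \<open>Differential inclusions\<close>

definition abs_continuous_on :: "real \<Rightarrow> real \<Rightarrow> (real \<Rightarrow> 'a::real_normed_vector) \<Rightarrow> bool" where
  "abs_continuous_on a b x \<longleftrightarrow>
     (\<forall>e>0. \<exists>d>0. \<forall>(N::nat) u v.
        (\<forall>k<N. a \<le> u k \<and> u k \<le> v k \<and> v k \<le> b) \<and>
        (\<forall>k<N. \<forall>l<N. k \<noteq> l \<longrightarrow> {u k<..<v k} \<inter> {u l<..<v l} = {}) \<and>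
        (\<Sum>k<N. v k - u k) < d \<longrightarrow>
        (\<Sum>k<N. norm (x (v k) - x (u k))) < e)"

definition locally_abs_continuous_on :: "real set \<Rightarrow> (real \<Rightarrow> 'a::real_normed_vector) \<Rightarrow> bool" where
  "locally_abs_continuous_on I x \<longleftrightarrow> (\<forall>a b. a \<le> b \<and> {a..b} \<subseteq> I \<longrightarrow> abs_continuous_on a b x)"

definition locally_lipschitz_on :: "real set \<Rightarrow> (real \<Rightarrow> 'a::real_normed_vector) \<Rightarrow> bool" where
  "locally_lipschitz_on I x \<longleftrightarrow> (\<forall>t\<in>I. \<exists>r>0. \<exists>L. L-lipschitz_on (cball t r \<inter> I) x)"

text \<open>For locally absolutely continuous curves a differential inclusion is required at almost
  every time, since such curves need only be differentiable almost everywhere.\<close>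

definition satisfies_inclusion ::
  "('a \<Rightarrow> 'a set) \<Rightarrow> real set \<Rightarrow> (real \<Rightarrow> 'a::real_normed_vector) \<Rightarrow> bool" where
  "satisfies_inclusion F I x \<longleftrightarrow>
     (AE t in lebesgue. t \<in> I \<longrightarrow> (\<exists>v\<in>F (x t). (x has_vector_derivative v) (at t within I)))"

text \<open>\<open>j\<close> is a right-continuous path of the switching process. Quantifying over all bounded
  intervals \<open>[a, b)\<close> of constancy of \<open>j\<close> covers every interval between consecutive jumps (also
  an unbounded last one) without enumerating the jump times. An ordinary differential equation
  is the case of a singleton-valued \<open>F k\<close>.\<close>

definition follows_switched ::
  "(nat \<Rightarrow> 'a \<Rightarrow> 'a set) \<Rightarrow> (real \<Rightarrow> nat) \<Rightarrow> (real \<Rightarrow> 'a::real_normed_vector) \<Rightarrow> bool" where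
  "follows_switched F j x \<longleftrightarrow>
     (\<forall>a b. 0 \<le> a \<and> a < b \<and> (\<forall>t\<in>{a..<b}. j t = j a) \<longrightarrow>
        locally_abs_continuous_on {a..b} x \<and> satisfies_inclusion (F (j a)) {a..b} x)"

definition stochastic_approximation ::
  "'w measure \<Rightarrow> (real \<Rightarrow> 'w \<Rightarrow> nat) \<Rightarrow> (nat \<Rightarrow> 'a \<Rightarrow> 'a set) \<Rightarrow> 'a
     \<Rightarrow> (real \<Rightarrow> 'w \<Rightarrow> 'a::real_normed_vector) \<Rightarrow> bool" where
  "stochastic_approximation M i F x0 X \<longleftrightarrow>
     (\<forall>t\<ge>0. X t \<in> borel_measurable M) \<and>
     (\<forall>\<omega>\<in>space M. X 0 \<omega> = x0 \<and> continuous_on {0..} (\<lambda>t. X t \<omega>)) \<and>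
     (AE \<omega> in M. follows_switched F (\<lambda>t. i t \<omega>) (\<lambda>t. X t \<omega>))"


section \<open>Sparse inversion\<close>

definition gradient :: "('a::real_inner \<Rightarrow> real) \<Rightarrow> 'a \<Rightarrow> 'a" where
  "gradient f x = (THE g. GDERIV f x :> g)"

definition data_misfit :: "real^'n^'m \<Rightarrow> real^'m \<Rightarrow> real^'n \<Rightarrow> real" where
  "data_misfit A b x = (1/2) * (norm (A *v x - b))\<^sup>2"

definition subdiff_abs :: "real \<Rightarrow> real set" where
  "subdiff_abs s = (if s > 0 then {1} else if s < 0 then {-1} else {-1..1})"

definition subdiff_l1 :: "real^'n \<Rightarrow> (real^'n) set" where
  "subdiff_l1 x = {v. \<forall>c. v $ c \<in> subdiff_abs (x $ c)}"

definition sparse_inversion_field :: "real^'n^'m \<Rightarrow> real^'m \<Rightarrow> real^'n \<Rightarrow> (real^'n) set" where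
  "sparse_inversion_field A b x =
     {- (1/2) *\<^sub>R gradient (data_misfit A b) x - (1/2) *\<^sub>R v | v. v \<in> subdiff_l1 x}"

definition sparse_inversion_flow ::
  "real^'n^'m \<Rightarrow> real^'m \<Rightarrow> real^'n \<Rightarrow> (real \<Rightarrow> real^'n) \<Rightarrow> bool" where
  "sparse_inversion_flow A b x0 z \<longleftrightarrow>
     z 0 = x0 \<and> locally_abs_continuous_on {0..} z \<and>
     satisfies_inclusion (sparse_inversion_field A b) {0..} z"

definition sparse_inversion_split ::
  "real^'n^'m \<Rightarrow> real^'m \<Rightarrow> nat \<Rightarrow> real^'n \<Rightarrow> (real^'n) set" where
  "sparse_inversion_split A b k x =
     (if k = 0 then {- gradient (data_misfit A b) x} else uminus ` subdiff_l1 x)"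


section \<open>Classification\<close>

text \<open>The canonical projection onto a subspace \<open>V\<close> is the orthogonal one, \<open>closest_point V\<close>,
  regarded as a map of the whole space into itself. On \<open>V\<close> its adjoint agrees with the adjoint
  of the projection with codomain \<open>V\<close>.\<close>

definition observation_map :: "real \<Rightarrow> (real^'n) set \<Rightarrow> real^'n \<Rightarrow> real^'n" where
  "observation_map \<alpha> V x = \<alpha> *\<^sub>R adjoint (closest_point V) (closest_point V x)"

definition observation_data :: "real \<Rightarrow> (real^'n) set \<Rightarrow> real^'n \<Rightarrow> real^'n" where
  "observation_data \<alpha> V d = \<alpha> *\<^sub>R adjoint (closest_point V) d"

definition discrete_laplacian :: "real^'n^'k \<Rightarrow> real^'n^'n" where
  "discrete_laplacian G = - (transpose G ** G)"

definition negative_definite :: "real^'n^'n \<Rightarrow> bool" where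
  "negative_definite L \<longleftrightarrow> (\<forall>x. x \<noteq> 0 \<longrightarrow> x \<bullet> (L *v x) < 0)"

definition subdiff_W1 :: "real \<Rightarrow> real set" where
  "subdiff_W1 s =
     (if s < -1 then {-1} else if s > 1 then {1} else if s = -1 \<or> s = 1 then {-1..1} else {- s})"

definition subdiff_W :: "real^'n \<Rightarrow> (real^'n) set" where
  "subdiff_W x = {v. \<forall>c. v $ c \<in> subdiff_W1 (x $ c)}"

definition allen_cahn_field ::
  "real \<Rightarrow> real \<Rightarrow> (real^'n) set \<Rightarrow> real^'n \<Rightarrow> real^'n^'k \<Rightarrow> real^'n \<Rightarrow> (real^'n) set" where
  "allen_cahn_field \<alpha> \<epsilon> V d G x =
     {- (1/2) *\<^sub>R observation_map \<alpha> V x + (1/2) *\<^sub>R observation_data \<alpha> V d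
        + (\<epsilon>/2) *\<^sub>R (discrete_laplacian G *v x) - (1/(2*\<epsilon>)) *\<^sub>R v | v. v \<in> subdiff_W x}"

definition allen_cahn_flow ::
  "real \<Rightarrow> real \<Rightarrow> (real^'n) set \<Rightarrow> real^'n \<Rightarrow> real^'n^'k \<Rightarrow> real^'n \<Rightarrow> (real \<Rightarrow> real^'n) \<Rightarrow> bool" where
  "allen_cahn_flow \<alpha> \<epsilon> V d G x0 z \<longleftrightarrow>
     z 0 = x0 \<and> locally_lipschitz_on {0..} z \<and>
     satisfies_inclusion (allen_cahn_field \<alpha> \<epsilon> V d G) {0..} z"

definition allen_cahn_split ::
  "real \<Rightarrow> real \<Rightarrow> (real^'n) set \<Rightarrow> real^'n \<Rightarrow> real^'n^'k \<Rightarrow> nat \<Rightarrow> real^'n \<Rightarrow> (real^'n) set" where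
  "allen_cahn_split \<alpha> \<epsilon> V d G k x =
     (if k = 0
      then {- observation_map \<alpha> V x + observation_data \<alpha> V d + \<epsilon> *\<^sub>R (discrete_laplacian G *v x)}
      else (\<lambda>v. - (1/\<epsilon>) *\<^sub>R v) ` subdiff_W x)"


section \<open>Weak convergence of random paths\<close>

text \<open>Paths are functions on \<open>[0, \<infinity>)\<close>, extended by \<open>undefined\<close> to negative times so that two
  paths are equal iff they agree on \<open>[0, \<infinity>)\<close>.\<close>

definition path_space :: "(real \<Rightarrow> 'a::metric_space) set" where
  "path_space = {f \<in> extensional {0..}. continuous_on {0..} f}"

text \<open>The usual metric on the continuous paths on \<open>[0, \<infinity>)\<close>: the integral over all \<open>t \<ge> 0\<close> of
  \<open>exp (- t)\<close> times the minimum of \<open>1\<close> and the uniform distance on \<open>[0, t]\<close> (the minimum is taken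
  inside the supremum, which keeps the latter finite for arbitrary functions). Convergence in it is
  uniform convergence on every \<open>[0, T]\<close>. The plain supremum over \<open>[0, \<infinity>)\<close> would not do: for each
  fixed switching rate the switching process almost surely has arbitrarily long holding times in
  each state, during which a switched path moves away from the averaged one by an amount that does
  not vanish as the rate grows.\<close>

definition path_dist :: "(real \<Rightarrow> 'a::metric_space) \<Rightarrow> (real \<Rightarrow> 'a) \<Rightarrow> real" where
  "path_dist f g = (LINT t:{0..}|lborel. exp (- t) * (SUP s\<in>{0..t}. min 1 (dist (f s) (g s))))"

definition running_dist :: "(real \<Rightarrow> 'a::metric_space) \<Rightarrow> (real \<Rightarrow> 'a) \<Rightarrow> real \<Rightarrow> real" where
  "running_dist f g t = (SUP s\<in>{0..t}. min 1 (dist (f s) (g s)))"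

lemma running_dist_upper:
  assumes "0 \<le> s" "s \<le> t"
  shows "min 1 (dist (f s) (g s)) \<le> running_dist f g t"
  unfolding running_dist_def
  by (rule cSUP_upper) (use assms in \<open>auto intro!: bdd_aboveI[of _ 1]\<close>)

lemma running_dist_le:
  assumes "0 \<le> t" "\<And>s. 0 \<le> s \<Longrightarrow> s \<le> t \<Longrightarrow> min 1 (dist (f s) (g s)) \<le> c"
  shows "running_dist f g t \<le> c"
  unfolding running_dist_def by (rule cSUP_least) (use assms in auto)

lemma running_dist_nonneg: "0 \<le> t \<Longrightarrow> 0 \<le> running_dist f g t"
  using running_dist_upper[of 0 t f g] by (smt (verit) zero_le_dist)

lemma running_dist_le_1: "0 \<le> t \<Longrightarrow> running_dist f g t \<le> 1"
  by (rule running_dist_le) auto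

lemma running_dist_mono: "0 \<le> s \<Longrightarrow> s \<le> t \<Longrightarrow> running_dist f g s \<le> running_dist f g t"
  by (intro running_dist_le running_dist_upper) auto

lemma running_dist_triangle:
  assumes "0 \<le> t"
  shows "running_dist f h t \<le> running_dist f g t + running_dist g h t"
proof (rule running_dist_le[OF assms])
  fix s assume "0 \<le> s" "s \<le> t"
  then show "min 1 (dist (f s) (h s)) \<le> running_dist f g t + running_dist g h t"
    using running_dist_upper[of s t f g] running_dist_upper[of s t g h] dist_triangle[of "f s" "h s" "g s"]
    by (smt (verit) zero_le_dist)
qed

lemma set_integrable_exp_minus: "set_integrable lborel {0..} (\<lambda>t::real. exp (- t))"
proof -
  have "(\<lambda>t::real. exp (- t)) absolutely_integrable_on {0..}"
    using integrable_on_exp_minus_to_infinity[of 1 0]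
    by (intro nonnegative_absolutely_integrable_1) auto
  then show ?thesis
    unfolding set_integrable_def by (subst (asm) integrable_completion) auto
qed

lemma set_integrable_running_dist:
  "set_integrable lborel {0..} (\<lambda>t. exp (- t) * running_dist f g t)"
proof -
  define r where "r = (\<lambda>t. running_dist f g (max 0 t))"
  have "mono r"
    unfolding r_def by (intro monoI running_dist_mono) auto
  then have [measurable]: "r \<in> borel_measurable borel"
    by (rule borel_measurable_mono)
  have "set_integrable lborel {0..} (\<lambda>t. exp (- t) * r t)"
  proof (rule set_integrable_bound[OF set_integrable_exp_minus])
    show "set_borel_measurable lborel {0..} (\<lambda>t. exp (- t) * r t)"
      unfolding set_borel_measurable_def by measurable
    show "AE t in lborel. t \<in> {0..} \<longrightarrow> norm (exp (- t) * r t) \<le> norm (exp (- t))"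
      using running_dist_nonneg[of _ f g] running_dist_le_1[of _ f g]
      by (auto simp: r_def abs_mult)
  qed
  also have "?this \<longleftrightarrow> ?thesis"
    by (rule set_integrable_cong) (auto simp: r_def)
  finally show ?thesis .
qed

lemma path_dist_eq: "path_dist f g = (LINT t:{0..}|lborel. exp (- t) * running_dist f g t)"
  unfolding path_dist_def running_dist_def ..

lemma path_dist_lower:
  assumes "0 \<le> T"
  shows "exp (- (T + 1)) * running_dist f g T \<le> path_dist f g"
proof -
  have "exp (- (T + 1)) * running_dist f g T =
      (LINT t:{T..T+1}|lborel. exp (- (T + 1)) * running_dist f g T)"
    by (simp add: set_lebesgue_integral_def)
  also have "\<dots> \<le> (LINT t:{T..T+1}|lborel. exp (- t) * running_dist f g t)"
    using assms running_dist_nonneg[of T f g] running_dist_mono[of T _ f g]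
    by (intro set_integral_mono mult_mono
          set_integrable_subset[OF set_integrable_running_dist])
       (auto simp: set_integrable_def)
  also have "\<dots> \<le> path_dist f g"
    unfolding path_dist_eq set_lebesgue_integral_def
    using assms running_dist_nonneg[of _ f g] set_integrable_running_dist[of f g]
      set_integrable_subset[OF set_integrable_running_dist[of f g], of "{T..T+1}"]
    by (intro integral_mono) (auto simp: set_integrable_def indicator_def)
  finally show ?thesis .
qed

lemma Metric_space_path: "Metric_space path_space (path_dist :: (real \<Rightarrow> 'a::metric_space) \<Rightarrow> _)"
proof
  fix f g h :: "real \<Rightarrow> 'a"
  show "0 \<le> path_dist f g"
    using path_dist_lower[of 0 f g] running_dist_nonneg[of 0 f g]
    by (smt (verit) exp_ge_zero mult_nonneg_nonneg)
  show "path_dist f g = path_dist g f"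
    unfolding path_dist_def by (simp add: dist_commute)
  show "path_dist f h \<le> path_dist f g + path_dist g h"
  proof -
    have "path_dist f h \<le>
        (LINT t:{0..}|lborel. exp (- t) * running_dist f g t + exp (- t) * running_dist g h t)"
      unfolding path_dist_eq using running_dist_triangle[of _ f h g]
      by (intro set_integral_mono set_integral_add set_integrable_running_dist)
         (auto simp flip: distrib_left)
    also have "\<dots> = path_dist f g + path_dist g h"
      unfolding path_dist_eq by (intro set_integral_add set_integrable_running_dist)
    finally show ?thesis .
  qed
  assume fg: "f \<in> path_space" "g \<in> path_space"
  show "path_dist f g = 0 \<longleftrightarrow> f = g"
  proof
    assume 0: "path_dist f g = 0"
    have "f t = g t" for t
    proof (cases "t \<ge> 0")
      case True
      then have "running_dist f g t \<le> 0"
        using path_dist_lower[of t f g] 0 by (simp add: mult_le_0_iff not_le)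
      then show ?thesis
        using running_dist_upper[of t t f g] True zero_le_dist[of "f t" "g t"]
        by (smt (verit) dist_eq_0_iff)
    qed (use fg in \<open>auto simp: path_space_def extensional_def\<close>)
    then show "f = g" by auto
  next
    assume "f = g"
    have "running_dist g g t = 0" if "0 \<le> t" for t
      using running_dist_nonneg[of t g g] running_dist_le[of t g g 0] that by auto
    then show "path_dist f g = 0"
      unfolding path_dist_eq \<open>f = g\<close> set_lebesgue_integral_def
      by (auto simp: indicator_def intro!: Bochner_Integration.integral_eq_zero_AE AE_I2)
  qed
qed

definition path_topology :: "(real \<Rightarrow> 'a::metric_space) topology" where
  "path_topology = Metric_space.mtopology path_space path_dist"

definition topology_borel :: "'p topology \<Rightarrow> 'p measure" where
  "topology_borel T = sigma (topspace T) {U. openin T U}"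

definition weakly_converges ::
  "'p topology \<Rightarrow> ('i \<Rightarrow> 'p measure) \<Rightarrow> 'p measure \<Rightarrow> 'i filter \<Rightarrow> bool" where
  "weakly_converges T N N0 F \<longleftrightarrow>
     (\<forall>f. continuous_map T euclideanreal f \<and> bounded (f ` topspace T) \<longrightarrow>
        ((\<lambda>i. \<integral>p. f p \<partial>N i) \<longlongrightarrow> (\<integral>p. f p \<partial>N0)) F)"

definition path_law :: "'w measure \<Rightarrow> (real \<Rightarrow> 'w \<Rightarrow> 'a::metric_space) \<Rightarrow> (real \<Rightarrow> 'a) measure" where
  "path_law M X = distr M (topology_borel path_topology) (\<lambda>\<omega>. restrict (\<lambda>t. X t \<omega>) {0..})"

definition deterministic_path_law :: "(real \<Rightarrow> 'a::metric_space) \<Rightarrow> (real \<Rightarrow> 'a) measure" where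
  "deterministic_path_law z = return (topology_borel path_topology) (restrict z {0..})"

end

theory Submission
  imports Defs
begin

text \<open>Both systems have the form \<open>x' \<in> f x\<close> or \<open>x' \<in> F x\<close> according to the state of the switching,
  with \<open>f\<close> Lipschitz and \<open>F\<close> bounded and one-sided Lipschitz, and the limit flow solves
  \<open>z' \<in> (f z + F z) / 2\<close>. With \<open>\<sigma> = \<plusminus>1/2\<close> encoding the state and \<open>h = 2 (f z - z')\<close>, which depends on
  the flow only, the difference \<open>e = x - z\<close> satisfies
  \<open>(\<bar>e\<bar>\<^sup>2)' \<le> 2 L \<bar>e\<bar>\<^sup>2 + 2 \<sigma> h \<bullet> e\<close> almost everywhere. Since \<open>e\<close> is Lipschitz with a constant that does not
  depend on the path, freezing it on the cells of a grid of \<open>[0, T]\<close> bounds \<open>\<bar>e\<bar>\<^sup>2\<close> on \<open>[0, T]\<close>, up to an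
  error of the order of the mesh, by the integrals of \<open>\<sigma> h\<close> over finitely many cells. The Markov property
  gives \<open>E (\<sigma> s * \<sigma> t) = exp (- 2 \<lambda> \<bar>t - s\<bar>) / 4\<close>, so that the second moments of these integrals tend to
  \<open>0\<close> as \<open>\<lambda> \<rightarrow> \<infinity>\<close>. Convergence of the paths in probability to a deterministic path implies weak
  convergence.\<close>


section \<open>Absolutely continuous curves\<close>

text \<open>In either state \<open>e'\<close> is a difference of values of one field,
  \<open>f\<close> or \<open>F\<close>, at \<open>x\<close> and at \<open>z\<close>, plus exactly
  \<open>\<sigma> h\<close>. Since \<open>F\<close> is set-valued and jumps, its difference is small
  only after pairing with \<open>e\<close>; this forces an energy argument instead of a comparison
  of velocities. The obstacle is that \<open>e\<close> depends on the switching, so that the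
  decorrelation of \<open>\<sigma>\<close> says nothing directly about the integral of
  \<open>\<sigma> h \<bullet> e\<close>. After freezing, \<open>\<sigma>\<close> is integrated
  against the deterministic \<open>h\<close> alone, and the dependence is paid for by the mesh.
  Hence the mesh is fixed first and only then does the rate grow. Jumps are never enumerated:
  inequalities on intervals of constancy are propagated by an induction along the real line. The
  correlation formula holds for every initial law because the square of the spin is constant.
  Bounded horizons suffice because the path metric gives weight \<open>exp (- T)\<close> to all that
  happens after \<open>T\<close>.\<close>

text \<open>Reindexing along a bijection with \<open>{..<card I}\<close>. It lets the cells of a
  tagged division, which are pairs of a tag and a set, index the intervals directly.\<close>

lemma abs_continuous_on_finite_family:
  fixes x :: "real \<Rightarrow> 'a::real_normed_vector"
  assumes x: "abs_continuous_on a b x" and "e > 0"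
  shows "\<exists>d>0. \<forall>I (u :: 'i \<Rightarrow> real) v. finite I \<and>
     (\<forall>k\<in>I. a \<le> u k \<and> u k \<le> v k \<and> v k \<le> b) \<and>
     disjoint_family_on (\<lambda>k. {u k<..<v k}) I \<and>
     (\<Sum>k\<in>I. v k - u k) < d \<longrightarrow> (\<Sum>k\<in>I. norm (x (v k) - x (u k))) < e"
proof -
  obtain d where d: "d > 0" "\<forall>(N::nat) u v.
        (\<forall>k<N. a \<le> u k \<and> u k \<le> v k \<and> v k \<le> b) \<and>
        (\<forall>k<N. \<forall>l<N. k \<noteq> l \<longrightarrow> {u k<..<v k} \<inter> {u l<..<v l} = {}) \<and>
        (\<Sum>k<N. v k - u k) < d \<longrightarrow>
        (\<Sum>k<N. norm (x (v k) - x (u k))) < e"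
    using x[unfolded abs_continuous_on_def, rule_format, OF \<open>e > 0\<close>] by (elim exE conjE) (rule that)
  show ?thesis
  proof (intro exI[of _ d] conjI allI impI d(1); elim conjE)
    fix I and u v :: "'i \<Rightarrow> real"
    assume I: "finite I"
      and uv: "\<forall>k\<in>I. a \<le> u k \<and> u k \<le> v k \<and> v k \<le> b"
      and disj: "disjoint_family_on (\<lambda>k. {u k<..<v k}) I"
      and sm: "(\<Sum>k\<in>I. v k - u k) < d"
    obtain f where f: "bij_betw f {..<card I} I"
      using ex_bij_betw_nat_finite[OF I] by (auto simp: atLeast0LessThan)
    have inI: "f k \<in> I" if "k < card I" for k
      using f that by (auto simp: bij_betw_def)
    have inj: "f k \<noteq> f l" if "k < card I" "l < card I" "k \<noteq> l" for k l
      using f that by (auto simp: bij_betw_def inj_on_def)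
    have re: "(\<Sum>k<card I. w (f k)) = (\<Sum>k\<in>I. w k)" for w :: "'i \<Rightarrow> real"
      using sum.reindex_bij_betw[OF f] by simp
    have "(\<Sum>k<card I. norm (x (v (f k)) - x (u (f k)))) < e"
    proof (rule d(2)[rule_format, OF conjI, OF _ conjI])
      show "\<forall>k<card I. a \<le> u (f k) \<and> u (f k) \<le> v (f k) \<and> v (f k) \<le> b"
        using uv inI by blast
      show "\<forall>k<card I. \<forall>l<card I. k \<noteq> l \<longrightarrow> {u (f k)<..<v (f k)} \<inter> {u (f l)<..<v (f l)} = {}"
        using disj inI inj unfolding disjoint_family_on_def by blast
      show "(\<Sum>k<card I. v (f k) - u (f k)) < d"
        using sm re[of "\<lambda>k. v k - u k"] by simp
    qed
    then show "(\<Sum>k\<in>I. norm (x (v k) - x (u k))) < e"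
      using re[of "\<lambda>k. norm (x (v k) - x (u k))"] by simp
  qed
qed

lemma lipschitz_on_imp_abs_continuous_on:
  fixes x :: "real \<Rightarrow> 'a::real_normed_vector"
  assumes L: "L-lipschitz_on {a..b} x"
  shows "abs_continuous_on a b x"
  unfolding abs_continuous_on_def
proof (intro allI impI)
  fix e :: real assume "e > 0"
  have "L \<ge> 0" using L by (rule lipschitz_on_nonneg)
  show "\<exists>d>0. \<forall>(N::nat) u v.
        (\<forall>k<N. a \<le> u k \<and> u k \<le> v k \<and> v k \<le> b) \<and>
        (\<forall>k<N. \<forall>l<N. k \<noteq> l \<longrightarrow> {u k<..<v k} \<inter> {u l<..<v l} = {}) \<and>
        (\<Sum>k<N. v k - u k) < d \<longrightarrow> (\<Sum>k<N. norm (x (v k) - x (u k))) < e"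
  \<comment> \<open>With \<open>L + 1\<close> the quotient makes sense for \<open>L = 0\<close> and
    the final inequality is strict.\<close>
  proof (intro exI[of _ "e / (L + 1)"] conjI allI impI; (elim conjE)?)
    show "0 < e / (L + 1)" using \<open>e > 0\<close> \<open>L \<ge> 0\<close> by simp
    fix N :: nat and u v :: "nat \<Rightarrow> real"
    assume uv: "\<forall>k<N. a \<le> u k \<and> u k \<le> v k \<and> v k \<le> b"
      and sm: "(\<Sum>k<N. v k - u k) < e / (L + 1)"
    have "(\<Sum>k<N. norm (x (v k) - x (u k))) \<le> (\<Sum>k<N. L * (v k - u k))"
    proof (rule sum_mono)
      fix k assume "k \<in> {..<N}"
      then have "a \<le> u k \<and> u k \<le> v k \<and> v k \<le> b" using uv by auto
      then show "norm (x (v k) - x (u k)) \<le> L * (v k - u k)"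
        using lipschitz_onD[OF L, of "v k" "u k"] by (auto simp: dist_norm)
    qed
    also have "\<dots> = L * (\<Sum>k<N. v k - u k)" by (simp add: sum_distrib_left)
    also have "\<dots> \<le> L * (e / (L + 1))"
      using sm \<open>L \<ge> 0\<close> by (intro mult_left_mono) auto
    also have "\<dots> < e" using \<open>e > 0\<close> \<open>L \<ge> 0\<close> by (simp add: field_simps)
    finally show "(\<Sum>k<N. norm (x (v k) - x (u k))) < e" .
  qed
qed

text \<open>The tags in the exceptional null set are forced into an open set of small measure, on which
  absolute continuity bounds the increments.\<close>

theorem fundamental_theorem_of_calculus_abs_continuous:
  fixes x :: "real \<Rightarrow> 'a::banach"
  assumes ab: "a \<le> b" and ac: "abs_continuous_on a b x"
    and der: "AE t in lebesgue. t \<in> {a..b} \<longrightarrow> (x has_vector_derivative g t) (at t within {a..b})"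
  shows "(g has_integral (x b - x a)) {a..b}"
proof (cases "a = b")
  case False
  with ab have ab': "a < b" by simp
  define E where "E = {t \<in> {a..b}. \<not> (x has_vector_derivative g t) (at t within {a..b})}"
  have negE: "negligible E"
  proof -
    obtain N where N: "N \<in> null_sets lebesgue"
      "\<And>t. t \<notin> N \<Longrightarrow> t \<in> {a..b} \<longrightarrow> (x has_vector_derivative g t) (at t within {a..b})"
      using AE_E3[OF der] by auto
    then have "E \<subseteq> N" by (auto simp: E_def)
    then show ?thesis using N(1) negligible_iff_null_sets negligible_subset by blast
  qed
  \<comment> \<open>Killing the integrand on \<open>E\<close> leaves only the increments of
    \<open>x\<close> over the cells tagged there.\<close>
  define g' where "g' t = (if t \<in> E then 0 else g t)" for t
  have "(g' has_integral (x b - x a)) {a..b}"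
    unfolding has_integral_factor_content_real
  proof (intro allI impI)
    fix \<epsilon> :: real assume "\<epsilon> > 0"
    \<comment> \<open>One half is spent on the cells with good tags, the other on those tagged in
      \<open>E\<close>.\<close>
    define e where "e = \<epsilon> / 2"
    have "e > 0" using \<open>\<epsilon> > 0\<close> by (simp add: e_def)
    have "\<forall>t. \<exists>d>0. t \<in> {a..b} - E \<longrightarrow>
         (\<forall>y\<in>{a..b}. norm (y-t) < d \<longrightarrow> norm (x y - x t - (y-t) *\<^sub>R g t) \<le> e * norm (y-t))"
      using \<open>e > 0\<close> unfolding E_def has_vector_derivative_def has_derivative_within_alt
      by (auto intro: zero_less_one)
    then obtain r where r: "\<And>t. 0 < r t"
        "\<And>t y. \<lbrakk>t \<in> {a..b} - E; y \<in> {a..b}; norm (y-t) < r t\<rbrakk>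
             \<Longrightarrow> norm (x y - x t - (y-t) *\<^sub>R g t) \<le> e * norm (y-t)"
      by metis
    have pos: "e * (b - a) > 0" using \<open>e > 0\<close> ab' by simp
    obtain d where d: "d > 0" "\<forall>I (u :: real \<times> real set \<Rightarrow> real) v. finite I \<and>
       (\<forall>k\<in>I. a \<le> u k \<and> u k \<le> v k \<and> v k \<le> b) \<and>
       disjoint_family_on (\<lambda>k. {u k<..<v k}) I \<and>
       (\<Sum>k\<in>I. v k - u k) < d \<longrightarrow> (\<Sum>k\<in>I. norm (x (v k) - x (u k))) < e * (b - a)"
      using abs_continuous_on_finite_family[OF ac pos] by (elim exE conjE) (rule that)
    obtain U where U: "open U" "E \<subseteq> U" "U - E \<in> lmeasurable" "emeasure lebesgue (U - E) < ennreal d"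
      using sets_lebesgue_outer_open[of E d] negE d(1) negligible_imp_sets by blast
    have Ulm: "U \<in> lmeasurable"
      using U(1,3) negE
      by (metis borel_open measurable_Diff_null_set negligible_iff_null_sets sets_completionI_sets sets_lborel)
    have mU: "measure lebesgue U < d"
      using U(3,4) negE Ulm \<open>d > 0\<close>
      by (metis emeasure_eq_measure2 ennreal_less_iff measure_Diff_null_set measure_nonneg
          negligible_iff_null_sets fmeasurableD)
    define \<gamma> where "\<gamma> t = (if t \<in> E then U else ball t (r t))" for t
    show "\<exists>\<gamma>. gauge \<gamma> \<and> (\<forall>p. p tagged_division_of {a..b} \<and> \<gamma> fine p \<longrightarrow>
      norm ((\<Sum>(t, K)\<in>p. measure lborel K *\<^sub>R g' t) - (x b - x a)) \<le> \<epsilon> * measure lborel {a..b})"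
    proof (intro exI[of _ \<gamma>] conjI allI impI; (elim conjE)?)
      show "gauge \<gamma>" using U r(1) by (auto simp: gauge_def \<gamma>_def)
      fix p assume ptag: "p tagged_division_of {a..b}" and fine: "\<gamma> fine p"
      have finp: "finite p" using ptag by blast
      define u where "u = (\<lambda>q::real \<times> real set. Inf (snd q))"
      define v where "v = (\<lambda>q::real \<times> real set. Sup (snd q))"
      have pK: "snd q = {u q..v q} \<and> u q \<le> fst q \<and> fst q \<le> v q \<and> a \<le> u q \<and> v q \<le> b
          \<and> {u q..v q} \<subseteq> \<gamma> (fst q)" if q: "q \<in> p" for q
      proof -
        obtain t K where q': "q = (t, K)" by (cases q)
        obtain c d where K: "K = {c..d}"
          using tagged_division_ofD(4)[OF ptag, of t K] q q' by (auto simp: box_real)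
        have "t \<in> K" "K \<subseteq> {a..b}" "K \<subseteq> \<gamma> t"
          using tagged_division_ofD(2,3)[OF ptag, of t K] fine q q' by (auto simp: fine_def)
        with K show ?thesis by (auto simp: q' u_def v_def)
      qed
      have disj0: "{u q<..<v q} \<inter> {u q'<..<v q'} = {}" if "q \<in> p" "q' \<in> p" "q \<noteq> q'" for q q'
      proof -
        have "(fst q, snd q) \<in> p" "(fst q', snd q') \<in> p" "(fst q, snd q) \<noteq> (fst q', snd q')"
          using that by auto
        from tagged_division_ofD(5)[OF ptag this] show ?thesis
          using pK[OF that(1)] pK[OF that(2)] by (metis interior_atLeastAtMost_real)
      qed
      have disj: "disjoint_family_on (\<lambda>q. {u q<..<v q}) I" if "I \<subseteq> p" for I
        using disj0 that unfolding disjoint_family_on_def by blast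
      have ba: "b - a = (\<Sum>q\<in>p. v q - u q)" "x b - x a = (\<Sum>q\<in>p. x (v q) - x (u q))"
        using additive_tagged_division_1[where f= "\<lambda>x. x"] additive_tagged_division_1[where f= x]
            \<open>a \<le> b\<close> ptag by (auto simp: u_def v_def split_def)
      define pE where "pE = {q \<in> p. fst q \<in> E}"
      have finE: "finite pE" and pEp: "pE \<subseteq> p" using finp by (auto simp: pE_def)
      \<comment> \<open>The cells tagged in \<open>E\<close> do not overlap and lie in
        \<open>U\<close>, so their total length is below the \<open>d\<close> of absolute
        continuity.\<close>
      have "(\<Sum>q\<in>pE. v q - u q) = (\<Sum>q\<in>pE. measure lebesgue {u q<..<v q})"
        using pK pEp by (intro sum.cong) (auto dest!: pK)
      also have "\<dots> = measure lebesgue (\<Union>q\<in>pE. {u q<..<v q})"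
        using disj[OF pEp] finE
        by (intro measure_finite_Union[symmetric])
           (auto simp: less_top simp flip: box_real intro: emeasure_bounded_finite[unfolded infinity_ennreal_def])
      also have "\<dots> \<le> measure lebesgue U"
      proof (rule measure_mono_fmeasurable[OF _ _ Ulm])
        show "(\<Union>q\<in>pE. {u q<..<v q}) \<subseteq> U"
          using pK by (force simp: pE_def \<gamma>_def)
      qed (use finE in auto)
      finally have "(\<Sum>q\<in>pE. norm (x (v q) - x (u q))) < e * (b - a)"
        using pK pEp mU finE disj[OF pEp] by (intro d(2)[rule_format] conjI) force+
      moreover have "norm (\<Sum>q\<in>pE. measure lborel (snd q) *\<^sub>R g' (fst q) - (x (v q) - x (u q)))
          \<le> (\<Sum>q\<in>pE. norm (x (v q) - x (u q)))"
        by (rule sum_norm_le) (auto simp: pE_def g'_def norm_minus_commute)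
      ultimately have sE: "norm (\<Sum>q\<in>pE. measure lborel (snd q) *\<^sub>R g' (fst q) - (x (v q) - x (u q)))
          \<le> e * (b - a)" by simp
      have "norm (\<Sum>q\<in>p-pE. measure lborel (snd q) *\<^sub>R g' (fst q) - (x (v q) - x (u q)))
          \<le> (\<Sum>q\<in>p-pE. e * (v q - u q))"
      proof (rule sum_norm_le)
        fix q assume "q \<in> p - pE"
        then have q: "q \<in> p" "fst q \<notin> E" by (auto simp: pE_def)
        define t where "t = fst q"
        note k = pK[OF q(1), folded t_def]
        have tE: "t \<notin> E" using q by (simp add: t_def)
        then have sub: "{u q..v q} \<subseteq> ball t (r t)" using k by (simp add: \<gamma>_def)
        \<comment> \<open>Straddling: the tag lies between the endpoints, so the distances in the
          two linearisation errors add up to the length of the cell.\<close>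
        have "norm ((v q - u q) *\<^sub>R g t - (x (v q) - x (u q)))
            = norm (x (u q) - x t - (u q - t) *\<^sub>R g t - (x (v q) - x t - (v q - t) *\<^sub>R g t))"
          by (auto simp: algebra_simps)
        also have "\<dots> \<le> norm (x (u q) - x t - (u q - t) *\<^sub>R g t) + norm (x (v q) - x t - (v q - t) *\<^sub>R g t)"
          by (rule norm_triangle_ineq4)
        also have "\<dots> \<le> e * norm (u q - t) + e * norm (v q - t)"
        proof (intro add_mono r(2))
          have "u q \<in> {u q..v q}" "v q \<in> {u q..v q}" using k by auto
          then have "u q \<in> ball t (r t)" "v q \<in> ball t (r t)" using sub by (meson subsetD)+
          then show "norm (u q - t) < r t" "norm (v q - t) < r t"
            by (auto simp: dist_real_def)
        qed (use k tE in auto)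
        also have "\<dots> = e * (v q - u q)" using k by (simp add: algebra_simps)
        finally show "norm (measure lborel (snd q) *\<^sub>R g' (fst q) - (x (v q) - x (u q))) \<le> e * (v q - u q)"
          using k tE by (simp add: g'_def t_def)
      qed
      also have "\<dots> \<le> (\<Sum>q\<in>p. e * (v q - u q))"
        using finp \<open>e > 0\<close> by (intro sum_mono2) (auto dest!: pK)
      also have "\<dots> = e * (b - a)" by (simp add: ba(1) sum_distrib_left)
      finally have sN: "norm (\<Sum>q\<in>p-pE. measure lborel (snd q) *\<^sub>R g' (fst q) - (x (v q) - x (u q)))
          \<le> e * (b - a)" .
      have "(\<Sum>(t, K)\<in>p. measure lborel K *\<^sub>R g' t) - (x b - x a)
          = (\<Sum>q\<in>p. measure lborel (snd q) *\<^sub>R g' (fst q) - (x (v q) - x (u q)))"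
        by (simp add: ba(2) sum_subtractf split_def)
      also have "\<dots> = (\<Sum>q\<in>p-pE. measure lborel (snd q) *\<^sub>R g' (fst q) - (x (v q) - x (u q)))
          + (\<Sum>q\<in>pE. measure lborel (snd q) *\<^sub>R g' (fst q) - (x (v q) - x (u q)))"
        by (rule sum.subset_diff[OF pEp finp])
      finally have eq: "(\<Sum>(t, K)\<in>p. measure lborel K *\<^sub>R g' t) - (x b - x a) = \<dots>" .
      have "norm ((\<Sum>(t, K)\<in>p. measure lborel K *\<^sub>R g' t) - (x b - x a)) \<le> e * (b - a) + e * (b - a)"
        unfolding eq by (rule order_trans[OF norm_triangle_ineq add_mono[OF sN sE]])
      also have "\<dots> = \<epsilon> * measure lborel {a..b}" using ab by (simp add: e_def)
      finally show "norm ((\<Sum>(t, K)\<in>p. measure lborel K *\<^sub>R g' t) - (x b - x a)) \<le> \<epsilon> * measure lborel {a..b}" .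
    qed
  qed
  then show ?thesis
    by (rule has_integral_spike[OF negE, rotated]) (auto simp: g'_def)
qed (auto simp: has_integral_refl)

section \<open>Random paths\<close>

lemma set_integral_exp_minus:
  assumes "0 \<le> c"
  shows "set_integrable lborel {c..} (\<lambda>t::real. exp (- t))"
    and "(LINT t:{c..}|lborel. exp (- t)) = exp (- c)"
proof -
  show int: "set_integrable lborel {c..} (\<lambda>t::real. exp (- t))"
    using assms by (intro set_integrable_subset[OF set_integrable_exp_minus]) auto
  have "((\<lambda>t. exp (- t)) has_integral exp (- c)) {c..}"
    using has_integral_exp_minus_to_infinity[of 1 c] by simp
  then show "(LINT t:{c..}|lborel. exp (- t)) = exp (- c)"
    using set_borel_integral_eq_integral(2)[OF int] by (simp add: integral_unique)
qed

text \<open>The weight \<open>exp (- t)\<close> has total mass 1 and mass \<open>exp (- T)\<close>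
  beyond \<open>T\<close>. Before \<open>T\<close> the running distance is at most its value at
  \<open>T\<close>; afterwards it is at most 1 by truncation. Uniform closeness on one bounded
  interval therefore controls the metric.\<close>

lemma path_dist_le_running_dist:
  assumes "0 \<le> T"
  shows "path_dist f g \<le> running_dist f g T + exp (- T)"
proof -
  have 1: "set_integrable lborel {0..} (\<lambda>t. exp (- t) * running_dist f g T)"
    by (intro set_integrable_mult_left) (auto intro: set_integral_exp_minus)
  have 2: "set_integrable lborel {0..} (\<lambda>t. indicator {T..} t * exp (- t))"
  proof -
    have "(\<lambda>t. indicator {0..} t *\<^sub>R (indicator {T..} t * exp (- t)))
        = (\<lambda>t::real. indicator {T..} t *\<^sub>R exp (- t))"
      using assms by (auto simp: indicator_def)
    then show ?thesis using set_integral_exp_minus(1)[OF assms] by (simp add: set_integrable_def)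
  qed
  have "path_dist f g \<le> (LINT t:{0..}|lborel. exp (- t) * running_dist f g T + indicator {T..} t * exp (- t))"
    unfolding path_dist_eq
  proof (rule set_integral_mono[OF set_integrable_running_dist set_integral_add(1)[OF 1 2]])
    fix t :: real assume "t \<in> {0..}"
    then show "exp (- t) * running_dist f g t \<le> exp (- t) * running_dist f g T + indicator {T..} t * exp (- t)"
      using running_dist_mono[of t T f g] running_dist_le_1[of t f g] running_dist_nonneg[of T f g] assms
      by (cases "t \<le> T") (auto simp: indicator_def mult_left_le intro: add_increasing)
  qed
  also have "\<dots> = (LINT t:{0..}|lborel. exp (- t) * running_dist f g T)
      + (LINT t:{0..}|lborel. indicator {T..} t * exp (- t))"
    by (rule set_integral_add(2)[OF 1 2])
  also have "(LINT t:{0..}|lborel. indicator {T..} t * exp (- t)) = (LINT t:{T..}|lborel. exp (- t))"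
    unfolding set_lebesgue_integral_def
    using assms by (intro Bochner_Integration.integral_cong) (auto simp: indicator_def)
  also have "\<dots> = exp (- T)" by (rule set_integral_exp_minus(2)[OF assms])
  also have "(LINT t:{0..}|lborel. exp (- t) * running_dist f g T) = running_dist f g T"
    using set_integral_exp_minus(2)[of 0] by simp
  finally show ?thesis .
qed

lemma exp_minus_small:
  assumes "0 < e"
  obtains T :: real where "0 \<le> T" "exp (- T) < e"
proof (rule that[of "max 0 (1 - ln e)"])
  have "exp (- max 0 (1 - ln e)) \<le> exp (ln e - 1)" by auto
  also have "\<dots> < exp (ln e)" by simp
  finally show "exp (- max 0 (1 - ln e)) < e" using assms by simp
qed auto

lemma path_dist_le_uniform:
  assumes "\<And>s. 0 \<le> s \<Longrightarrow> dist (f s) (g s) \<le> c"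
  shows "path_dist f g \<le> c"
proof (rule field_le_epsilon)
  fix e :: real assume "0 < e"
  then obtain T where T: "0 \<le> T" "exp (- T) < e" by (rule exp_minus_small)
  have "running_dist f g T \<le> c"
    using assms T by (intro running_dist_le) (auto intro: min.coboundedI2)
  then show "path_dist f g \<le> c + e"
    using path_dist_le_running_dist[OF T(1), of f g] T(2) by simp
qed

section \<open>Topology and Borel sets of the path space\<close>

lemma topspace_path_topology: "topspace (path_topology :: (real \<Rightarrow> 'a::metric_space) topology) = path_space"
  unfolding path_topology_def by (rule Metric_space.topspace_mtopology[OF Metric_space_path])

lemma openin_path_topology:
  fixes U :: "(real \<Rightarrow> 'a::metric_space) set"
  shows "openin path_topology U \<longleftrightarrow>
    U \<subseteq> path_space \<and> (\<forall>p\<in>U. \<exists>r>0. \<forall>q\<in>path_space. path_dist p q < r \<longrightarrow> q \<in> U)"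
proof -
  interpret path: Metric_space "path_space :: (real \<Rightarrow> 'a) set" path_dist
    by (rule Metric_space_path)
  have "path.mball p r \<subseteq> U \<longleftrightarrow> (\<forall>q\<in>path_space. path_dist p q < r \<longrightarrow> q \<in> U)" if "p \<in> path_space" for p r
    using that by (auto simp: subset_eq)
  then show ?thesis
    unfolding path_topology_def path.openin_mtopology by (intro conj_cong refl) (simp add: subset_eq Ball_def[of U])
qed

lemma space_topology_borel: "space (topology_borel T) = topspace T"
  unfolding topology_borel_def by (intro space_measure_of) (auto dest: openin_subset)

lemma sets_topology_borel: "sets (topology_borel T) = sigma_sets (topspace T) {U. openin T U}"
  unfolding topology_borel_def by (intro sets_measure_of) (auto dest: openin_subset)

lemma borel_measurable_continuous_map:
  assumes "continuous_map T euclideanreal f"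
  shows "f \<in> borel_measurable (topology_borel T)"
proof (rule borel_measurableI)
  fix S :: "real set" assume "open S"
  then have "openin T {x \<in> topspace T. f x \<in> S}"
    using assms by (auto simp: continuous_map_def)
  moreover have "f -` S \<inter> space (topology_borel T) = {x \<in> topspace T. f x \<in> S}"
    by (auto simp: space_topology_borel)
  ultimately show "f -` S \<inter> space (topology_borel T) \<in> sets (topology_borel T)"
    by (simp add: sets_topology_borel sigma_sets.Basic)
qed

lemma measurable_topology_borelI:
  assumes "f \<in> space M \<rightarrow> topspace T" "\<And>U. openin T U \<Longrightarrow> f -` U \<inter> space M \<in> sets M"
  shows "f \<in> M \<rightarrow>\<^sub>M topology_borel T"
  unfolding topology_borel_def
  by (rule measurable_measure_of) (use assms in \<open>auto dest: openin_subset\<close>)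

section \<open>Piecewise linear interpolation and measurability of random paths\<close>

definition hat :: "real \<Rightarrow> nat \<Rightarrow> real" where
  "hat u k = max 0 (1 - \<bar>u - real k\<bar>)"

lemma hat_nonneg: "0 \<le> hat u k" and hat_le_1: "hat u k \<le> 1"
  by (auto simp: hat_def)

text \<open>At most two consecutive tents are nonzero at \<open>u\<close>, and their values are the
  two linear interpolation weights.\<close>

lemma sum_hat:
  assumes "0 \<le> u" "u \<le> real N"
  shows "(\<Sum>k\<le>N. hat u k) = 1"
  using assms
proof (induction N)
  case (Suc N)
  show ?case
  proof (cases "u \<le> real N")
    case True
    with Suc show ?thesis by (simp add: hat_def)
  next
    case False
    have "(\<Sum>k<N. hat u k) = 0"
      using False by (intro sum.neutral) (auto simp: hat_def)
    moreover have "(\<Sum>k\<le>Suc N. hat u k) = (\<Sum>k<N. hat u k) + hat u N + hat u (Suc N)"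
      by (simp add: lessThan_Suc_atMost[symmetric])
    ultimately show ?thesis using False Suc.prems by (auto simp: hat_def)
  qed
qed (auto simp: hat_def)

text \<open>With spacing \<open>1 / n\<close> and nodes up to \<open>n\<^sup>2\<close> the grid
  covers \<open>[0, n]\<close>, so that one parameter refines the mesh and extends the horizon. Only
  finitely many values of \<open>y\<close> enter.\<close>

definition hat_interpolation :: "nat \<Rightarrow> (nat \<Rightarrow> 'a::real_normed_vector) \<Rightarrow> real \<Rightarrow> 'a" where
  "hat_interpolation n y = restrict (\<lambda>t. \<Sum>k\<le>n\<^sup>2. hat (real n * t) k *\<^sub>R y k) {0..}"

lemma hat_interpolation_in_path_space: "hat_interpolation n y \<in> path_space"
proof -
  have "continuous_on {0..} (hat_interpolation n y) \<longleftrightarrow>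
      continuous_on {0..} (\<lambda>t. \<Sum>k\<le>n\<^sup>2. hat (real n * t) k *\<^sub>R y k)"
    by (rule continuous_on_cong) (auto simp: hat_interpolation_def)
  moreover have "continuous_on {0..} (\<lambda>t. \<Sum>k\<le>n\<^sup>2. hat (real n * t) k *\<^sub>R y k)"
    unfolding hat_def by (intro continuous_intros)
  ultimately show ?thesis by (simp add: path_space_def hat_interpolation_def)
qed

lemma path_dist_hat_interpolation:
  "path_dist (hat_interpolation n y) (hat_interpolation n y') \<le> (\<Sum>k\<le>n\<^sup>2. norm (y k - y' k))"
proof (rule path_dist_le_uniform)
  fix s :: real assume "0 \<le> s"
  then have "dist (hat_interpolation n y s) (hat_interpolation n y' s)
      = norm (\<Sum>k\<le>n\<^sup>2. hat (real n * s) k *\<^sub>R (y k - y' k))"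
    by (simp add: hat_interpolation_def dist_norm sum_subtractf scaleR_diff_right)
  also have "\<dots> \<le> (\<Sum>k\<le>n\<^sup>2. norm (y k - y' k))"
    by (rule sum_norm_le) (simp add: hat_nonneg hat_le_1 mult_left_le_one_le)
  finally show "dist (hat_interpolation n y s) (hat_interpolation n y' s) \<le> (\<Sum>k\<le>n\<^sup>2. norm (y k - y' k))" .
qed

text \<open>The interpolation is continuous in the sequence of nodal values for the product
  topology, because finitely many coordinates control the path metric. This reduces measurability of
  interpolated random paths to that of their coordinates.\<close>

lemma open_vimage_hat_interpolation:
  assumes U: "openin path_topology (U :: (real \<Rightarrow> 'a::real_normed_vector) set)"
  shows "open (hat_interpolation n -` U)"
proof (subst open_subopen, intro ballI)
  fix y assume "y \<in> hat_interpolation n -` U"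
  then obtain r where r: "r > 0" "\<And>q. q \<in> path_space \<Longrightarrow> path_dist (hat_interpolation n y) q < r \<Longrightarrow> q \<in> U"
    using U unfolding openin_path_topology by blast
  define V where "V = {y'. (\<Sum>k\<le>n\<^sup>2. norm (y k - y' k)) < r}"
  have "open V"
    unfolding V_def by (intro open_Collect_less continuous_intros continuous_on_product_coordinates)
  moreover have "y \<in> V" using r(1) by (simp add: V_def)
  moreover have "V \<subseteq> hat_interpolation n -` U"
  proof
    fix y' assume "y' \<in> V"
    then have "path_dist (hat_interpolation n y) (hat_interpolation n y') < r"
      using path_dist_hat_interpolation[of n y y'] by (simp add: V_def)
    from r(2)[OF hat_interpolation_in_path_space this] show "y' \<in> hat_interpolation n -` U" by simp
  qed
  ultimately show "\<exists>T. open T \<and> y \<in> T \<and> T \<subseteq> hat_interpolation n -` U" by blast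
qed

lemma hat_interpolation_converges:
  fixes p :: "real \<Rightarrow> 'a::real_normed_vector"
  assumes p: "continuous_on {0..} p" and "e > 0"
  shows "\<forall>\<^sub>F n in sequentially. path_dist (hat_interpolation n (\<lambda>k. p (k / n))) (restrict p {0..}) < e"
proof -
  obtain T :: real where T: "0 \<le> T" "exp (- T) < e / 2"
    using exp_minus_small[of "e/2"] \<open>e > 0\<close> by auto
  \<comment> \<open>The extra unit of time makes room for the node just to the right of a point near
    \<open>T\<close>.\<close>
  have "uniformly_continuous_on {0..T+1} p"
    by (rule compact_uniformly_continuous[OF continuous_on_subset[OF p]]) auto
  then obtain \<delta> where \<delta>: "\<delta> > 0"
      "\<And>s t. s \<in> {0..T+1} \<Longrightarrow> t \<in> {0..T+1} \<Longrightarrow> dist s t < \<delta> \<Longrightarrow> dist (p s) (p t) < e / 2"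
    unfolding uniformly_continuous_on_def using \<open>e > 0\<close> by (meson half_gt_zero)
  have "\<forall>\<^sub>F n in sequentially. real n > max (max 1 T) (1 / \<delta>)"
    using filterlim_real_sequentially filterlim_at_top_dense by blast
  then show ?thesis
  proof eventually_elim
    fix n :: nat assume n: "real n > max (max 1 T) (1 / \<delta>)"
    then have n0: "real n > 1" "real n > T" "1 / real n < \<delta>"
      using \<delta>(1) by (auto simp: field_simps)
    have "running_dist (hat_interpolation n (\<lambda>k. p (k / n))) (restrict p {0..}) T \<le> e / 2"
    proof (rule running_dist_le[OF T(1)])
      fix s :: real assume s: "0 \<le> s" "s \<le> T"
      have "real n * s \<le> real (n\<^sup>2)"
        using s n0 by (simp add: power2_eq_square)
      then have 1: "(\<Sum>k\<le>n\<^sup>2. hat (real n * s) k) = 1" using s by (intro sum_hat) auto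
      have near: "norm (p (k / n) - p s) \<le> e / 2" if "hat (real n * s) k \<noteq> 0" for k
      proof -
        have "\<bar>real n * s - real k\<bar> < 1" using that by (auto simp: hat_def)
        then have "\<bar>s - k / n\<bar> < 1 / n"
        proof -
          have "s - k / n = (real n * s - real k) / n" using n0 by (simp add: field_simps)
          then show ?thesis using \<open>\<bar>real n * s - real k\<bar> < 1\<close> n0 by (simp add: divide_strict_right_mono)
        qed
        moreover have "1 / real n < 1" using n0 by simp
        ultimately have "\<bar>s - k / n\<bar> < \<delta>" "\<bar>s - k / n\<bar> < 1" using n0 by linarith+
        then have "dist (k / n) s < \<delta>" "k / n \<in> {0..T+1}"
          using s by (auto simp: dist_real_def)
        then show ?thesis using \<delta>(2)[of "k / n" s] s by (auto simp: dist_norm)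
      qed
      \<comment> \<open>The weights sum to 1, so the error is an average of
        \<open>p (k / n) - p s\<close> over nodes within \<open>1 / n\<close> of
        \<open>s\<close>.\<close>
      have "dist (hat_interpolation n (\<lambda>k. p (k / n)) s) (restrict p {0..} s)
          = norm ((\<Sum>k\<le>n\<^sup>2. hat (real n * s) k *\<^sub>R p (k / n)) - (\<Sum>k\<le>n\<^sup>2. hat (real n * s) k) *\<^sub>R p s)"
        using s by (simp add: hat_interpolation_def dist_norm 1)
      also have "\<dots> = norm (\<Sum>k\<le>n\<^sup>2. hat (real n * s) k *\<^sub>R (p (k / n) - p s))"
        by (simp add: scaleR_sum_left sum_subtractf scaleR_diff_right)
      also have "\<dots> \<le> (\<Sum>k\<le>n\<^sup>2. hat (real n * s) k * (e / 2))"
      proof (rule sum_norm_le)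
        fix k
        show "norm (hat (real n * s) k *\<^sub>R (p (k / n) - p s)) \<le> hat (real n * s) k * (e / 2)"
        proof (cases "hat (real n * s) k = 0")
          case False
          then show ?thesis
            using mult_left_mono[OF near[OF False] hat_nonneg] by (simp add: hat_nonneg)
        qed simp
      qed
      also have "\<dots> = e / 2" by (subst sum_distrib_right[symmetric]) (simp add: 1)
      finally show "min 1 (dist (hat_interpolation n (\<lambda>k. p (k / n)) s) (restrict p {0..} s)) \<le> e / 2"
        by simp
    qed
    then show "path_dist (hat_interpolation n (\<lambda>k. p (k / n))) (restrict p {0..}) < e"
      using path_dist_le_running_dist[OF T(1), of "hat_interpolation n (\<lambda>k. p (k / n))" "restrict p {0..}"] T(2)
      by linarith
  qed
qed

lemma restrict_in_path_space: "restrict p {0..} \<in> path_space \<longleftrightarrow> continuous_on {0..} p"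
proof -
  have "continuous_on {0..} (restrict p {0..}) \<longleftrightarrow> continuous_on {0..} p"
    by (rule continuous_on_cong) auto
  then show ?thesis by (simp add: path_space_def)
qed

text \<open>The path is the limit of the interpolations of its values on finer and finer grids, which are
  continuous functions of countably many random variables; this avoids separability of the path
  space.\<close>

lemma measurable_path:
  fixes X :: "real \<Rightarrow> 'w \<Rightarrow> 'a::euclidean_space"
  assumes meas: "\<And>t. 0 \<le> t \<Longrightarrow> X t \<in> borel_measurable M"
    and cont: "\<And>\<omega>. \<omega> \<in> space M \<Longrightarrow> continuous_on {0..} (\<lambda>t. X t \<omega>)"
  shows "(\<lambda>\<omega>. restrict (\<lambda>t. X t \<omega>) {0..}) \<in> M \<rightarrow>\<^sub>M topology_borel path_topology"
proof (rule measurable_topology_borelI)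
  let ?P = "\<lambda>\<omega>. restrict (\<lambda>t. X t \<omega>) {0..}"
  let ?Q = "\<lambda>n \<omega>. hat_interpolation n (\<lambda>k. X (k / n) \<omega>)"
  have P: "?P \<omega> \<in> path_space" if "\<omega> \<in> space M" for \<omega>
    using cont[OF that] by (simp add: restrict_in_path_space)
  then show "?P \<in> space M \<rightarrow> topspace path_topology" by (simp add: topspace_path_topology)
  fix U :: "(real \<Rightarrow> 'a) set" assume U: "openin path_topology U"
  \<comment> \<open>Approximants that stay in \<open>U\<close> may have a limit outside
    \<open>U\<close>. The sets \<open>V m\<close> keep a margin from the complement, so membership
    of almost all approximants in one \<open>V m\<close> characterises a limit in \<open>U\<close>;
    the strict inequality for the radius makes \<open>V m\<close> open.\<close>
  define V where "V m = {p \<in> path_space. \<exists>r>1 / real (Suc m). \<forall>q\<in>path_space. path_dist p q < r \<longrightarrow> q \<in> U}" for m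
  note sym = Metric_space.commute[OF Metric_space_path]
  note tri = Metric_space.triangle[OF Metric_space_path]
  have V: "openin path_topology (V m)" for m
    unfolding openin_path_topology
  proof (intro conjI ballI)
    fix p assume "p \<in> V m"
    then obtain r where p: "p \<in> path_space" and r: "r > 1 / real (Suc m)"
      "\<And>q. q \<in> path_space \<Longrightarrow> path_dist p q < r \<Longrightarrow> q \<in> U" by (auto simp: V_def)
    show "\<exists>r>0. \<forall>q\<in>path_space. path_dist p q < r \<longrightarrow> q \<in> V m"
    \<comment> \<open>A move by half of the gap leaves around \<open>q\<close> a ball whose radius
      is the midpoint of \<open>1 / Suc m\<close> and \<open>r\<close>, still above the
      threshold.\<close>
    proof (intro exI[of _ "(r - 1 / real (Suc m)) / 2"] conjI ballI impI)
      fix q assume q: "q \<in> path_space" "path_dist p q < (r - 1 / real (Suc m)) / 2"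
      have "q' \<in> U" if q': "q' \<in> path_space" "path_dist q q' < (r + 1 / real (Suc m)) / 2" for q'
        using tri[OF p q(1) q'(1)] q(2) q' by (intro r(2)) auto
      then show "q \<in> V m" using q(1) r(1)
        by (auto simp: V_def intro!: exI[of _ "(r + 1 / real (Suc m)) / 2"])
    qed (use r in auto)
  qed (auto simp: V_def)
  have iff: "?P \<omega> \<in> U \<longleftrightarrow> (\<exists>m N. \<forall>n\<ge>N. ?Q n \<omega> \<in> V m)" if \<omega>: "\<omega> \<in> space M" for \<omega>
  proof
    assume "?P \<omega> \<in> U"
    then obtain r where r: "r > 0" "\<And>q. q \<in> path_space \<Longrightarrow> path_dist (?P \<omega>) q < r \<Longrightarrow> q \<in> U"
      using U unfolding openin_path_topology by blast
    obtain m where m: "1 / real (Suc m) < r / 2"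
      using nat_approx_posE[of "r/2"] r(1) by auto
    have "\<forall>\<^sub>F n in sequentially. path_dist (?Q n \<omega>) (?P \<omega>) < r / 2"
      using hat_interpolation_converges[OF cont[OF \<omega>], of "r/2"] r(1) by simp
    then have "\<forall>\<^sub>F n in sequentially. ?Q n \<omega> \<in> V m"
    proof eventually_elim
      fix n assume n: "path_dist (?Q n \<omega>) (?P \<omega>) < r / 2"
      have "q \<in> U" if q: "q \<in> path_space" "path_dist (?Q n \<omega>) q < r / 2" for q
        using tri[OF P[OF \<omega>] hat_interpolation_in_path_space q(1), of n "\<lambda>k. X (k / n) \<omega>"] n q(2)
        by (intro r(2)[OF q(1)]) (simp add: sym)
      with m show "?Q n \<omega> \<in> V m"
        unfolding V_def using hat_interpolation_in_path_space by blast
    qed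
    then show "\<exists>m N. \<forall>n\<ge>N. ?Q n \<omega> \<in> V m" by (auto simp: eventually_sequentially)
  next
    assume "\<exists>m N. \<forall>n\<ge>N. ?Q n \<omega> \<in> V m"
    then obtain m N where N: "\<And>n. n \<ge> N \<Longrightarrow> ?Q n \<omega> \<in> V m" by blast
    have "\<forall>\<^sub>F n in sequentially. path_dist (?Q n \<omega>) (?P \<omega>) < 1 / real (Suc m)"
      by (rule hat_interpolation_converges[OF cont[OF \<omega>]]) simp
    then obtain n where n: "n \<ge> N" "path_dist (?Q n \<omega>) (?P \<omega>) < 1 / real (Suc m)"
      by (auto simp: eventually_sequentially) (meson le_cases order_refl)
    then show "?P \<omega> \<in> U" using N[OF n(1)] P[OF \<omega>] by (auto simp: V_def)
  qed
  have Q: "?Q n -` V m \<inter> space M \<in> sets M" for n m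
  proof -
    have "(\<lambda>\<omega> k. X (real k / n) \<omega>) \<in> borel_measurable M"
      by (rule measurable_coordinatewise_then_product) (auto intro: meas)
    from measurable_sets[OF this borel_open[OF open_vimage_hat_interpolation[OF V]]]
    show ?thesis by (simp add: vimage_def)
  qed
  have "?P -` U \<inter> space M = (\<Union>m. \<Union>N. \<Inter>n\<in>{N..}. ?Q n -` V m \<inter> space M)"
  proof (rule set_eqI)
    fix \<omega>
    show "\<omega> \<in> ?P -` U \<inter> space M \<longleftrightarrow> \<omega> \<in> (\<Union>m. \<Union>N. \<Inter>n\<in>{N..}. ?Q n -` V m \<inter> space M)"
    proof (cases "\<omega> \<in> space M")
      case True
      then show ?thesis unfolding vimage_eq Int_iff UN_iff INT_iff iff[OF True] by auto
    qed auto
  qed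
  also have "\<dots> \<in> sets M" by (intro sets.countable_UN'' sets.countable_INT' image_subsetI Q) auto
  finally show "?P -` U \<inter> space M \<in> sets M" .
qed

text \<open>Since the limit is a single path, continuity of \<open>f\<close> there suffices. It is
  used where \<open>Y\<close> is below \<open>c\<close>; elsewhere \<open>f\<close> changes by at
  most \<open>2 * K\<close>, which is at most \<open>2 * K / c\<close> times \<open>Y\<close>, a
  pathwise form of Markov's inequality. Working with an integrable majorant \<open>Y\<close>
  requires no measurability of the supremum of the distance.\<close>

lemma weakly_converges_deterministic:
  fixes X :: "real \<Rightarrow> real \<Rightarrow> 'w \<Rightarrow> 'a::euclidean_space"
  assumes M: "\<And>l. l > 0 \<Longrightarrow> prob_space (M l)"
    and meas: "\<And>l t. l > 0 \<Longrightarrow> 0 \<le> t \<Longrightarrow> X l t \<in> borel_measurable (M l)"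
    and cont: "\<And>l \<omega>. l > 0 \<Longrightarrow> \<omega> \<in> space (M l) \<Longrightarrow> continuous_on {0..} (\<lambda>t. X l t \<omega>)"
    and z: "continuous_on {0..} z"
    and bound: "\<And>T c. 0 \<le> T \<Longrightarrow> 0 < c \<Longrightarrow> \<exists>Y. (\<forall>l>0. integrable (M l) (Y l) \<and> (\<forall>\<omega>. 0 \<le> Y l \<omega>) \<and>
       (AE \<omega> in M l. \<forall>t\<in>{0..T}. (dist (X l t \<omega>) (z t))\<^sup>2 \<le> c + Y l \<omega>)) \<and>
       ((\<lambda>l. \<integral>\<omega>. Y l \<omega> \<partial>M l) \<longlongrightarrow> 0) at_top"
  shows "weakly_converges path_topology (\<lambda>l. path_law (M l) (X l)) (deterministic_path_law z) at_top"
  unfolding weakly_converges_def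
proof (intro allI impI, elim conjE)
  fix f :: "(real \<Rightarrow> 'a) \<Rightarrow> real"
  assume f: "continuous_map path_topology euclideanreal f"
    and bdd: "bounded (f ` topspace path_topology)"
  note fm = borel_measurable_continuous_map[OF f]
  define \<zeta> where "\<zeta> = restrict z {0..}"
  have \<zeta>: "\<zeta> \<in> path_space" using z by (simp add: \<zeta>_def restrict_in_path_space)
  let ?P = "\<lambda>l \<omega>. restrict (\<lambda>t. X l t \<omega>) {0..}"
  have Pm: "?P l \<in> M l \<rightarrow>\<^sub>M topology_borel path_topology" if "l > 0" for l
    by (rule measurable_path) (use meas cont that in auto)
  have P: "?P l \<omega> \<in> path_space" if "l > 0" "\<omega> \<in> space (M l)" for l \<omega>
    using measurable_space[OF Pm[OF that(1)] that(2)] by (simp add: space_topology_borel topspace_path_topology)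
  obtain K where K: "K > 0" "\<And>p. p \<in> path_space \<Longrightarrow> \<bar>f p\<bar> \<le> K"
    using bdd by (auto simp: bounded_pos topspace_path_topology)
  have limit: "(\<integral>p. f p \<partial>deterministic_path_law z) = f \<zeta>"
    unfolding deterministic_path_law_def \<zeta>_def[symmetric]
    by (rule integral_return) (use \<zeta> fm in \<open>auto simp: space_topology_borel topspace_path_topology\<close>)
  have law: "(\<integral>p. f p \<partial>path_law (M l) (X l)) = (\<integral>\<omega>. f (?P l \<omega>) \<partial>M l)" if "l > 0" for l
    unfolding path_law_def by (rule integral_distr[OF Pm[OF that] fm])
  show "((\<lambda>l. \<integral>p. f p \<partial>path_law (M l) (X l)) \<longlongrightarrow> (\<integral>p. f p \<partial>deterministic_path_law z)) at_top"
    unfolding tendsto_iff limit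
  proof (intro allI impI)
    fix \<epsilon> :: real assume "\<epsilon> > 0"
    have "openin path_topology {p \<in> topspace path_topology. f p \<in> ball (f \<zeta>) (\<epsilon>/2)}" (is "openin _ ?B")
      by (rule openin_continuous_map_preimage[OF f]) simp
    moreover have "\<zeta> \<in> ?B" using \<zeta> \<open>\<epsilon> > 0\<close> by (simp add: topspace_path_topology)
    ultimately obtain \<delta> where \<delta>: "\<delta> > 0" "\<And>q. q \<in> path_space \<Longrightarrow> path_dist \<zeta> q < \<delta> \<Longrightarrow> q \<in> ?B"
      unfolding openin_path_topology by meson
    obtain T :: real where T: "0 \<le> T" "exp (- T) < \<delta> / 2"
      using exp_minus_small[of "\<delta>/2"] \<delta>(1) by auto
    \<comment> \<open>Where \<open>Y\<close> is below \<open>c\<close>, the squared distance is at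
      most \<open>2 * c\<close>, which is the square of \<open>\<delta> / 4\<close>; the truncated
      tail costs less than \<open>\<delta> / 2\<close> more.\<close>
    define c where "c = (\<delta> / 4)\<^sup>2 / 2"
    have "c > 0" using \<delta>(1) by (simp add: c_def)
    obtain Y where Y0: "\<forall>l>0. integrable (M l) (Y l) \<and> (\<forall>\<omega>. 0 \<le> Y l \<omega>) \<and>
          (AE \<omega> in M l. \<forall>t\<in>{0..T}. (dist (X l t \<omega>) (z t))\<^sup>2 \<le> c + Y l \<omega>)"
        and Ylim: "((\<lambda>l. \<integral>\<omega>. Y l \<omega> \<partial>M l) \<longlongrightarrow> 0) at_top"
      using bound[OF T(1) \<open>c > 0\<close>] by (elim exE conjE) (rule that)
    then have Y: "integrable (M l) (Y l)" "0 \<le> Y l \<omega>"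
        "AE \<omega> in M l. \<forall>t\<in>{0..T}. (dist (X l t \<omega>) (z t))\<^sup>2 \<le> c + Y l \<omega>" if "l > 0" for l \<omega>
      using that by blast+
    have est: "\<bar>(\<integral>\<omega>. f (?P l \<omega>) \<partial>M l) - f \<zeta>\<bar> \<le> \<epsilon> / 2 + 2 * K / c * (\<integral>\<omega>. Y l \<omega> \<partial>M l)" if l: "l > 0" for l
    proof -
      interpret prob_space "M l" by (rule M[OF l])
      have fPm: "(\<lambda>\<omega>. f (?P l \<omega>)) \<in> borel_measurable (M l)"
        using measurable_compose[OF Pm[OF l] fm] .
      have int: "integrable (M l) (\<lambda>\<omega>. f (?P l \<omega>))"
        by (rule integrable_const_bound[of _ K]) (use fPm P[OF l] K in auto)
      have "AE \<omega> in M l. \<bar>f (?P l \<omega>) - f \<zeta>\<bar> \<le> \<epsilon> / 2 + 2 * K / c * Y l \<omega>"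
        using Y(3)[OF l] AE_space
      proof eventually_elim
        fix \<omega> assume near: "\<forall>t\<in>{0..T}. (dist (X l t \<omega>) (z t))\<^sup>2 \<le> c + Y l \<omega>" and \<omega>: "\<omega> \<in> space (M l)"
        show "\<bar>f (?P l \<omega>) - f \<zeta>\<bar> \<le> \<epsilon> / 2 + 2 * K / c * Y l \<omega>"
        proof (cases "Y l \<omega> < c")
          case True
          have "dist (X l t \<omega>) (z t) \<le> \<delta> / 4" if "t \<in> {0..T}" for t
          proof (rule power2_le_imp_le)
            have "(dist (X l t \<omega>) (z t))\<^sup>2 \<le> c + c" using near True that by fastforce
            then show "(dist (X l t \<omega>) (z t))\<^sup>2 \<le> (\<delta> / 4)\<^sup>2" by (simp add: c_def)
          qed (use \<delta>(1) in auto)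
          then have "running_dist \<zeta> (?P l \<omega>) T \<le> \<delta> / 4"
            by (intro running_dist_le[OF T(1)]) (force simp: \<zeta>_def dist_commute min_le_iff_disj)
          then have "path_dist \<zeta> (?P l \<omega>) < \<delta>"
            using path_dist_le_running_dist[OF T(1), of \<zeta> "?P l \<omega>"] T(2) \<delta>(1) by linarith
          from \<delta>(2)[OF P[OF l \<omega>] this] have "\<bar>f (?P l \<omega>) - f \<zeta>\<bar> \<le> \<epsilon> / 2"
            by (simp add: dist_real_def abs_minus_commute)
          moreover have "0 \<le> 2 * K / c * Y l \<omega>" using K \<open>c > 0\<close> Y(2)[OF l] by simp
          ultimately show ?thesis by linarith
        next
          case False
          have "\<bar>f (?P l \<omega>) - f \<zeta>\<bar> \<le> 2 * K" using K(2)[OF P[OF l \<omega>]] K(2)[OF \<zeta>] by linarith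
          also have "2 * K \<le> 2 * K / c * Y l \<omega>"
            using False K \<open>c > 0\<close> by (simp add: field_simps)
          finally show ?thesis using \<open>\<epsilon> > 0\<close> by linarith
        qed
      qed
      then have "(\<integral>\<omega>. \<bar>f (?P l \<omega>) - f \<zeta>\<bar> \<partial>M l) \<le> (\<integral>\<omega>. \<epsilon> / 2 + 2 * K / c * Y l \<omega> \<partial>M l)"
        using int Y(1)[OF l] by (intro integral_mono_AE) auto
      also have "\<dots> = \<epsilon> / 2 + 2 * K / c * (\<integral>\<omega>. Y l \<omega> \<partial>M l)"
        using Y(1)[OF l] by (simp add: prob_space)
      finally have "(\<integral>\<omega>. \<bar>f (?P l \<omega>) - f \<zeta>\<bar> \<partial>M l) \<le> \<epsilon> / 2 + 2 * K / c * (\<integral>\<omega>. Y l \<omega> \<partial>M l)" .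
      moreover have "(\<integral>\<omega>. f (?P l \<omega>) - f \<zeta> \<partial>M l) = (\<integral>\<omega>. f (?P l \<omega>) \<partial>M l) - f \<zeta>"
        using int by (simp add: prob_space)
      ultimately show ?thesis
        using integral_abs_bound[of "M l" "\<lambda>\<omega>. f (?P l \<omega>) - f \<zeta>"] by linarith
    qed
    have "((\<lambda>l. \<epsilon> / 2 + 2 * K / c * (\<integral>\<omega>. Y l \<omega> \<partial>M l)) \<longlongrightarrow> \<epsilon> / 2 + 2 * K / c * 0) at_top"
      by (intro tendsto_intros Ylim)
    then have "\<forall>\<^sub>F l in at_top. \<epsilon> / 2 + 2 * K / c * (\<integral>\<omega>. Y l \<omega> \<partial>M l) < \<epsilon>"
      by (rule order_tendstoD(2)) (use \<open>\<epsilon> > 0\<close> in simp)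
    then show "\<forall>\<^sub>F l in at_top. dist (\<integral>p. f p \<partial>path_law (M l) (X l)) (f \<zeta>) < \<epsilon>"
      using eventually_gt_at_top[of 0]
    proof eventually_elim
      fix l :: real
      assume "\<epsilon> / 2 + 2 * K / c * (\<integral>\<omega>. Y l \<omega> \<partial>M l) < \<epsilon>" "0 < l"
      then show "dist (\<integral>p. f p \<partial>path_law (M l) (X l)) (f \<zeta>) < \<epsilon>"
        using est[of l] by (simp add: law dist_real_def)
    qed
  qed
qed

section \<open>The switching process\<close>

lemma subalgebra_process_past:
  assumes "\<And>u. 0 \<le> u \<Longrightarrow> X u \<in> M \<rightarrow>\<^sub>M count_space S"
  shows "subalgebra M (process_past M X s)"
  unfolding subalgebra_def process_past_def
proof
  have sub: "{X u -` B \<inter> space M | u B. 0 \<le> u \<and> u \<le> s} \<subseteq> sets M"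
  proof clarify
    fix u :: real and B assume "0 \<le> u"
    note X = assms[OF this]
    \<comment> \<open>Generators of the past use arbitrary sets \<open>B\<close>, whereas
      measurability of the state concerns subsets of \<open>S\<close>.\<close>
    have "X u -` B \<inter> space M = X u -` (B \<inter> S) \<inter> space M"
      using measurable_space[OF X] by auto
    then show "X u -` B \<inter> space M \<in> sets M"
      using measurable_sets[OF X, of "B \<inter> S"] by simp
  qed
  then show "space (sigma (space M) {X u -` B \<inter> space M | u B. 0 \<le> u \<and> u \<le> s}) = space M"
    by (intro space_measure_of) (auto dest: sets.sets_into_space)
  show "sets (sigma (space M) {X u -` B \<inter> space M | u B. 0 \<le> u \<and> u \<le> s}) \<subseteq> sets M"
    using sub by (subst sets_measure_of) (auto intro: sets.sigma_sets_subset[THEN subsetD])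
qed

lemma measurable_process_past:
  assumes "0 \<le> u" "u \<le> s"
  shows "X u \<in> process_past M X s \<rightarrow>\<^sub>M count_space UNIV"
proof (rule measurableI)
  have sub: "{X u -` B \<inter> space M | u B. 0 \<le> u \<and> u \<le> s} \<subseteq> Pow (space M)" by auto
  fix B
  have "X u -` B \<inter> space M \<in> {X u -` B \<inter> space M | u B. 0 \<le> u \<and> u \<le> s}"
    using assms by blast
  then show "X u -` B \<inter> space (process_past M X s) \<in> sets (process_past M X s)"
    unfolding process_past_def space_measure_of[OF sub] sets_measure_of[OF sub]
    by (rule sigma_sets.Basic)
qed auto

section \<open>Transition probabilities and correlations of the two-state process\<close>

text \<open>The rate matrix has the eigenvectors \<open>(1, 1)\<close> and \<open>(1, -1)\<close>
  with eigenvalues \<open>0\<close> and \<open>-2 * l\<close>. The term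
  \<open>of_bool (r = 0)\<close> is the power of the eigenvalue \<open>0\<close>, the sign comes
  from the second eigenvector.\<close>

lemma rate_power_switching_rates:
  assumes "j \<in> {0, 1}" "k \<in> {0, 1}"
  shows "rate_power {0, 1} (switching_rates l) r j k
    = (of_bool (r = 0) + (if j = k then 1 else -1) * (-2 * l) ^ r) / 2"
  using assms
proof (induction r arbitrary: j)
  case (Suc r)
  have IH: "rate_power {0, 1} (switching_rates l) r m k
      = (of_bool (r = 0) + (if m = k then 1 else -1) * (-2 * l) ^ r) / 2" if "m \<in> {0, 1}" for m
    using Suc.IH Suc.prems that by blast
  have IH0: "rate_power {0, 1} (switching_rates l) r 0 k
        = (of_bool (r = 0) + (if 0 = k then 1 else -1) * (-2 * l) ^ r) / 2"
    and IH1: "rate_power {0, 1} (switching_rates l) r 1 k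
        = (of_bool (r = 0) + (if 1 = k then 1 else -1) * (-2 * l) ^ r) / 2"
    by (rule IH; simp)+
  have "rate_power {0, 1} (switching_rates l) (Suc r) j k
      = switching_rates l j 0 * rate_power {0, 1} (switching_rates l) r 0 k
        + switching_rates l j 1 * rate_power {0, 1} (switching_rates l) r 1 k"
    by simp
  also have "\<dots> = (of_bool (Suc r = 0) + (if j = k then 1 else -1) * (-2 * l) ^ Suc r) / 2"
    unfolding IH0 IH1
    using Suc.prems by (auto simp: switching_rates_def field_simps)
  finally show ?case .
qed auto

lemma transition_prob_switching_rates:
  assumes "j \<in> {0, 1}" "k \<in> {0, 1}"
  shows "transition_prob {0, 1} (switching_rates l) h j k
    = (1 + (if j = k then 1 else -1) * exp (-2 * l * h)) / 2"
proof -
  define c :: real where "c = (if j = k then 1 else -1)"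
  have "(\<lambda>r. h ^ r / fact r * of_bool (r = 0)) sums (\<Sum>r\<in>{0}. h ^ r / fact r * of_bool (r = 0))"
    by (rule sums_finite) auto
  then have 1: "(\<lambda>r. h ^ r / fact r * of_bool (r = 0)) sums 1" by simp
  have "(\<lambda>r. c * ((-2 * l * h) ^ r /\<^sub>R fact r)) sums (c * exp (-2 * l * h))"
    by (intro sums_mult exp_converges)
  from sums_divide[OF sums_add[OF 1 this], of 2]
  have "(\<lambda>r. h ^ r / fact r * ((of_bool (r = 0) + c * (-2 * l) ^ r) / 2)) sums ((1 + c * exp (-2 * l * h)) / 2)"
  proof (rule sums_cong[THEN iffD1, rotated])
    fix r
    have "(-2 * l * h) ^ r = h ^ r * (-2 * l) ^ r" by (simp only: power_mult_distrib mult.commute)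
    then show "(h ^ r / fact r * of_bool (r = 0) + c * ((-2 * l * h) ^ r /\<^sub>R fact r)) / 2
        = h ^ r / fact r * ((of_bool (r = 0) + c * (-2 * l) ^ r) / 2)"
      by (simp only:) (simp add: field_simps)
  qed
  then show ?thesis
    unfolding transition_prob_def rate_power_switching_rates[OF assms] c_def[symmetric]
    by (rule sums_unique[symmetric])
qed

text \<open>The indicator of state 0 minus its stationary mean. With these values the active field,
  \<open>f\<close> or \<open>v\<close>, equals its average plus the spin times
  \<open>f - v\<close>.\<close>

definition spin :: "nat \<Rightarrow> real" where
  "spin j = (if j = 0 then 1 / 2 else - 1 / 2)"

lemma abs_spin: "\<bar>spin j\<bar> = 1 / 2"
  by (simp add: spin_def)

locale switching_process = prob_space M for M :: "'w measure" +
  fixes i :: "real \<Rightarrow> 'w \<Rightarrow> nat" and l :: real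
  assumes markov: "markov_jump_process M {0, 1} (switching_rates l) i"
begin

lemma measurable_state: "0 \<le> t \<Longrightarrow> i t \<in> M \<rightarrow>\<^sub>M count_space {0, 1}"
  using markov unfolding markov_jump_process_def by blast

lemma measurable_state_UNIV: "0 \<le> t \<Longrightarrow> i t \<in> M \<rightarrow>\<^sub>M count_space UNIV"
  by (rule measurable_compose[OF measurable_state]) auto

lemma state_cases: "0 \<le> t \<Longrightarrow> \<omega> \<in> space M \<Longrightarrow> i t \<omega> = 0 \<or> i t \<omega> = 1"
  using measurable_space[OF measurable_state] by fastforce

lemma right_continuous_state:
  "\<omega> \<in> space M \<Longrightarrow> 0 \<le> t \<Longrightarrow> \<forall>\<^sub>F s in at_right t. i s \<omega> = i t \<omega>"
  using markov unfolding markov_jump_process_def by blast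

lemma measurable_spin: "0 \<le> t \<Longrightarrow> (\<lambda>\<omega>. spin (i t \<omega>)) \<in> borel_measurable M"
  by (rule measurable_compose[OF measurable_state_UNIV]) auto

lemma integrable_spin_mult:
  "0 \<le> s \<Longrightarrow> 0 \<le> t \<Longrightarrow> integrable M (\<lambda>\<omega>. spin (i s \<omega>) * spin (i t \<omega>))"
  by (rule integrable_const_bound[of _ "1/4"]) (auto simp: abs_mult abs_spin intro!: measurable_spin borel_measurable_times)

text \<open>Conditioning on the past up to \<open>s\<close> turns the indicator of state 1 at time
  \<open>s + h\<close> into \<open>1 / 2 - exp (- 2 * l * h)\<close> times the spin at
  \<open>s\<close>. After multiplication by that spin its square is the constant
  \<open>1 / 4\<close>, and the law of the state at \<open>s\<close> drops out.\<close>

lemma expectation_spin_mult_shift: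
  assumes s: "0 \<le> s" and h: "0 \<le> h"
  shows "(\<integral>\<omega>. spin (i s \<omega>) * spin (i (s + h) \<omega>) \<partial>M) = exp (- 2 * l * h) / 4"
proof -
  let ?F = "process_past M i s"
  interpret finite_measure_subalgebra M ?F
    by unfold_locales (rule subalgebra_process_past[OF measurable_state])
  have sh: "0 \<le> s + h" using s h by simp
  define g where "g \<omega> = (indicator {1} (i (s + h) \<omega>) :: real)" for \<omega>
  define f where "f \<omega> = spin (i s \<omega>)" for \<omega>
  have gm: "g \<in> borel_measurable M" unfolding g_def
    by (rule measurable_compose[OF measurable_state_UNIV[OF sh]]) auto
  have fF: "f \<in> borel_measurable ?F" unfolding f_def
    by (rule measurable_compose[OF measurable_process_past[OF s order_refl]]) auto
  have fm: "f \<in> borel_measurable M" unfolding f_def by (rule measurable_spin[OF s])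
  have intf: "integrable M f"
    by (rule integrable_const_bound[of _ "1/2", OF AE_I2 fm]) (simp add: f_def abs_spin)
  have intfg: "integrable M (\<lambda>\<omega>. f \<omega> * g \<omega>)"
    by (rule integrable_const_bound[of _ "1/2", OF AE_I2 borel_measurable_times[OF fm gm]])
       (auto simp: f_def g_def abs_spin abs_mult indicator_def)
  have ff: "f \<omega> * f \<omega> = 1 / 4" for \<omega> by (simp add: f_def spin_def)
  have "AE \<omega> in M. real_cond_exp M ?F g \<omega> = transition_prob {0, 1} (switching_rates l) h (i s \<omega>) 1"
    using markov s h unfolding markov_jump_process_def g_def by blast
  then have ce: "AE \<omega> in M. f \<omega> * real_cond_exp M ?F g \<omega> = f \<omega> / 2 - exp (- 2 * l * h) / 4"
    using AE_space
  proof eventually_elim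
    fix \<omega> assume *: "real_cond_exp M ?F g \<omega> = transition_prob {0, 1} (switching_rates l) h (i s \<omega>) 1"
      and "\<omega> \<in> space M"
    then have st: "i s \<omega> = 0 \<or> i s \<omega> = 1" using state_cases[OF s] by blast
    have p: "transition_prob {0, 1} (switching_rates l) h (i s \<omega>) 1
        = (1 + (if i s \<omega> = 1 then 1 else -1) * exp (-2 * l * h)) / 2"
      by (rule transition_prob_switching_rates) (use st in auto)
    from st have rc: "real_cond_exp M ?F g \<omega> = 1 / 2 - exp (- 2 * l * h) * f \<omega>"
      unfolding * f_def p by (auto simp: spin_def diff_divide_distrib add_divide_distrib)
    have "f \<omega> * real_cond_exp M ?F g \<omega> = f \<omega> / 2 - exp (- 2 * l * h) * (f \<omega> * f \<omega>)"
      unfolding rc by (simp add: algebra_simps)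
    then show "f \<omega> * real_cond_exp M ?F g \<omega> = f \<omega> / 2 - exp (- 2 * l * h) / 4"
      unfolding ff by simp
  qed
  have "(\<integral>\<omega>. f \<omega> * g \<omega> \<partial>M) = (\<integral>\<omega>. f \<omega> * real_cond_exp M ?F g \<omega> \<partial>M)"
    by (rule real_cond_exp_intg(2)[OF intfg fF gm, symmetric])
  also have "\<dots> = (\<integral>\<omega>. f \<omega> / 2 - exp (- 2 * l * h) / 4 \<partial>M)"
    using ce fm by (intro integral_cong_AE) (auto intro!: borel_measurable_times borel_measurable_diff borel_measurable_divide)
  also have "\<dots> = (\<integral>\<omega>. f \<omega> \<partial>M) / 2 - exp (- 2 * l * h) / 4"
    using intf by (simp add: prob_space)
  finally have fg: "(\<integral>\<omega>. f \<omega> * g \<omega> \<partial>M) = (\<integral>\<omega>. f \<omega> \<partial>M) / 2 - exp (- 2 * l * h) / 4" .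
  \<comment> \<open>On the state space the spin is \<open>1 / 2\<close> minus the indicator of state
    1, so the mean of \<open>f\<close> cancels against the one in \<open>fg\<close>.\<close>
  have "(\<integral>\<omega>. spin (i s \<omega>) * spin (i (s + h) \<omega>) \<partial>M) = (\<integral>\<omega>. f \<omega> / 2 - f \<omega> * g \<omega> \<partial>M)"
    by (rule Bochner_Integration.integral_cong[OF refl])
       (use state_cases[OF sh] in \<open>fastforce simp: f_def g_def spin_def\<close>)
  also have "\<dots> = exp (- 2 * l * h) / 4"
    using intf intfg fg by simp
  finally show ?thesis .
qed

lemma expectation_spin_mult:
  assumes "0 \<le> s" "0 \<le> t"
  shows "(\<integral>\<omega>. spin (i s \<omega>) * spin (i t \<omega>) \<partial>M) = exp (- 2 * l * \<bar>t - s\<bar>) / 4"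
proof (cases "s \<le> t")
  case True
  then show ?thesis using expectation_spin_mult_shift[of s "t - s"] assms by simp
next
  case False
  then show ?thesis using expectation_spin_mult_shift[of t "s - t"] assms by (simp add: mult.commute)
qed

section \<open>Second moments of integrals of the spin\<close>

text \<open>Time is rounded up to a grid, so that each approximant involves countably many states;
  right-continuity identifies the limit. Negative times are sent to 0 to obtain a function on the
  whole line.\<close>

lemma joint_measurable_spin:
  "(\<lambda>p. spin (i (max 0 (fst p :: real)) (snd p))) \<in> borel_measurable (borel \<Otimes>\<^sub>M M)"
proof (rule borel_measurable_LIMSEQ_real)
  \<comment> \<open>The added 1 makes \<open>r n t\<close> exceed \<open>t\<close> strictly, also
    when \<open>t\<close> is a grid point, as convergence in \<open>at_right t\<close>
    demands.\<close>
  define r where "r n t = (real (nat \<lfloor>real (Suc n) * t\<rfloor>) + 1) / real (Suc n)" for n :: nat and t :: real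
  show "(\<lambda>p. spin (i (r n (max 0 (fst p))) (snd p))) \<in> borel_measurable (borel \<Otimes>\<^sub>M M)" for n
  proof -
    have "(\<lambda>p. spin (i ((real k + 1) / real (Suc n)) (snd p))) \<in> borel_measurable (borel \<Otimes>\<^sub>M M)" for k
      by (rule measurable_compose[OF measurable_snd measurable_spin]) auto
    moreover have "(\<lambda>p. nat \<lfloor>real (Suc n) * max 0 (fst p)\<rfloor>) \<in> (borel \<Otimes>\<^sub>M M) \<rightarrow>\<^sub>M count_space UNIV"
      by measurable
    ultimately show ?thesis unfolding r_def by (rule measurable_compose_countable)
  qed
  fix p :: "real \<times> 'w" assume "p \<in> space (borel \<Otimes>\<^sub>M M)"
  then have \<omega>: "snd p \<in> space M" by (auto simp: space_pair_measure)
  define t where "t = max 0 (fst p)"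
  have t: "0 \<le> t" by (simp add: t_def)
  have bounds: "t < r n t \<and> r n t \<le> t + 1 / real (Suc n)" for n
  proof -
    have "0 \<le> real (Suc n) * t" using t by simp
    then have "real (nat \<lfloor>real (Suc n) * t\<rfloor>) \<le> real (Suc n) * t"
      "real (Suc n) * t < real (nat \<lfloor>real (Suc n) * t\<rfloor>) + 1"
      by (simp_all add: of_nat_nat)
    then show ?thesis unfolding r_def by (simp add: field_simps del: of_nat_Suc)
  qed
  have "(\<lambda>n. r n t) \<longlonglongrightarrow> t"
  proof (rule tendsto_sandwich[OF _ _ tendsto_const])
    show "(\<lambda>n. t + 1 / real (Suc n)) \<longlonglongrightarrow> t"
      using tendsto_add[OF tendsto_const[of t] LIMSEQ_Suc[OF lim_1_over_n]] by simp
  qed (use bounds in \<open>auto intro!: always_eventually less_imp_le\<close>)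
  then have "filterlim (\<lambda>n. r n t) (at_right t) sequentially"
    using bounds by (intro filterlim_at_withinI) auto
  from this right_continuous_state[OF \<omega> t]
  have "\<forall>\<^sub>F n in sequentially. i (r n t) (snd p) = i t (snd p)"
    by (auto simp: filterlim_iff)
  then have "\<forall>\<^sub>F n in sequentially. spin (i (r n t) (snd p)) = spin (i t (snd p))"
    by eventually_elim simp
  then show "(\<lambda>n. spin (i (r n (max 0 (fst p))) (snd p))) \<longlonglongrightarrow> spin (i (max 0 (fst p)) (snd p))"
    unfolding t_def by (rule tendsto_eventually)
qed

lemma borel_measurable_spin_path:
  assumes "\<omega> \<in> space M"
  shows "(\<lambda>t. spin (i (max 0 t) \<omega>)) \<in> borel_measurable borel"
  using measurable_compose[OF measurable_Pair2'[OF assms] joint_measurable_spin] by simp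

text \<open>The square of an integral is a double integral over
  \<open>N \<Otimes>\<^sub>M N\<close>. Everything is bounded on finite measure spaces, so Fubini
  moves the expectation inside, where only the product of two spins is random because
  \<open>g\<close> is deterministic.\<close>

lemma norm_sq_integral_spin:
  fixes g :: "real \<Rightarrow> 'a::euclidean_space" and a b :: real
  assumes a: "0 \<le> a" and g[measurable]: "g \<in> borel_measurable borel" and B: "\<And>t. norm (g t) \<le> B"
  defines "N \<equiv> restrict_space lborel {a..b}"
  defines "J \<equiv> \<lambda>\<omega>. LINT t:{a..b}|lborel. spin (i t \<omega>) *\<^sub>R g t"
  shows "integrable M (\<lambda>\<omega>. (norm (J \<omega>))\<^sup>2)"
    and "(\<integral>\<omega>. (norm (J \<omega>))\<^sup>2 \<partial>M)
      = (\<integral>p. exp (- 2 * l * \<bar>snd p - fst p\<bar>) / 4 * (g (fst p) \<bullet> g (snd p)) \<partial>(N \<Otimes>\<^sub>M N))"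
proof -
  note joint_measurable_spin[measurable]
  define \<sigma> where "\<sigma> t \<omega> = spin (i (max 0 t) \<omega>)" for t \<omega>
  have \<sigma>m: "(\<lambda>p. \<sigma> (fst p) (snd p)) \<in> borel_measurable (borel \<Otimes>\<^sub>M M)"
    unfolding \<sigma>_def by measurable
  have B0: "0 \<le> B" using B[of 0] norm_ge_zero order_trans by blast
  have spN: "space N = {a..b}" by (simp add: N_def space_restrict_space)
  interpret N: finite_measure N
    unfolding N_def by (rule finite_measureI) (simp add: emeasure_restrict_space space_restrict_space emeasure_lborel_Icc_eq)
  interpret NN: pair_sigma_finite N N ..
  interpret P: finite_measure "N \<Otimes>\<^sub>M N"
    by (rule finite_measure_pair_measure) unfold_locales
  interpret PM: pair_sigma_finite "N \<Otimes>\<^sub>M N" M ..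
  interpret PMf: finite_measure "(N \<Otimes>\<^sub>M N) \<Otimes>\<^sub>M M"
    by (rule finite_measure_pair_measure) unfold_locales
  have idN: "(\<lambda>t. t) \<in> N \<rightarrow>\<^sub>M borel"
    unfolding N_def by (rule measurable_restrict_space1) simp
  define K where "K x = \<sigma> (fst (fst x)) (snd x) * \<sigma> (snd (fst x)) (snd x) * (g (fst (fst x)) \<bullet> g (snd (fst x)))" for x
  have gN: "g \<in> borel_measurable N" using measurable_compose[OF idN g] by simp
  have 1: "(\<lambda>x. \<sigma> (fst (fst x)) (snd x)) \<in> borel_measurable ((N \<Otimes>\<^sub>M N) \<Otimes>\<^sub>M M)"
  proof -
    have "(\<lambda>x. (fst (fst x), snd x)) \<in> (N \<Otimes>\<^sub>M N) \<Otimes>\<^sub>M M \<rightarrow>\<^sub>M borel \<Otimes>\<^sub>M M"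
      by (intro measurable_Pair measurable_snd measurable_compose[OF _ idN] measurable_compose[OF measurable_fst measurable_fst])
    from measurable_compose[OF this \<sigma>m] show ?thesis by simp
  qed
  have 2: "(\<lambda>x. \<sigma> (snd (fst x)) (snd x)) \<in> borel_measurable ((N \<Otimes>\<^sub>M N) \<Otimes>\<^sub>M M)"
  proof -
    have "(\<lambda>x. (snd (fst x), snd x)) \<in> (N \<Otimes>\<^sub>M N) \<Otimes>\<^sub>M M \<rightarrow>\<^sub>M borel \<Otimes>\<^sub>M M"
      by (intro measurable_Pair measurable_snd measurable_compose[OF _ idN] measurable_compose[OF measurable_fst measurable_snd])
    from measurable_compose[OF this \<sigma>m] show ?thesis by simp
  qed
  have Km: "K \<in> borel_measurable ((N \<Otimes>\<^sub>M N) \<Otimes>\<^sub>M M)"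
    unfolding K_def
    by (intro borel_measurable_times 1 2 borel_measurable_inner
        measurable_compose[OF measurable_fst measurable_compose[OF measurable_fst gN]]
        measurable_compose[OF measurable_fst measurable_compose[OF measurable_snd gN]])
  have Kb: "norm (K x) \<le> B\<^sup>2 / 4" for x
  proof -
    have "\<bar>g (fst (fst x)) \<bullet> g (snd (fst x))\<bar> \<le> B * B"
      using Cauchy_Schwarz_ineq2 B B0 by (meson mult_mono norm_ge_zero order_trans)
    then show ?thesis
      by (simp add: K_def \<sigma>_def abs_mult abs_spin power2_eq_square)
  qed
  have intK: "integrable ((N \<Otimes>\<^sub>M N) \<Otimes>\<^sub>M M) K"
    by (rule PMf.integrable_const_bound[OF AE_I2[OF Kb] Km])
  have J: "(norm (J \<omega>))\<^sup>2 = (\<integral>p. K (p, \<omega>) \<partial>(N \<Otimes>\<^sub>M N))" if \<omega>: "\<omega> \<in> space M" for \<omega>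
  proof -
    have \<sigma>\<omega>: "(\<lambda>t. \<sigma> t \<omega>) \<in> borel_measurable N"
      using measurable_compose[OF idN borel_measurable_spin_path[OF \<omega>]] by (simp add: \<sigma>_def)
    have int: "integrable N (\<lambda>t. \<sigma> t \<omega> *\<^sub>R g t)"
      by (rule N.integrable_const_bound[of _ "B / 2"])
         (use B gN \<sigma>\<omega> in \<open>auto simp: \<sigma>_def abs_spin intro!: borel_measurable_scaleR\<close>)
    have JN: "J \<omega> = (\<integral>t. \<sigma> t \<omega> *\<^sub>R g t \<partial>N)"
    proof -
      have "J \<omega> = (LINT t:{a..b}|lborel. \<sigma> t \<omega> *\<^sub>R g t)"
        unfolding J_def set_lebesgue_integral_def
        using a by (intro Bochner_Integration.integral_cong) (auto simp: \<sigma>_def indicator_def max_def)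
      also have "\<dots> = (\<integral>t. \<sigma> t \<omega> *\<^sub>R g t \<partial>N)"
        unfolding N_def set_lebesgue_integral_def by (rule integral_restrict_space[symmetric]) simp
      finally show ?thesis .
    qed
    have "(norm (J \<omega>))\<^sup>2 = J \<omega> \<bullet> J \<omega>" by (simp add: dot_square_norm)
    also have "\<dots> = (\<integral>s. (\<sigma> s \<omega> *\<^sub>R g s) \<bullet> J \<omega> \<partial>N)"
      using integral_inner_left[of "J \<omega>" N "\<lambda>t. \<sigma> t \<omega> *\<^sub>R g t", OF int] by (simp only: JN[symmetric])
    also have "\<dots> = (\<integral>s. \<integral>u. (\<sigma> s \<omega> *\<^sub>R g s) \<bullet> (\<sigma> u \<omega> *\<^sub>R g u) \<partial>N \<partial>N)"
      by (rule Bochner_Integration.integral_cong[OF refl], subst JN)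
         (rule integral_inner_right[symmetric], rule int)
    also have "\<dots> = (\<integral>s. \<integral>u. K ((s, u), \<omega>) \<partial>N \<partial>N)"
      by (simp add: K_def mult_ac)
    also have "\<dots> = (\<integral>p. K (p, \<omega>) \<partial>(N \<Otimes>\<^sub>M N))"
    proof (rule NN.integral_fst')
      have "(\<lambda>p. K (p, \<omega>)) \<in> borel_measurable (N \<Otimes>\<^sub>M N)"
        by (rule measurable_compose[OF measurable_Pair2'[OF \<omega>] Km])
      then show "integrable (N \<Otimes>\<^sub>M N) (\<lambda>p. K (p, \<omega>))"
        by (intro P.integrable_const_bound[OF AE_I2[OF Kb]])
    qed
    finally show ?thesis .
  qed
  have "integrable M (\<lambda>\<omega>. \<integral>p. K (p, \<omega>) \<partial>(N \<Otimes>\<^sub>M N))"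
    using PM.integrable_snd[of "\<lambda>p \<omega>. K (p, \<omega>)"] intK by (simp add: case_prod_unfold)
  then show "integrable M (\<lambda>\<omega>. (norm (J \<omega>))\<^sup>2)"
    by (rule Bochner_Integration.integrable_cong[THEN iffD1, OF refl, rotated]) (simp add: J)
  have "(\<integral>\<omega>. (norm (J \<omega>))\<^sup>2 \<partial>M) = (\<integral>\<omega>. \<integral>p. K (p, \<omega>) \<partial>(N \<Otimes>\<^sub>M N) \<partial>M)"
    by (rule Bochner_Integration.integral_cong[OF refl]) (rule J)
  also have "\<dots> = (\<integral>p. \<integral>\<omega>. K (p, \<omega>) \<partial>M \<partial>(N \<Otimes>\<^sub>M N))"
    using PM.Fubini_integral[of "\<lambda>p \<omega>. K (p, \<omega>)"] intK by (simp add: case_prod_unfold)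
  also have "\<dots> = (\<integral>p. exp (- 2 * l * \<bar>snd p - fst p\<bar>) / 4 * (g (fst p) \<bullet> g (snd p)) \<partial>(N \<Otimes>\<^sub>M N))"
  proof (rule Bochner_Integration.integral_cong[OF refl])
    fix p assume "p \<in> space (N \<Otimes>\<^sub>M N)"
    then have p: "0 \<le> fst p" "0 \<le> snd p" using a by (auto simp: space_pair_measure spN)
    then show "(\<integral>\<omega>. K (p, \<omega>) \<partial>M) = exp (- 2 * l * \<bar>snd p - fst p\<bar>) / 4 * (g (fst p) \<bullet> g (snd p))"
      using integrable_spin_mult[OF p] by (simp add: K_def \<sigma>_def expectation_spin_mult[OF p])
  qed
  finally show "(\<integral>\<omega>. (norm (J \<omega>))\<^sup>2 \<partial>M)
      = (\<integral>p. exp (- 2 * l * \<bar>snd p - fst p\<bar>) / 4 * (g (fst p) \<bullet> g (snd p)) \<partial>(N \<Otimes>\<^sub>M N))" .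
qed

end

text \<open>Dominated convergence: the exponential tends to 0 off the diagonal, and the diagonal is
  a null set of the product measure.\<close>

lemma integral_exp_decay_tendsto_0:
  fixes g :: "real \<Rightarrow> 'a::euclidean_space" and a b :: real
  assumes g: "g \<in> borel_measurable borel" and B: "\<And>t. norm (g t) \<le> B"
  defines "N \<equiv> restrict_space lborel {a..b}"
  shows "((\<lambda>l. \<integral>p. exp (- 2 * l * \<bar>snd p - fst p\<bar>) / 4 * (g (fst p) \<bullet> g (snd p)) \<partial>(N \<Otimes>\<^sub>M N)) \<longlongrightarrow> 0) at_top"
proof -
  interpret N: finite_measure N
    unfolding N_def by (rule finite_measureI) (simp add: emeasure_restrict_space space_restrict_space emeasure_lborel_Icc_eq)
  interpret NN: pair_sigma_finite N N ..
  interpret P: finite_measure "N \<Otimes>\<^sub>M N"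
    by (rule finite_measure_pair_measure) unfold_locales
  have B0: "0 \<le> B" using B[of 0] norm_ge_zero order_trans by blast
  have idN: "(\<lambda>t. t) \<in> N \<rightarrow>\<^sub>M borel"
    unfolding N_def by (rule measurable_restrict_space1) simp
  have gN: "g \<in> borel_measurable N" using measurable_compose[OF idN g] by simp
  have f: "fst \<in> N \<Otimes>\<^sub>M N \<rightarrow>\<^sub>M borel" "snd \<in> N \<Otimes>\<^sub>M N \<rightarrow>\<^sub>M borel"
    using measurable_compose[OF measurable_fst idN] measurable_compose[OF measurable_snd idN] by auto
  have diag: "AE p in N \<Otimes>\<^sub>M N. fst p \<noteq> snd p"
  proof (rule NN.AE_pair_measure)
    show "{p \<in> space (N \<Otimes>\<^sub>M N). fst p \<noteq> snd p} \<in> sets (N \<Otimes>\<^sub>M N)"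
      using borel_measurable_neq[OF f] by simp
    show "AE x in N. AE y in N. fst (x, y) \<noteq> snd (x, y)"
    proof (rule AE_I2)
      fix x :: real
      have "AE y in lborel. y \<noteq> x" by (rule AE_lborel_singleton)
      then show "AE y in N. fst (x, y) \<noteq> snd (x, y)"
        unfolding N_def by (subst AE_restrict_space_iff) (auto elim: eventually_mono)
    qed
  qed
  have "((\<lambda>l. \<integral>p. exp (- 2 * l * \<bar>snd p - fst p\<bar>) / 4 * (g (fst p) \<bullet> g (snd p)) \<partial>(N \<Otimes>\<^sub>M N))
      \<longlongrightarrow> (\<integral>p. 0 \<partial>(N \<Otimes>\<^sub>M N))) at_top"
  proof (rule integral_dominated_convergence_at_top[where w = "\<lambda>_. B\<^sup>2"])
    show "(\<lambda>p. exp (- 2 * l * \<bar>snd p - fst p\<bar>) / 4 * (g (fst p) \<bullet> g (snd p))) \<in> borel_measurable (N \<Otimes>\<^sub>M N)" for l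
      using measurable_compose[OF measurable_fst gN] measurable_compose[OF measurable_snd gN] f
      by measurable
    show "AE p in N \<Otimes>\<^sub>M N. ((\<lambda>l. exp (- 2 * l * \<bar>snd p - fst p\<bar>) / 4 * (g (fst p) \<bullet> g (snd p))) \<longlongrightarrow> 0) at_top"
      using diag
    proof eventually_elim
      fix p :: "real \<times> real" assume "fst p \<noteq> snd p"
      then have c: "0 < 2 * \<bar>snd p - fst p\<bar>" by simp
      have "filterlim (\<lambda>l. l * (2 * \<bar>snd p - fst p\<bar>)) at_top at_top"
        by (rule filterlim_at_top_mult_tendsto_pos[OF tendsto_const c filterlim_ident])
      then have "((\<lambda>l. exp (- (l * (2 * \<bar>snd p - fst p\<bar>)))) \<longlongrightarrow> 0) at_top"
        by (intro filterlim_compose[OF exp_at_bot]) (simp add: filterlim_uminus_at_top)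
      from tendsto_mult[OF tendsto_divide[OF this tendsto_const[of 4]] tendsto_const[of "g (fst p) \<bullet> g (snd p)"]]
      show "((\<lambda>l. exp (- 2 * l * \<bar>snd p - fst p\<bar>) / 4 * (g (fst p) \<bullet> g (snd p))) \<longlongrightarrow> 0) at_top"
        by (simp add: mult_ac)
    qed
    show "\<forall>\<^sub>F l in at_top. AE p in N \<Otimes>\<^sub>M N. norm (exp (- 2 * l * \<bar>snd p - fst p\<bar>) / 4 * (g (fst p) \<bullet> g (snd p))) \<le> B\<^sup>2"
      using eventually_ge_at_top[of 0]
    proof eventually_elim
      fix l :: real assume l: "0 \<le> l"
      show "AE p in N \<Otimes>\<^sub>M N. norm (exp (- 2 * l * \<bar>snd p - fst p\<bar>) / 4 * (g (fst p) \<bullet> g (snd p))) \<le> B\<^sup>2"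
      proof (rule AE_I2)
        fix p :: "real \<times> real"
        have "\<bar>g (fst p) \<bullet> g (snd p)\<bar> \<le> B * B"
          using Cauchy_Schwarz_ineq2 B B0 by (meson mult_mono norm_ge_zero order_trans)
        moreover have "exp (- 2 * l * \<bar>snd p - fst p\<bar>) / 4 \<le> 1"
          using l by (smt (verit) exp_le_one_iff mult_nonneg_nonneg abs_ge_zero mult_minus_left divide_le_eq_1)
        ultimately have "exp (- 2 * l * \<bar>snd p - fst p\<bar>) / 4 * \<bar>g (fst p) \<bullet> g (snd p)\<bar> \<le> 1 * (B * B)"
          by (intro mult_mono) auto
        then show "norm (exp (- 2 * l * \<bar>snd p - fst p\<bar>) / 4 * (g (fst p) \<bullet> g (snd p))) \<le> B\<^sup>2"
          by (simp add: abs_mult power2_eq_square)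
      qed
    qed
  qed auto
  then show ?thesis by simp
qed

section \<open>Switched paths near the averaged flow\<close>

lemma abs_continuous_on_subset:
  assumes "abs_continuous_on a b x" "a \<le> a'" "b' \<le> b"
  shows "abs_continuous_on a' b' x"
  unfolding abs_continuous_on_def
proof (intro allI impI)
  fix e :: real assume e: "e > 0"
  obtain d where d: "d > 0" "\<forall>(N::nat) u v.
        (\<forall>k<N. a \<le> u k \<and> u k \<le> v k \<and> v k \<le> b) \<and>
        (\<forall>k<N. \<forall>l<N. k \<noteq> l \<longrightarrow> {u k<..<v k} \<inter> {u l<..<v l} = {}) \<and>
        (\<Sum>k<N. v k - u k) < d \<longrightarrow> (\<Sum>k<N. norm (x (v k) - x (u k))) < e"
    using assms(1)[unfolded abs_continuous_on_def, rule_format, OF e] by (elim exE conjE) (rule that)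
  show "\<exists>d>0. \<forall>(N::nat) u v.
        (\<forall>k<N. a' \<le> u k \<and> u k \<le> v k \<and> v k \<le> b') \<and>
        (\<forall>k<N. \<forall>l<N. k \<noteq> l \<longrightarrow> {u k<..<v k} \<inter> {u l<..<v l} = {}) \<and>
        (\<Sum>k<N. v k - u k) < d \<longrightarrow> (\<Sum>k<N. norm (x (v k) - x (u k))) < e"
  proof (intro exI[of _ d] conjI allI impI d(1); elim conjE)
    fix N :: nat and u v :: "nat \<Rightarrow> real"
    assume 1: "\<forall>k<N. a' \<le> u k \<and> u k \<le> v k \<and> v k \<le> b'"
      and 2: "\<forall>k<N. \<forall>l<N. k \<noteq> l \<longrightarrow> {u k<..<v k} \<inter> {u l<..<v l} = {}"
      and 3: "(\<Sum>k<N. v k - u k) < d"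
    have "\<forall>k<N. a \<le> u k \<and> u k \<le> v k \<and> v k \<le> b" using 1 assms(2,3) by force
    with 2 3 show "(\<Sum>k<N. norm (x (v k) - x (u k))) < e" by (intro d(2)[rule_format] conjI)
  qed
qed

lemma abs_continuous_on_imp_continuous_on:
  fixes x :: "real \<Rightarrow> 'a::real_normed_vector"
  assumes "abs_continuous_on a b x"
  shows "continuous_on {a..b} x"
  unfolding continuous_on_iff
proof (intro ballI allI impI)
  fix t e :: real assume t: "t \<in> {a..b}" and "e > 0"
  obtain d where d: "d > 0" "\<forall>I (u :: nat \<Rightarrow> real) v. finite I \<and>
     (\<forall>k\<in>I. a \<le> u k \<and> u k \<le> v k \<and> v k \<le> b) \<and>
     disjoint_family_on (\<lambda>k. {u k<..<v k}) I \<and>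
     (\<Sum>k\<in>I. v k - u k) < d \<longrightarrow> (\<Sum>k\<in>I. norm (x (v k) - x (u k))) < e"
    using abs_continuous_on_finite_family[OF assms \<open>e > 0\<close>, where 'i = nat] by (elim exE conjE) (rule that)
  have "norm (x (max s t) - x (min s t)) < e" if s: "s \<in> {a..b}" "dist s t < d" for s
    using d(2)[rule_format, of "{0}" "\<lambda>_. min s t" "\<lambda>_. max s t"] s t
    by (cases "s \<le> t") (auto simp: disjoint_family_on_def dist_real_def)
  then have "dist (x s) (x t) < e" if "s \<in> {a..b}" "dist s t < d" for s
    using that by (fastforce simp: dist_norm max_def min_def norm_minus_commute split: if_splits)
  then show "\<exists>d>0. \<forall>s\<in>{a..b}. dist s t < d \<longrightarrow> dist (x s) (x t) < e"
    using d(1) by blast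
qed

text \<open>A derivative is selected pointwise and integrated. The gauge integral asks for no
  measurability of the selection, so \<open>Hilbert_Choice\<close> may be used freely.\<close>

lemma lipschitz_on_of_bounded_derivative:
  fixes x :: "real \<Rightarrow> 'a::banach"
  assumes ac: "abs_continuous_on a b x" and C: "0 \<le> C"
    and der: "AE t in lebesgue. t \<in> {a..b} \<longrightarrow>
      (\<exists>v. norm v \<le> C \<and> (x has_vector_derivative v) (at t within {a..b}))"
  shows "C-lipschitz_on {a..b} x"
proof -
  define ok where "ok t v \<longleftrightarrow> norm v \<le> C \<and> (x has_vector_derivative v) (at t within {a..b})" for t v
  \<comment> \<open>The default 0 keeps the bound \<open>C\<close> valid on the exceptional null set
    too.\<close>
  define g where "g t = (if \<exists>v. ok t v then SOME v. ok t v else 0)" for t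
  have g: "ok t (g t)" if "\<exists>v. ok t v" for t using someI_ex[OF that] that by (simp add: g_def)
  have gC: "norm (g t) \<le> C" for t using g[of t] C by (cases "\<exists>v. ok t v") (auto simp: ok_def g_def)
  have 1: "norm (x t - x s) \<le> C * (t - s)" if st: "s \<le> t" "s \<in> {a..b}" "t \<in> {a..b}" for s t
  proof -
    have "(g has_integral (x t - x s)) {s..t}"
    proof (rule fundamental_theorem_of_calculus_abs_continuous[OF st(1)])
      show "abs_continuous_on s t x" by (rule abs_continuous_on_subset[OF ac]) (use st in auto)
      show "AE r in lebesgue. r \<in> {s..t} \<longrightarrow> (x has_vector_derivative g r) (at r within {s..t})"
        using der
      proof eventually_elim
        case (elim r)
        show ?case
        proof
          assume r: "r \<in> {s..t}"
          then have "\<exists>v. ok r v" using elim st by (auto simp: ok_def)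
          from g[OF this] show "(x has_vector_derivative g r) (at r within {s..t})"
            unfolding ok_def using st by (auto elim: has_vector_derivative_within_subset)
        qed
      qed
    qed
    from has_integral_bound[OF C, of g _ s t] this gC show ?thesis
      using st by (simp add: box_real)
  qed
  show ?thesis
  proof (rule lipschitz_onI[OF _ C])
    fix s t assume "s \<in> {a..b}" "t \<in> {a..b}"
    then show "dist (x s) (x t) \<le> C * dist s t"
      using 1[of s t] 1[of t s] by (cases "s \<le> t") (auto simp: dist_norm norm_minus_commute)
  qed
qed

lemma lipschitz_on_inner:
  fixes f g :: "'b::metric_space \<Rightarrow> 'a::real_inner"
  assumes f: "C-lipschitz_on X f" and g: "D-lipschitz_on X g"
    and A: "\<And>t. t \<in> X \<Longrightarrow> norm (f t) \<le> A" and B: "\<And>t. t \<in> X \<Longrightarrow> norm (g t) \<le> B"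
    and AB: "0 \<le> A" "0 \<le> B"
  shows "(A * D + B * C)-lipschitz_on X (\<lambda>t. f t \<bullet> g t)"
proof (rule lipschitz_onI)
  show "0 \<le> A * D + B * C"
    using AB lipschitz_on_nonneg[OF f] lipschitz_on_nonneg[OF g] by simp
  fix s t assume st: "s \<in> X" "t \<in> X"
  have "f s \<bullet> g s - f t \<bullet> g t = f s \<bullet> (g s - g t) + (f s - f t) \<bullet> g t"
    by (simp add: inner_diff_left inner_diff_right)
  also have "\<bar>\<dots>\<bar> \<le> norm (f s) * norm (g s - g t) + norm (f s - f t) * norm (g t)"
    by (rule order_trans[OF abs_triangle_ineq add_mono[OF Cauchy_Schwarz_ineq2 Cauchy_Schwarz_ineq2]])
  also have "\<dots> \<le> A * (D * dist s t) + (C * dist s t) * B"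
    using A[OF st(1)] B[OF st(2)] AB lipschitz_onD[OF f st] lipschitz_onD[OF g st] lipschitz_on_nonneg[OF f]
    by (intro add_mono mult_mono) (auto simp: dist_norm)
  finally show "dist (f s \<bullet> g s) (f t \<bullet> g t) \<le> (A * D + B * C) * dist s t"
    by (simp add: dist_real_def algebra_simps)
qed

lemma lipschitz_on_exp_decay:
  fixes c :: real
  assumes "0 \<le> c"
  shows "c-lipschitz_on {0..} (\<lambda>t. exp (- c * t))"
proof (rule lipschitz_onI[OF _ assms])
  have 1: "\<bar>exp (- c * s) - exp (- c * t)\<bar> \<le> c * (t - s)" if "0 \<le> s" "s \<le> t" for s t :: real
  proof -
    \<comment> \<open>The first factor is at most 1 and \<open>1 - exp (- y)\<close> is at most
      \<open>y\<close>.\<close>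
    have "exp (- c * s) - exp (- c * t) = exp (- c * s) * (1 - exp (- c * (t - s)))"
      by (simp add: algebra_simps flip: exp_add)
    moreover have "exp (- c * s) \<le> 1" using that assms by simp
    moreover have "0 \<le> 1 - exp (- c * (t - s))" using that assms by simp
    moreover have "1 - exp (- c * (t - s)) \<le> c * (t - s)"
      using exp_ge_add_one_self[of "- c * (t - s)"] by simp
    ultimately show ?thesis
      using mult_mono[of "exp (- c * s)" 1 "1 - exp (- c * (t - s))" "c * (t - s)"] by simp
  qed
  fix s t :: real assume "s \<in> {0..}" "t \<in> {0..}"
  then show "dist (exp (- c * s)) (exp (- c * t)) \<le> c * dist s t"
    using 1[of s t] 1[of t s] by (cases "s \<le> t") (auto simp: dist_real_def abs_minus_commute)
qed

lemma increment_le_integral: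
  fixes \<phi> q :: "real \<Rightarrow> real"
  assumes ab: "a \<le> b" and \<phi>: "C-lipschitz_on {a..b} \<phi>" and q: "q integrable_on {a..b}"
    and der: "AE t in lebesgue. t \<in> {a..b} \<longrightarrow> (\<exists>D\<le>q t. (\<phi> has_vector_derivative D) (at t within {a..b}))"
  shows "\<phi> b - \<phi> a \<le> integral {a..b} q"
proof -
  define ok where "ok t D \<longleftrightarrow> D \<le> q t \<and> (\<phi> has_vector_derivative D) (at t within {a..b})" for t D
  \<comment> \<open>The default \<open>q t\<close> makes \<open>g\<close> lie below \<open>q\<close>
    at every point, not only almost everywhere.\<close>
  define g where "g t = (if \<exists>D. ok t D then SOME D. ok t D else q t)" for t
  have g: "ok t (g t)" if "\<exists>D. ok t D" for t using someI_ex[OF that] that by (simp add: g_def)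
  have gq: "g t \<le> q t" for t using g[of t] by (cases "\<exists>D. ok t D") (auto simp: ok_def g_def)
  have "(g has_integral (\<phi> b - \<phi> a)) {a..b}"
  proof (rule fundamental_theorem_of_calculus_abs_continuous[OF ab lipschitz_on_imp_abs_continuous_on[OF \<phi>]])
    show "AE t in lebesgue. t \<in> {a..b} \<longrightarrow> (\<phi> has_vector_derivative g t) (at t within {a..b})"
      using der
    proof eventually_elim
      case (elim t)
      then have "\<exists>D. ok t D" if "t \<in> {a..b}" using that by (auto simp: ok_def)
      with g show ?case by (auto simp: ok_def)
    qed
  qed
  from has_integral_le[OF this integrable_integral[OF q]] gq show ?thesis by simp
qed

section \<open>Induction along an interval and comparison across jumps\<close>

text \<open>Real induction: at the infimum of the counterexamples \<open>closed\<close> yields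
  \<open>P\<close>, and \<open>step\<close> then excludes counterexamples shortly after it.\<close>

lemma interval_induct [consumes 1, case_names closed step]:
  fixes a b t :: real
  assumes t: "t \<in> {a..b}"
    and closed: "\<And>t. t \<in> {a..b} \<Longrightarrow> (\<And>s. a \<le> s \<Longrightarrow> s < t \<Longrightarrow> P s) \<Longrightarrow> P t"
    and step: "\<And>t. a \<le> t \<Longrightarrow> t < b \<Longrightarrow> P t \<Longrightarrow> \<exists>r>t. \<forall>s\<in>{t..r}. s \<le> b \<longrightarrow> P s"
  shows "P t"
proof (rule ccontr)
  assume "\<not> P t"
  define S where "S = {t \<in> {a..b}. \<not> P t}"
  have S: "S \<noteq> {}" "bdd_below S" using t \<open>\<not> P t\<close> by (auto simp: S_def)
  define m where "m = Inf S"
  have m: "m \<in> {a..b}"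
  proof -
    have "a \<le> m" unfolding m_def by (rule cInf_greatest[OF S(1)]) (auto simp: S_def)
    moreover have "m \<le> t" unfolding m_def by (rule cInf_lower[OF _ S(2)]) (use t \<open>\<not> P t\<close> in \<open>auto simp: S_def\<close>)
    ultimately show ?thesis using t by auto
  qed
  have below: "P s" if "a \<le> s" "s < m" for s
    using cInf_lower[OF _ S(2), of s] that m by (auto simp: m_def S_def not_le[symmetric])
  have Pm: "P m" by (rule closed[OF m below])
  have "m < b"
  proof (rule ccontr)
    assume "\<not> m < b"
    then have "m = b" using m by auto
    then have "t \<le> m" using t by auto
    then show False using Pm below[of t] t \<open>\<not> P t\<close> by (cases "t = m") auto
  qed
  then obtain r where r: "r > m" "\<And>s. s \<in> {m..r} \<Longrightarrow> s \<le> b \<Longrightarrow> P s"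
    using step[of m] m Pm by auto
  have "r \<le> m" unfolding m_def
  proof (rule cInf_greatest[OF S(1)])
    fix s assume s: "s \<in> S"
    then have "m \<le> s" unfolding m_def by (rule cInf_lower[OF _ S(2)])
    then show "r \<le> s" using r(2)[of s] s by (force simp: S_def)
  qed
  then show False using r(1) by simp
qed

text \<open>Left limits of \<open>j\<close> are not needed: continuity of \<open>\<phi>\<close> and \<open>Q\<close> carries the comparison past
  accumulation points of jumps.\<close>

lemma switched_increment_le:
  fixes \<phi> Q :: "real \<Rightarrow> real" and j :: "real \<Rightarrow> nat"
  assumes j: "\<And>t. 0 \<le> t \<Longrightarrow> \<forall>\<^sub>F s in at_right t. j s = j t" and a: "0 \<le> a"
    and cont: "continuous_on {a..b} \<phi>" "continuous_on {a..b} Q" and start: "\<phi> a \<le> Q a"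
    and step: "\<And>s t. a \<le> s \<Longrightarrow> s < t \<Longrightarrow> t \<le> b \<Longrightarrow> \<forall>r\<in>{s..<t}. j r = j s \<Longrightarrow> \<phi> t - \<phi> s \<le> Q t - Q s"
    and t: "t \<in> {a..b}"
  shows "\<phi> t \<le> Q t"
  using t
proof (induction rule: interval_induct)
  case (closed t)
  show ?case
  proof (cases "t = a")
    case False
    show ?thesis
    proof (rule ccontr)
      assume "\<not> \<phi> t \<le> Q t"
      then have pos: "0 < \<phi> t - Q t" by simp
      have "continuous_on {a..b} (\<lambda>t. \<phi> t - Q t)" by (intro continuous_intros cont)
      then obtain d where d: "d > 0"
        "\<And>s. s \<in> {a..b} \<Longrightarrow> dist s t < d \<Longrightarrow> dist (\<phi> s - Q s) (\<phi> t - Q t) < \<phi> t - Q t"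
        using closed(1) pos unfolding continuous_on_iff by blast
      \<comment> \<open>An earlier point so close to \<open>t\<close> that a positive excess at
        \<open>t\<close> would persist there.\<close>
      define s where "s = max a (t - d / 2)"
      have s: "a \<le> s" "s < t" "dist s t < d" "s \<in> {a..b}"
        using False closed(1) d(1) by (auto simp: s_def dist_real_def)
      from d(2)[OF s(4,3)] closed(2)[OF s(1,2)] show False by (auto simp: dist_real_def)
    qed
  qed (use start in simp)
next
  case (step t)
  have "0 \<le> t" using step a by simp
  from j[OF this] obtain r where r: "r > t" "\<And>s. t < s \<Longrightarrow> s < r \<Longrightarrow> j s = j t"
    unfolding eventually_at_right_field by blast
  have "\<phi> s \<le> Q s" if s: "t \<le> s" "s \<le> r" "s \<le> b" for s
  proof (cases "s = t")
    case False
    have const: "\<forall>u\<in>{t..<s}. j u = j t"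
    proof
      fix u assume "u \<in> {t..<s}"
      then show "j u = j t" using r(2)[of u] s by (cases "u = t") auto
    qed
    have "\<phi> s - \<phi> t \<le> Q s - Q t"
      by (rule assms(6)[OF _ _ _ const]) (use s False step(1) in auto)
    then show ?thesis using step(3) by simp
  qed (use step in simp)
  then show ?case using r(1) by auto
qed

section \<open>Split fields, averaged flow and switched paths\<close>

text \<open>A single \<open>K\<close> bounds both the Lipschitz constant of \<open>f\<close> and the
  values of \<open>F\<close>. Requiring \<open>L\<close> to dominate \<open>K\<close> lets the same
  exponential weight absorb the field differences of both states.\<close>

locale splitting =
  fixes f :: "'a::euclidean_space \<Rightarrow> 'a" and F :: "'a \<Rightarrow> 'a set" and K L :: real
  assumes f_lipschitz: "norm (f x - f y) \<le> K * norm (x - y)"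
    and F_bounded: "v \<in> F x \<Longrightarrow> norm v \<le> K"
    and F_one_sided: "u \<in> F x \<Longrightarrow> v \<in> F y \<Longrightarrow> (u - v) \<bullet> (x - y) \<le> L * (norm (x - y))\<^sup>2"
    and K_nonneg: "0 \<le> K" and K_le_L: "K \<le> L"
begin

definition averaged_field :: "'a \<Rightarrow> 'a set" where
  "averaged_field x = {(1/2) *\<^sub>R f x + (1/2) *\<^sub>R v | v. v \<in> F x}"

definition switched_field :: "nat \<Rightarrow> 'a \<Rightarrow> 'a set" where
  "switched_field k x = (if k = 0 then {f x} else F x)"

lemma norm_f: "norm (f x) \<le> norm (f 0) + K * norm x"
  using f_lipschitz[of x 0] norm_triangle_sub[of "f x" "f 0"] by simp

lemma continuous_on_f: "continuous_on X f"
proof -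
  have "K-lipschitz_on X f"
    by (rule lipschitz_onI) (use f_lipschitz K_nonneg in \<open>auto simp: dist_norm\<close>)
  then show ?thesis by (rule lipschitz_on_continuous_on)
qed

end

text \<open>The selection \<open>v\<close> that drives \<open>z\<close> is only known to exist at
  almost every time. It enters the estimates through \<open>h\<close>, a bounded Borel function on
  the whole line, against which \<open>\<sigma>\<close> can be integrated.\<close>

locale averaged_flow = splitting f F K L
  for f :: "'a::euclidean_space \<Rightarrow> 'a" and F K L +
  fixes z h :: "real \<Rightarrow> 'a" and T B R C :: real
  assumes T: "0 < T" and h_measurable: "h \<in> borel_measurable borel"
    and h_bounded: "norm (h t) \<le> B"
    and z_bounded: "t \<in> {0..T} \<Longrightarrow> norm (z t) \<le> R"
    and z_lipschitz: "C-lipschitz_on {0..T} z"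
    and z_derivative: "AE t in lebesgue. t \<in> {0..T} \<longrightarrow> (\<exists>v\<in>F (z t). h t = f (z t) - v \<and>
      (z has_vector_derivative ((1/2) *\<^sub>R f (z t) + (1/2) *\<^sub>R v)) (at t within {0..T}))"
begin

lemma B_nonneg: "0 \<le> B" by (rule order_trans[OF norm_ge_zero h_bounded])

lemma R_nonneg: "0 \<le> R" using order_trans[OF norm_ge_zero z_bounded[of 0]] T by simp

lemma C_nonneg: "0 \<le> C" by (rule lipschitz_on_nonneg[OF z_lipschitz])

lemma L_nonneg: "0 \<le> L" using K_nonneg K_le_L by simp

lemma z_continuous: "continuous_on {0..T} z"
  by (rule lipschitz_on_continuous_on[OF z_lipschitz])

text \<open>The a priori bound for \<open>e\<close> proved in \<open>norm_e_le\<close>. This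
  constant and those built on it involve the flow and the fields but not the switching, so the final
  estimate is uniform over paths and rates.\<close>

definition error_bound :: real where
  "error_bound = exp (L * T) * (T * B)"

definition speed_bound :: real where
  "speed_bound = norm (f 0) + K * (R + error_bound) + K"

lemma error_bound_nonneg: "0 \<le> error_bound" using T B_nonneg by (simp add: error_bound_def)

lemma speed_bound_nonneg: "0 \<le> speed_bound"
  using K_nonneg R_nonneg error_bound_nonneg by (simp add: speed_bound_def)

text \<open>Lipschitz constant of \<open>p\<close> by the product rule: the first term is due to the
  speed of \<open>e\<close>, the second to the derivative of the weight.\<close>

definition p_speed :: real where
  "p_speed = 2 * (speed_bound + C) + 4 * L * error_bound"

lemma p_speed_nonneg: "0 \<le> p_speed"
  using speed_bound_nonneg C_nonneg L_nonneg error_bound_nonneg by (simp add: p_speed_def)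

text \<open>The summands collect the integrals over the cells, the error of freezing and the
  incomplete last cell; the prefactor removes the weight of the energy.\<close>

definition rate_const :: real where
  "rate_const = exp (2 * L * T) * (2 * error_bound + B * p_speed * T\<^sup>2 + 2 * error_bound * B * T)"

lemma rate_const_nonneg: "0 \<le> rate_const"
  using error_bound_nonneg B_nonneg p_speed_nonneg T by (simp add: rate_const_def)

lemma norm_switched_field:
  assumes "u \<in> switched_field k x" "norm x \<le> r"
  shows "norm u \<le> norm (f 0) + K * r + K"
proof (cases "k = 0")
  case True
  then have "norm u \<le> norm (f 0) + K * norm x" using assms norm_f by (simp add: switched_field_def)
  also have "\<dots> \<le> norm (f 0) + K * r + K"
    using assms K_nonneg by (simp add: mult_left_mono add_increasing2)
  finally show ?thesis .
next
  case False
  then have "norm u \<le> K" using assms F_bounded by (simp add: switched_field_def)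
  moreover have "0 \<le> r" by (rule order_trans[OF norm_ge_zero assms(2)])
  ultimately show ?thesis using K_nonneg by (simp add: add_increasing)
qed

end

text \<open>\<open>\<sigma>\<close> encodes the state of the switching on \<open>[0, \<infinity>)\<close>; its values at negative times only matter for
  measurability.\<close>

locale switched_path = averaged_flow f F K L z h T B R C
  for f :: "'a::euclidean_space \<Rightarrow> 'a" and F K L z h T B R C +
  fixes j :: "real \<Rightarrow> nat" and x :: "real \<Rightarrow> 'a" and \<sigma> :: "real \<Rightarrow> real"
  assumes j: "0 \<le> t \<Longrightarrow> \<forall>\<^sub>F s in at_right t. j s = j t"
    and x_continuous: "continuous_on {0..} x" and x_0: "x 0 = z 0"
    and x_switched: "follows_switched switched_field j x"
    and \<sigma>_measurable: "\<sigma> \<in> borel_measurable borel"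
    and \<sigma>: "0 \<le> t \<Longrightarrow> \<sigma> t = (if j t = 0 then 1 / 2 else - 1 / 2)"
begin

definition e :: "real \<Rightarrow> 'a" where "e t = x t - z t"

text \<open>The factor that multiplies \<open>\<sigma> t *\<^sub>R h t\<close> in the derivative of
  \<open>energy\<close>; the weight is that of Gronwall's lemma.\<close>

definition p :: "real \<Rightarrow> 'a" where "p t = (2 * exp (- 2 * L * t)) *\<^sub>R e t"

definition energy :: "real \<Rightarrow> real" where "energy t = exp (- 2 * L * t) * (e t \<bullet> e t)"

lemma abs_\<sigma>: "0 \<le> t \<Longrightarrow> \<bar>\<sigma> t\<bar> = 1 / 2"
  using \<sigma>[of t] by simp

lemma x_derivative:
  assumes "0 \<le> a" "a < b" "\<forall>t\<in>{a..<b}. j t = j a"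
  shows "abs_continuous_on a b x"
    and "AE t in lebesgue. t \<in> {a..b} \<longrightarrow>
      (\<exists>u\<in>switched_field (j a) (x t). (x has_vector_derivative u) (at t within {a..b}))"
proof -
  have "locally_abs_continuous_on {a..b} x \<and> satisfies_inclusion (switched_field (j a)) {a..b} x"
    using x_switched[unfolded follows_switched_def] assms by blast
  then show "abs_continuous_on a b x"
    and "AE t in lebesgue. t \<in> {a..b} \<longrightarrow>
      (\<exists>u\<in>switched_field (j a) (x t). (x has_vector_derivative u) (at t within {a..b}))"
    using assms(2) by (auto simp: locally_abs_continuous_on_def satisfies_inclusion_def)
qed

lemma e_continuous: "continuous_on {0..T} e"
  unfolding e_def using continuous_on_subset[OF x_continuous, of "{0..T}"] z_continuous
  by (intro continuous_intros) auto

lemma p_continuous: "continuous_on {0..T} p"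
  unfolding p_def by (intro continuous_intros e_continuous)

lemma norm_forcing:
  assumes "0 \<le> t"
  shows "norm (\<sigma> t *\<^sub>R h t) \<le> B"
proof -
  have "norm (\<sigma> t *\<^sub>R h t) = 1 / 2 * norm (h t)"
    by (simp only: norm_scaleR abs_\<sigma>[OF assms])
  then show ?thesis using h_bounded[of t] norm_ge_zero[of "h t"] by linarith
qed

lemma forcing_integrable:
  assumes "0 \<le> a" "b \<le> T"
  shows "(\<lambda>t. \<sigma> t *\<^sub>R h t) integrable_on {a..b}"
    and "(\<lambda>t. (\<sigma> t *\<^sub>R h t) \<bullet> p t) integrable_on {a..b}"
proof -
  have m: "(\<lambda>t. \<sigma> t *\<^sub>R h t) \<in> borel_measurable (lebesgue_on {a..b})"
    using h_measurable \<sigma>_measurable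
    by (intro measurable_restrict_space1 measurable_completion) auto
  have bnd: "norm (\<sigma> t *\<^sub>R h t) \<le> B" if "t \<in> {a..b}" for t
    using norm_forcing[of t] that assms by simp
  show "(\<lambda>t. \<sigma> t *\<^sub>R h t) integrable_on {a..b}"
    by (rule measurable_bounded_by_integrable_imp_integrable[OF m integrable_const_ivl[of B]]) (use bnd in auto)
  have pc: "continuous_on {a..b} p" using p_continuous assms by (auto intro: continuous_on_subset)
  obtain A where A: "\<And>t. t \<in> {a..b} \<Longrightarrow> norm (p t) \<le> A"
    using compact_imp_bounded[OF compact_continuous_image[OF pc compact_Icc]] unfolding bounded_iff by (metis imageI)
  have pm: "p \<in> borel_measurable (lebesgue_on {a..b})"
    by (rule continuous_imp_measurable_on_sets_lebesgue[OF pc]) auto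
  show "(\<lambda>t. (\<sigma> t *\<^sub>R h t) \<bullet> p t) integrable_on {a..b}"
  proof (rule measurable_bounded_by_integrable_imp_integrable[OF _ integrable_const_ivl[of "B * A"]])
    show "(\<lambda>t. (\<sigma> t *\<^sub>R h t) \<bullet> p t) \<in> borel_measurable (lebesgue_on {a..b})"
      by (intro borel_measurable_inner m pm)
    fix t assume t: "t \<in> {a..b}"
    show "norm ((\<sigma> t *\<^sub>R h t) \<bullet> p t) \<le> B * A"
      unfolding real_norm_def
      by (rule order_trans[OF Cauchy_Schwarz_ineq2 mult_mono[OF bnd[OF t] A[OF t] B_nonneg]]) simp
  qed simp
qed

text \<open>The field difference contributes at most \<open>L\<close> times the squared norm of
  \<open>e\<close>, by the Lipschitz bound in state 0 and by the one-sided bound in state 1. The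
  derivative of the weight cancels this, and only the forcing is left.\<close>

lemma energy_step:
  assumes a: "0 \<le> a" "a < b" "b \<le> T" and const: "\<forall>t\<in>{a..<b}. j t = j a"
  shows "energy b - energy a \<le> integral {a..b} (\<lambda>t. (\<sigma> t *\<^sub>R h t) \<bullet> p t)"
proof -
  have xc: "continuous_on {a..b} x" using x_continuous a by (auto intro: continuous_on_subset)
  obtain r where r: "\<And>t. t \<in> {a..b} \<Longrightarrow> norm (x t) \<le> r"
    using compact_imp_bounded[OF compact_continuous_image[OF xc compact_Icc]] unfolding bounded_iff by (metis imageI)
  \<comment> \<open>A crude constant that depends on the path through \<open>r\<close>. It serves
    only to make \<open>energy\<close> absolutely continuous; the uniform \<open>speed_bound\<close>
    becomes available after \<open>norm_e_le\<close>, which rests on the present lemma.\<close>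
  define D where "D = norm (f 0) + K * r + K"
  have "0 \<le> r" using order_trans[OF norm_ge_zero r[of a]] a by simp
  then have D: "0 \<le> D" using K_nonneg by (simp add: D_def)
  have "D-lipschitz_on {a..b} x"
  proof (rule lipschitz_on_of_bounded_derivative[OF x_derivative(1)[OF a(1,2) const] D])
    show "AE t in lebesgue. t \<in> {a..b} \<longrightarrow> (\<exists>v. norm v \<le> D \<and> (x has_vector_derivative v) (at t within {a..b}))"
      using x_derivative(2)[OF a(1,2) const]
    proof eventually_elim
      case (elim t)
      then show ?case using r[of t] norm_switched_field unfolding D_def by blast
    qed
  qed
  moreover have "C-lipschitz_on {a..b} z"
    by (rule lipschitz_on_mono[OF z_lipschitz _ order_refl]) (use a in auto)
  ultimately have el: "(D + C)-lipschitz_on {a..b} e"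
    unfolding e_def by (rule lipschitz_on_diff)
  define A where "A = r + R"
  have A0: "0 \<le> A" using \<open>0 \<le> r\<close> R_nonneg by (simp add: A_def)
  have A: "norm (e t) \<le> A" if "t \<in> {a..b}" for t
    using r[of t] z_bounded[of t] that a norm_triangle_ineq4[of "x t" "z t"]
    by (auto simp: A_def e_def)
  have ee: "(A * (D + C) + A * (D + C))-lipschitz_on {a..b} (\<lambda>t. e t \<bullet> e t)"
    using A A0 by (intro lipschitz_on_inner el) auto
  have w: "(2 * L)-lipschitz_on {a..b} (\<lambda>t. exp (- (2 * L) * t))"
    by (rule lipschitz_on_mono[OF lipschitz_on_exp_decay _ order_refl]) (use L_nonneg a in auto)
  have "(1 * (A * (D + C) + A * (D + C)) + (A * A) * (2 * L))-lipschitz_on {a..b}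
      (\<lambda>t. exp (- (2 * L) * t) \<bullet> (e t \<bullet> e t))"
  proof (rule lipschitz_on_inner[OF w ee])
    fix t assume t: "t \<in> {a..b}"
    show "norm (exp (- (2 * L) * t)) \<le> 1" using t a L_nonneg by simp
    show "norm (e t \<bullet> e t) \<le> A * A"
      using A[OF t] A0 by (simp add: dot_square_norm power2_eq_square mult_mono)
  qed (use A0 in auto)
  then have "\<exists>D'. D'-lipschitz_on {a..b} energy"
    by (auto simp: energy_def)
  then obtain D' where D': "D'-lipschitz_on {a..b} energy" ..
  have q: "(\<lambda>t. (\<sigma> t *\<^sub>R h t) \<bullet> p t) integrable_on {a..b}"
    using a by (intro forcing_integrable) auto
  show ?thesis
  proof (rule increment_le_integral[OF less_imp_le[OF a(2)] D' q])
    \<comment> \<open>The right endpoint is discarded because \<open>j b\<close> may already be the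
      next state.\<close>
    have nb: "AE t in lebesgue. t \<noteq> b"
      by (rule AE_completion) (rule AE_lborel_singleton)
    show "AE t in lebesgue. t \<in> {a..b} \<longrightarrow>
        (\<exists>D\<le>(\<sigma> t *\<^sub>R h t) \<bullet> p t. (energy has_vector_derivative D) (at t within {a..b}))"
      using x_derivative(2)[OF a(1,2) const] z_derivative nb
    proof eventually_elim
      case (elim t)
      show ?case
      proof
        assume t: "t \<in> {a..b}"
        then have t0: "0 \<le> t" "t \<in> {0..T}" "t \<in> {a..<b}" using a elim(3) by auto
        have jt: "j t = j a" using const t0(3) by blast
        obtain u where u: "u \<in> switched_field (j a) (x t)" "(x has_vector_derivative u) (at t within {a..b})"
          using elim(1) t by blast
        obtain v where v: "v \<in> F (z t)" "h t = f (z t) - v"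
          "(z has_vector_derivative ((1/2) *\<^sub>R f (z t) + (1/2) *\<^sub>R v)) (at t within {0..T})"
          using elim(2) t0 by blast
        define e' where "e' = u - ((1/2) *\<^sub>R f (z t) + (1/2) *\<^sub>R v)"
        have e': "(e has_vector_derivative e') (at t within {a..b})"
          unfolding e_def e'_def using a
          by (intro has_vector_derivative_diff u(2) has_vector_derivative_within_subset[OF v(3)]) auto
        have "((\<lambda>t. e t \<bullet> e t) has_vector_derivative (e t \<bullet> e' + e' \<bullet> e t)) (at t within {a..b})"
          by (rule bounded_bilinear.has_vector_derivative[OF bounded_bilinear_inner e' e'])
        moreover have "((\<lambda>t. exp (- 2 * L * t)) has_vector_derivative (exp (- 2 * L * t) * (- 2 * L))) (at t within {a..b})"
          unfolding has_real_derivative_iff_has_vector_derivative[symmetric]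
          by (auto intro!: derivative_eq_intros)
        ultimately have der: "(energy has_vector_derivative
            (exp (- 2 * L * t) * (e t \<bullet> e' + e' \<bullet> e t) + exp (- 2 * L * t) * (- 2 * L) * (e t \<bullet> e t))) (at t within {a..b})"
          unfolding energy_def by (intro has_vector_derivative_mult)
        \<comment> \<open>In state 0 half of \<open>f (z t) - v\<close> exceeds the averaged
          velocity, in state 1 it is missing; the sign is that of \<open>\<sigma> t\<close>.\<close>
        have main: "e' \<bullet> e t \<le> L * (e t \<bullet> e t) + \<sigma> t * (h t \<bullet> e t)"
        proof (cases "j a = 0")
          case True
          then have s: "\<sigma> t = 1 / 2" using \<sigma>[OF t0(1)] jt by simp
          have "u = f (x t)" using u(1) True by (simp add: switched_field_def)
          then have "e' = (f (x t) - f (z t)) + \<sigma> t *\<^sub>R h t"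
            unfolding e'_def v(2) s by (simp add: algebra_simps flip: scaleR_2)
          moreover have "(f (x t) - f (z t)) \<bullet> e t \<le> L * (e t \<bullet> e t)"
          proof -
            have "(f (x t) - f (z t)) \<bullet> e t \<le> norm (f (x t) - f (z t)) * norm (e t)"
              by (rule norm_cauchy_schwarz)
            also have "\<dots> \<le> (L * norm (e t)) * norm (e t)"
              using f_lipschitz[of "x t" "z t"] K_le_L
              by (intro mult_right_mono order_trans[OF f_lipschitz]) (auto simp: e_def intro: mult_right_mono)
            finally show ?thesis by (simp add: dot_square_norm power2_eq_square)
          qed
          ultimately show ?thesis by (simp add: inner_add_left)
        next
          case False
          then have s: "\<sigma> t = - 1 / 2" using \<sigma>[OF t0(1)] jt by simp
          have "u \<in> F (x t)" using u(1) False by (simp add: switched_field_def)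
          then have "(u - v) \<bullet> e t \<le> L * (e t \<bullet> e t)"
            using F_one_sided[OF _ v(1)] by (simp add: e_def dot_square_norm)
          moreover have "e' = (u - v) + \<sigma> t *\<^sub>R h t"
            unfolding e'_def v(2) s by (simp add: algebra_simps flip: scaleR_2)
          ultimately show ?thesis by (simp add: inner_add_left)
        qed
        have "exp (- 2 * L * t) * (e t \<bullet> e' + e' \<bullet> e t) + exp (- 2 * L * t) * (- 2 * L) * (e t \<bullet> e t)
            = 2 * exp (- 2 * L * t) * (e' \<bullet> e t - L * (e t \<bullet> e t))"
          by (simp add: inner_commute algebra_simps)
        also have "\<dots> \<le> 2 * exp (- 2 * L * t) * (\<sigma> t * (h t \<bullet> e t))"
          using main by (intro mult_left_mono) auto
        also have "\<dots> = (\<sigma> t *\<^sub>R h t) \<bullet> p t" by (simp add: p_def)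
        finally show "\<exists>D\<le>(\<sigma> t *\<^sub>R h t) \<bullet> p t. (energy has_vector_derivative D) (at t within {a..b})"
          using der by blast
      qed
    qed
  qed
qed

section \<open>Bounds uniform over switched paths\<close>

lemma energy_le:
  assumes "t \<in> {0..T}"
  shows "energy t \<le> integral {0..t} (\<lambda>t. (\<sigma> t *\<^sub>R h t) \<bullet> p t)"
proof (rule switched_increment_le[where j = j and a = 0 and b = T and \<phi> = energy
      and Q = "\<lambda>t. integral {0..t} (\<lambda>t. (\<sigma> t *\<^sub>R h t) \<bullet> p t)"])
  show "continuous_on {0..T} energy"
    unfolding energy_def by (intro continuous_intros e_continuous)
  show "continuous_on {0..T} (\<lambda>t. integral {0..t} (\<lambda>t. (\<sigma> t *\<^sub>R h t) \<bullet> p t))"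
    by (rule indefinite_integral_continuous_1) (rule forcing_integrable; simp)
  show "energy 0 \<le> integral {0..0} (\<lambda>t. (\<sigma> t *\<^sub>R h t) \<bullet> p t)"
    by (simp add: energy_def e_def x_0)
  fix s t assume st: "0 \<le> s" "s < t" "t \<le> T" "\<forall>r\<in>{s..<t}. j r = j s"
  have "integral {0..s} (\<lambda>t. (\<sigma> t *\<^sub>R h t) \<bullet> p t) + integral {s..t} (\<lambda>t. (\<sigma> t *\<^sub>R h t) \<bullet> p t)
      = integral {0..t} (\<lambda>t. (\<sigma> t *\<^sub>R h t) \<bullet> p t)"
    using st by (intro Henstock_Kurzweil_Integration.integral_combine forcing_integrable) auto
  with energy_step[OF st] show "energy t - energy s
      \<le> integral {0..t} (\<lambda>t. (\<sigma> t *\<^sub>R h t) \<bullet> p t) - integral {0..s} (\<lambda>t. (\<sigma> t *\<^sub>R h t) \<bullet> p t)"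
    by simp
qed (use j assms in auto)

text \<open>Here \<open>\<rho>\<close> is the square root of the energy and the forcing is linear in
  it. At a maximum of \<open>\<rho>\<close> the energy inequality reads
  \<open>\<rho> m * \<rho> m \<le> (T * B) * \<rho> m\<close>, and one factor cancels.\<close>

lemma norm_e_le:
  assumes t: "t \<in> {0..T}"
  shows "norm (e t) \<le> error_bound"
proof -
  define \<rho> where "\<rho> s = exp (- L * s) * norm (e s)" for s
  have "continuous_on {0..T} \<rho>" unfolding \<rho>_def by (intro continuous_intros e_continuous)
  then obtain m where m: "m \<in> {0..T}" "\<And>s. s \<in> {0..T} \<Longrightarrow> \<rho> s \<le> \<rho> m"
    using continuous_attains_sup[of "{0..T}" \<rho>] T by auto
  have \<rho>0: "0 \<le> \<rho> s" for s by (simp add: \<rho>_def)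
  have ex2: "exp (- 2 * L * s) = exp (- L * s) * exp (- L * s)" for s
    by (simp flip: exp_add)
  have "\<rho> m * \<rho> m = energy m"
    unfolding \<rho>_def energy_def ex2 by (simp add: dot_square_norm power2_eq_square mult_ac)
  also have "\<dots> \<le> integral {0..m} (\<lambda>t. (\<sigma> t *\<^sub>R h t) \<bullet> p t)" by (rule energy_le[OF m(1)])
  also have "\<dots> \<le> integral {0..m} (\<lambda>t. B * \<rho> m)"
  proof (rule integral_le)
    show "(\<lambda>t. (\<sigma> t *\<^sub>R h t) \<bullet> p t) integrable_on {0..m}" using m by (intro forcing_integrable) auto
    fix s assume s: "s \<in> {0..m}"
    have "(\<sigma> s *\<^sub>R h s) \<bullet> p s \<le> norm (\<sigma> s *\<^sub>R h s) * norm (p s)" by (rule norm_cauchy_schwarz)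
    also have "\<dots> = norm (h s) * (exp (- L * s) * \<rho> s)"
      using abs_\<sigma>[of s] s unfolding p_def \<rho>_def ex2 by simp
    also have "\<dots> \<le> B * (1 * \<rho> m)"
      using h_bounded[of s] m s B_nonneg L_nonneg \<rho>0 by (intro mult_mono) auto
    finally show "(\<sigma> s *\<^sub>R h s) \<bullet> p s \<le> B * \<rho> m" by simp
  qed (rule integrable_const_ivl)
  also have "\<dots> = (m * B) * \<rho> m" using m by simp
  also have "\<dots> \<le> (T * B) * \<rho> m" using m B_nonneg \<rho>0 by (intro mult_right_mono) auto
  finally have "\<rho> m * \<rho> m \<le> (T * B) * \<rho> m" .
  then have "\<rho> m \<le> T * B"
    using \<rho>0[of m] T B_nonneg by (cases "\<rho> m = 0") (auto simp: mult_le_cancel_right)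
  then have "\<rho> t \<le> T * B" using m(2)[OF t] by simp
  have "norm (e t) = exp (L * t) * \<rho> t" by (simp add: \<rho>_def exp_minus)
  also have "\<dots> \<le> exp (L * T) * (T * B)"
    using t \<open>\<rho> t \<le> T * B\<close> L_nonneg \<rho>0 by (intro mult_mono) (auto intro: mult_left_mono)
  finally show ?thesis by (simp add: error_bound_def)
qed

text \<open>The a priori bound confines \<open>x\<close> to a fixed ball, on which both fields are
  bounded by \<open>speed_bound\<close>. The local Lipschitz estimates are glued across jumps by
  comparing the distance from \<open>x s\<close> with linear growth.\<close>

lemma e_lipschitz: "(speed_bound + C)-lipschitz_on {0..T} e"
proof -
  have xb: "norm (x t) \<le> R + error_bound" if "t \<in> {0..T}" for t
    using norm_e_le[OF that] z_bounded[OF that] norm_triangle_sub[of "x t" "z t"] by (simp add: e_def)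
  have 1: "norm (x t - x s) \<le> speed_bound * (t - s)" if st: "0 \<le> s" "s \<le> t" "t \<le> T" for s t
  proof (rule switched_increment_le[where j = j and a = s and b = t and \<phi> = "\<lambda>t. norm (x t - x s)"
        and Q = "\<lambda>t. speed_bound * (t - s)"])
    show "continuous_on {s..t} (\<lambda>t. norm (x t - x s))"
      using st by (intro continuous_intros continuous_on_subset[OF x_continuous]) auto
    show "continuous_on {s..t} (\<lambda>t. speed_bound * (t - s))" by (intro continuous_intros)
    fix a b assume ab: "s \<le> a" "a < b" "b \<le> t" "\<forall>r\<in>{a..<b}. j r = j a"
    have a0: "0 \<le> a" using ab st by simp
    have "speed_bound-lipschitz_on {a..b} x"
    proof (rule lipschitz_on_of_bounded_derivative[OF x_derivative(1)[OF a0 ab(2,4)] speed_bound_nonneg])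
      show "AE t in lebesgue. t \<in> {a..b} \<longrightarrow>
          (\<exists>v. norm v \<le> speed_bound \<and> (x has_vector_derivative v) (at t within {a..b}))"
        using x_derivative(2)[OF a0 ab(2,4)]
      proof eventually_elim
        case (elim r)
        show ?case
        proof
          assume r: "r \<in> {a..b}"
          then obtain u where u: "u \<in> switched_field (j a) (x r)" "(x has_vector_derivative u) (at r within {a..b})"
            using elim by blast
          have "r \<in> {0..T}" using r ab(1,3) st by simp
          then have "norm u \<le> speed_bound"
            unfolding speed_bound_def by (intro norm_switched_field[OF u(1) xb])
          then show "\<exists>v. norm v \<le> speed_bound \<and> (x has_vector_derivative v) (at r within {a..b})"
            using u(2) by blast
        qed
      qed
    qed
    from lipschitz_onD[OF this, of b a] have "norm (x b - x a) \<le> speed_bound * (b - a)"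
      using ab(2) by (simp add: dist_norm)
    then show "norm (x b - x s) - norm (x a - x s) \<le> speed_bound * (b - s) - speed_bound * (a - s)"
      using norm_triangle_ineq2[of "x b - x s" "x a - x s"] by (simp add: algebra_simps)
  qed (use j st in auto)
  have "speed_bound-lipschitz_on {0..T} x"
  proof (rule lipschitz_onI[OF _ speed_bound_nonneg])
    fix s t assume "s \<in> {0..T}" "t \<in> {0..T}"
    then show "dist (x s) (x t) \<le> speed_bound * dist s t"
      using 1[of s t] 1[of t s] by (cases "s \<le> t") (auto simp: dist_norm norm_minus_commute)
  qed
  then show ?thesis unfolding e_def by (rule lipschitz_on_diff[OF _ z_lipschitz])
qed

lemma norm_p_le:
  assumes t: "t \<in> {0..T}"
  shows "norm (p t) \<le> 2 * error_bound"
proof -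
  have "norm (p t) = 2 * (exp (- 2 * L * t) * norm (e t))" by (simp add: p_def)
  also have "\<dots> \<le> 2 * (1 * error_bound)"
    using t norm_e_le[OF t] L_nonneg by (intro mult_left_mono mult_mono) auto
  finally show ?thesis by simp
qed

lemma norm_p_diff_le:
  assumes "s \<in> {0..T}" "t \<in> {0..T}"
  shows "norm (p t - p s) \<le> p_speed * \<bar>t - s\<bar>"
proof -
  define w where "w t = exp (- (2 * L) * t)" for t
  have w: "\<bar>w t - w s\<bar> \<le> 2 * L * \<bar>t - s\<bar>"
    using lipschitz_onD[OF lipschitz_on_exp_decay, of "2 * L" t s] assms L_nonneg
    by (simp add: w_def dist_real_def)
  have w1: "\<bar>w t\<bar> \<le> 1" using assms L_nonneg by (simp add: w_def)
  have ee: "norm (e t - e s) \<le> (speed_bound + C) * \<bar>t - s\<bar>"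
    using lipschitz_onD[OF e_lipschitz assms(2,1)] by (simp add: dist_norm)
  have "p t - p s = 2 *\<^sub>R (w t *\<^sub>R (e t - e s) + (w t - w s) *\<^sub>R e s)"
    by (simp add: p_def w_def algebra_simps)
  then have "norm (p t - p s) = 2 * norm (w t *\<^sub>R (e t - e s) + (w t - w s) *\<^sub>R e s)" by simp
  also have "\<dots> \<le> 2 * (\<bar>w t\<bar> * norm (e t - e s) + \<bar>w t - w s\<bar> * norm (e s))"
    using norm_triangle_ineq[of "w t *\<^sub>R (e t - e s)" "(w t - w s) *\<^sub>R e s"] by simp
  also have "\<dots> \<le> 2 * (1 * ((speed_bound + C) * \<bar>t - s\<bar>) + (2 * L * \<bar>t - s\<bar>) * error_bound)"
    using w w1 ee norm_e_le[OF assms(1)] by (intro mult_left_mono add_mono mult_mono) auto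
  also have "\<dots> = p_speed * \<bar>t - s\<bar>" by (simp add: p_speed_def algebra_simps)
  finally show ?thesis .
qed

section \<open>Freezing on the cells of a grid\<close>

text \<open>Replacing \<open>p t\<close> by \<open>p a\<close> costs at most
  \<open>B * p_speed * (b - a)\<close> per unit of time and leaves the integral of
  \<open>\<sigma> h\<close> paired with one vector.\<close>

lemma forcing_integral_cell:
  assumes ab: "0 \<le> a" "a \<le> b" "b \<le> T"
  shows "integral {a..b} (\<lambda>t. (\<sigma> t *\<^sub>R h t) \<bullet> p t)
    \<le> 2 * error_bound * norm (integral {a..b} (\<lambda>t. \<sigma> t *\<^sub>R h t)) + B * p_speed * (b - a)\<^sup>2"
proof -
  let ?m = "\<lambda>t. \<sigma> t *\<^sub>R h t"
  have m: "?m integrable_on {a..b}" using ab by (intro forcing_integrable) auto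
  have "((\<lambda>t. ?m t \<bullet> p a) has_integral integral {a..b} ?m \<bullet> p a) {a..b}"
    using has_integral_linear[OF integrable_integral[OF m] bounded_linear_inner_left[of "p a"]] by (simp add: o_def)
  moreover have "((\<lambda>t. B * p_speed * (b - a)) has_integral (B * p_speed * (b - a)) * (b - a)) {a..b}"
    using has_integral_const_real[of "B * p_speed * (b - a)" a b] ab by (simp add: mult_ac)
  ultimately have 1: "((\<lambda>t. ?m t \<bullet> p a + B * p_speed * (b - a)) has_integral
      integral {a..b} ?m \<bullet> p a + (B * p_speed * (b - a)) * (b - a)) {a..b}"
    by (rule has_integral_add)
  have 2: "((\<lambda>t. ?m t \<bullet> p t) has_integral integral {a..b} (\<lambda>t. ?m t \<bullet> p t)) {a..b}"
    using ab by (intro integrable_integral forcing_integrable) auto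
  have 3: "?m t \<bullet> p t \<le> ?m t \<bullet> p a + B * p_speed * (b - a)" if t: "t \<in> {a..b}" for t
  proof -
    have "?m t \<bullet> p t - ?m t \<bullet> p a = ?m t \<bullet> (p t - p a)" by (simp add: inner_diff_right)
    also have "\<dots> \<le> norm (?m t) * norm (p t - p a)" by (rule norm_cauchy_schwarz)
    also have "\<dots> \<le> B * (p_speed * (b - a))"
    proof (intro mult_mono norm_forcing B_nonneg)
      have "norm (p t - p a) \<le> p_speed * \<bar>t - a\<bar>" using t ab by (intro norm_p_diff_le) auto
      also have "\<dots> \<le> p_speed * (b - a)" using t p_speed_nonneg by (intro mult_left_mono) auto
      finally show "norm (p t - p a) \<le> p_speed * (b - a)" .
    qed (use t ab in auto)
    finally show ?thesis by simp
  qed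
  have "integral {a..b} (\<lambda>t. ?m t \<bullet> p t)
      \<le> integral {a..b} ?m \<bullet> p a + (B * p_speed * (b - a)) * (b - a)"
    by (rule has_integral_le[OF 2 1 3])
  also have "integral {a..b} ?m \<bullet> p a \<le> norm (integral {a..b} ?m) * norm (p a)"
    by (rule norm_cauchy_schwarz)
  also have "\<dots> \<le> norm (integral {a..b} ?m) * (2 * error_bound)"
    using ab by (intro mult_left_mono norm_p_le) auto
  finally show ?thesis by (simp add: power2_eq_square mult_ac)
qed

text \<open>A bound without averaging, sufficient for the incomplete cell before \<open>t\<close>
  because that cell is as short as the mesh.\<close>

lemma forcing_integral_le:
  assumes ab: "0 \<le> a" "a \<le> b" "b \<le> T"
  shows "integral {a..b} (\<lambda>t. (\<sigma> t *\<^sub>R h t) \<bullet> p t) \<le> 2 * error_bound * B * (b - a)"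
proof -
  have 1: "((\<lambda>t. 2 * error_bound * B) has_integral (2 * error_bound * B) * (b - a)) {a..b}"
    using has_integral_const_real[of "2 * error_bound * B" a b] ab by (simp add: mult_ac)
  have 2: "((\<lambda>t. (\<sigma> t *\<^sub>R h t) \<bullet> p t) has_integral integral {a..b} (\<lambda>t. (\<sigma> t *\<^sub>R h t) \<bullet> p t)) {a..b}"
    using ab by (intro integrable_integral forcing_integrable) auto
  have 3: "(\<sigma> t *\<^sub>R h t) \<bullet> p t \<le> 2 * error_bound * B" if t: "t \<in> {a..b}" for t
  proof -
    have "(\<sigma> t *\<^sub>R h t) \<bullet> p t \<le> norm (\<sigma> t *\<^sub>R h t) * norm (p t)" by (rule norm_cauchy_schwarz)
    also have "\<dots> \<le> B * (2 * error_bound)"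
      using t ab by (intro mult_mono norm_forcing norm_p_le B_nonneg) auto
    finally show ?thesis by (simp add: mult_ac)
  qed
  show ?thesis by (rule has_integral_le[OF 2 1 3])
qed

lemma forcing_integral_grid:
  assumes n: "0 < n" and k: "k \<le> n"
  shows "integral {0..real k * (T / real n)} (\<lambda>t. (\<sigma> t *\<^sub>R h t) \<bullet> p t)
    \<le> (\<Sum>i<k. 2 * error_bound * norm (integral {real i * (T / real n)..real (Suc i) * (T / real n)} (\<lambda>t. \<sigma> t *\<^sub>R h t))
        + B * p_speed * (T / real n)\<^sup>2)"
  using k
proof (induction k)
  case (Suc k)
  define \<tau> where "\<tau> = T / real n"
  have \<tau>: "0 < \<tau>" using T n by (simp add: \<tau>_def)
  have kT: "real (Suc k) * \<tau> \<le> T"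
  proof -
    have "real (Suc k) * \<tau> \<le> real n * \<tau>" using Suc.prems \<tau> by (intro mult_right_mono) auto
    then show ?thesis using n by (simp add: \<tau>_def)
  qed
  have k0: "0 \<le> real k * \<tau>" "real k * \<tau> \<le> real (Suc k) * \<tau>" using \<tau> by (auto simp: algebra_simps)
  have "integral {0..real (Suc k) * \<tau>} (\<lambda>t. (\<sigma> t *\<^sub>R h t) \<bullet> p t)
      = integral {0..real k * \<tau>} (\<lambda>t. (\<sigma> t *\<^sub>R h t) \<bullet> p t)
        + integral {real k * \<tau>..real (Suc k) * \<tau>} (\<lambda>t. (\<sigma> t *\<^sub>R h t) \<bullet> p t)"
    using k0 kT by (intro Henstock_Kurzweil_Integration.integral_combine[symmetric] forcing_integrable) auto
  also have "integral {real k * \<tau>..real (Suc k) * \<tau>} (\<lambda>t. (\<sigma> t *\<^sub>R h t) \<bullet> p t)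
      \<le> 2 * error_bound * norm (integral {real k * \<tau>..real (Suc k) * \<tau>} (\<lambda>t. \<sigma> t *\<^sub>R h t))
        + B * p_speed * (real (Suc k) * \<tau> - real k * \<tau>)\<^sup>2"
    by (rule forcing_integral_cell[OF k0 kT])
  also have "real (Suc k) * \<tau> - real k * \<tau> = \<tau>" by (simp add: algebra_simps)
  finally show ?case using Suc by (simp add: \<tau>_def)
qed simp

text \<open>The summands \<open>\<bar>J\<bar> \<le> 1 / n\<^sup>2 + n\<^sup>2 \<bar>J\<bar>\<^sup>2\<close> are squared because only second moments of the \<open>J\<close> are
  computed.\<close>

lemma norm_e_sq_le:
  assumes t: "t \<in> {0..T}" and n: "0 < n"
  shows "(norm (e t))\<^sup>2 \<le> rate_const / real n + rate_const * (real n)\<^sup>2 *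
    (\<Sum>i<n. (norm (integral {real i * (T / real n)..real (Suc i) * (T / real n)} (\<lambda>t. \<sigma> t *\<^sub>R h t)))\<^sup>2)"
proof -
  define \<tau> where "\<tau> = T / real n"
  define J where "J i = norm (integral {real i * \<tau>..real (Suc i) * \<tau>} (\<lambda>t. \<sigma> t *\<^sub>R h t))" for i
  define E where "E = error_bound"
  have E: "0 \<le> E" by (simp add: E_def error_bound_nonneg)
  have \<tau>: "0 < \<tau>" using T n by (simp add: \<tau>_def)
  have n\<tau>: "real n * \<tau> = T" using n by (simp add: \<tau>_def)
  \<comment> \<open>The number of complete cells before \<open>t\<close>.\<close>
  define k where "k = nat \<lfloor>t / \<tau>\<rfloor>"
  have tk: "real k * \<tau> \<le> t" "t < real k * \<tau> + \<tau>"
  proof -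
    have "0 \<le> t / \<tau>" using t \<tau> by simp
    then have "real k \<le> t / \<tau>" "t / \<tau> < real k + 1" by (simp_all add: k_def of_nat_nat)
    then show "real k * \<tau> \<le> t" "t < real k * \<tau> + \<tau>" using \<tau> by (simp_all add: field_simps)
  qed
  have kn: "k \<le> n"
  proof -
    have "real k * \<tau> \<le> real n * \<tau>" using tk(1) t n\<tau> by simp
    then show ?thesis using \<tau> by simp
  qed
  have k0: "0 \<le> real k * \<tau>" using \<tau> by simp
  have "energy t \<le> integral {0..t} (\<lambda>t. (\<sigma> t *\<^sub>R h t) \<bullet> p t)" by (rule energy_le[OF t])
  also have "\<dots> = integral {0..real k * \<tau>} (\<lambda>t. (\<sigma> t *\<^sub>R h t) \<bullet> p t)
      + integral {real k * \<tau>..t} (\<lambda>t. (\<sigma> t *\<^sub>R h t) \<bullet> p t)"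
    using k0 tk t by (intro Henstock_Kurzweil_Integration.integral_combine[symmetric] forcing_integrable) auto
  also have "\<dots> \<le> (\<Sum>i<k. 2 * E * J i + B * p_speed * \<tau>\<^sup>2) + 2 * E * B * (t - real k * \<tau>)"
    unfolding J_def E_def \<tau>_def
    using forcing_integral_grid[OF n kn] forcing_integral_le[of "real k * \<tau>" t] k0 tk t
    by (intro add_mono) (auto simp: \<tau>_def)
  \<comment> \<open>Adding the nonnegative terms of the later cells makes the bound the same for all
    \<open>t\<close>.\<close>
  also have "\<dots> \<le> (\<Sum>i<n. 2 * E * J i + B * p_speed * \<tau>\<^sup>2) + 2 * E * B * \<tau>"
  proof (intro add_mono sum_mono2 mult_left_mono)
    show "0 \<le> 2 * E * J i + B * p_speed * \<tau>\<^sup>2" for i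
      using E B_nonneg p_speed_nonneg by (simp add: J_def)
  qed (use kn tk E B_nonneg in auto)
  also have "(\<Sum>i<n. 2 * E * J i + B * p_speed * \<tau>\<^sup>2) = 2 * E * (\<Sum>i<n. J i) + real n * (B * p_speed * \<tau>\<^sup>2)"
    by (simp add: sum.distrib sum_distrib_left)
  also have "real n * (B * p_speed * \<tau>\<^sup>2) = B * p_speed * T\<^sup>2 / real n"
    using n by (simp add: \<tau>_def power2_eq_square)
  also have "2 * E * B * \<tau> = 2 * E * B * T / real n" by (simp add: \<tau>_def)
  finally have en: "energy t \<le> 2 * E * (\<Sum>i<n. J i) + B * p_speed * T\<^sup>2 / real n + 2 * E * B * T / real n" .
  have sumJ: "(\<Sum>i<n. J i) \<le> 1 / real n + (real n)\<^sup>2 * (\<Sum>i<n. (J i)\<^sup>2)"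
  proof -
    have "J i \<le> 1 / (real n)\<^sup>2 + (real n)\<^sup>2 * (J i)\<^sup>2" for i
    proof -
      \<comment> \<open>The weights in the square are chosen so that the cross term is
        \<open>- 2 * J i\<close> and the constants \<open>1 / n\<^sup>2\<close> add up to
        \<open>1 / n\<close> over all cells.\<close>
      have "0 \<le> (1 / real n - real n * J i)\<^sup>2 + J i" by (simp add: J_def)
      also have "\<dots> = 1 / (real n)\<^sup>2 + (real n)\<^sup>2 * (J i)\<^sup>2 - J i"
        using n by (simp add: power2_eq_square field_simps)
      finally show ?thesis by simp
    qed
    then have "(\<Sum>i<n. J i) \<le> (\<Sum>i<n. 1 / (real n)\<^sup>2 + (real n)\<^sup>2 * (J i)\<^sup>2)" by (intro sum_mono)
    also have "\<dots> = real n * (1 / (real n)\<^sup>2) + (real n)\<^sup>2 * (\<Sum>i<n. (J i)\<^sup>2)"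
      by (simp add: sum.distrib sum_distrib_left)
    also have "real n * (1 / (real n)\<^sup>2) = 1 / real n" using n by (simp add: power2_eq_square)
    finally show ?thesis .
  qed
  define S where "S = (real n)\<^sup>2 * (\<Sum>i<n. (J i)\<^sup>2)"
  have S: "0 \<le> S" by (simp add: S_def sum_nonneg)
  have "energy t \<le> 2 * E * (1 / real n + S) + B * p_speed * T\<^sup>2 / real n + 2 * E * B * T / real n"
    using en mult_left_mono[OF sumJ, of "2 * E"] E unfolding S_def by linarith
  also have "\<dots> \<le> (2 * E + B * p_speed * T\<^sup>2 + 2 * E * B * T) * (1 / real n + S)"
  proof -
    have "0 \<le> (B * p_speed * T\<^sup>2 + 2 * E * B * T) * S"
      using S E B_nonneg p_speed_nonneg T by simp
    then show ?thesis by (simp add: algebra_simps add_divide_distrib)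
  qed
  finally have en': "energy t \<le> (2 * E + B * p_speed * T\<^sup>2 + 2 * E * B * T) * (1 / real n + S)" .
  have "(norm (e t))\<^sup>2 = exp (2 * L * t) * energy t"
    by (simp add: energy_def dot_square_norm mult_exp_exp flip: mult.assoc)
  also have "\<dots> \<le> exp (2 * L * T) * ((2 * E + B * p_speed * T\<^sup>2 + 2 * E * B * T) * (1 / real n + S))"
    using en' t L_nonneg by (intro mult_mono) (auto simp: energy_def intro: mult_left_mono)
  also have "\<dots> = rate_const * (1 / real n + S)" by (simp add: rate_const_def E_def)
  finally show ?thesis by (simp add: S_def J_def \<tau>_def algebra_simps)
qed

end

section \<open>Convergence of switched paths\<close>

lemma continuous_on_nonneg:
  fixes z :: "real \<Rightarrow> 'a::metric_space"
  assumes "\<And>T. continuous_on {0..T} z"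
  shows "continuous_on {0..} z"
  unfolding continuous_on_iff
proof (intro ballI allI impI)
  fix t e :: real assume t: "t \<in> {0..}" and e: "0 < e"
  have "t \<in> {0..t + 1}" using t by simp
  then obtain d where d: "0 < d" "\<And>s. s \<in> {0..t + 1} \<Longrightarrow> dist s t < d \<Longrightarrow> dist (z s) (z t) < e"
    using assms[of "t + 1", unfolded continuous_on_iff] e by blast
  have "dist (z s) (z t) < e" if "s \<in> {0..}" "dist s t < min d 1" for s
    using that by (intro d(2)) (auto simp: dist_real_def)
  then show "\<exists>d>0. \<forall>s\<in>{0..}. dist s t < d \<longrightarrow> dist (z s) (z t) < e"
    using d(1) by (intro exI[of _ "min d 1"]) auto
qed

text \<open>A fixed sequence of increments exhibits the derivative as a pointwise limit of
  continuous functions of time, hence as measurable.\<close>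

lemma difference_quotient_tendsto:
  fixes z :: "real \<Rightarrow> 'a::real_normed_vector"
  assumes "(z has_vector_derivative v) (at t within {0..})" "0 \<le> t"
  shows "(\<lambda>n. real (Suc n) *\<^sub>R (z (t + 1 / real (Suc n)) - z t)) \<longlonglongrightarrow> v"
proof -
  define s where "s n = t + 1 / real (Suc n)" for n
  have "s \<longlonglongrightarrow> t"
    unfolding s_def using tendsto_add[OF tendsto_const[of t] LIMSEQ_Suc[OF lim_1_over_n]] by simp
  then have "filterlim s (at t within {0..}) sequentially"
    using assms(2) by (intro filterlim_at_withinI) (auto simp: s_def)
  moreover have "((\<lambda>y. (1 / norm (y - t)) *\<^sub>R (z y - (z t + (y - t) *\<^sub>R v))) \<longlongrightarrow> 0) (at t within {0..})"
    using assms(1) by (simp add: has_vector_derivative_def has_derivative_within)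
  ultimately have "(\<lambda>n. (1 / norm (s n - t)) *\<^sub>R (z (s n) - (z t + (s n - t) *\<^sub>R v))) \<longlonglongrightarrow> 0"
    by (rule filterlim_compose[rotated])
  moreover have "(1 / norm (s n - t)) *\<^sub>R (z (s n) - (z t + (s n - t) *\<^sub>R v))
      = real (Suc n) *\<^sub>R (z (s n) - z t) - v" for n
    by (simp add: s_def scaleR_diff_right scaleR_add_right)
  ultimately have "(\<lambda>n. real (Suc n) *\<^sub>R (z (s n) - z t) - v) \<longlonglongrightarrow> 0" by simp
  then show ?thesis unfolding s_def by (rule LIM_zero_cancel)
qed

context splitting
begin

text \<open>The inclusion determines \<open>v\<close> from the derivative of \<open>z\<close>, so
  \<open>f z - v\<close> is twice the difference of \<open>f z\<close> and that derivative. Thus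
  \<open>h\<close> is obtained from difference quotients, without a measurable selection from
  \<open>F\<close>.\<close>

lemma averaged_flow_exists:
  assumes T: "0 < T" and ac: "\<And>T. abs_continuous_on 0 T z"
    and sol: "satisfies_inclusion averaged_field {0..} z"
  obtains h B R C where "averaged_flow f F K L z h T B R C"
proof -
  have zc: "continuous_on {0..} z"
    by (rule continuous_on_nonneg) (rule abs_continuous_on_imp_continuous_on[OF ac])
  have zT: "continuous_on {0..T} z" by (rule continuous_on_subset[OF zc]) auto
  obtain R where R: "\<And>t. t \<in> {0..T} \<Longrightarrow> norm (z t) \<le> R"
    using compact_imp_bounded[OF compact_continuous_image[OF zT compact_Icc]] unfolding bounded_iff
    by (metis imageI)
  have R0: "0 \<le> R" using order_trans[OF norm_ge_zero R[of 0]] T by simp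
  define B where "B = norm (f 0) + K * R + K"
  have B0: "0 \<le> B" using K_nonneg R0 by (simp add: B_def)
  have fzB: "norm (f (z t)) + K \<le> B" if "t \<in> {0..T}" for t
    using norm_f[of "z t"] mult_left_mono[OF R[OF that] K_nonneg] by (simp add: B_def)
  have der: "AE t in lebesgue. t \<in> {0..} \<longrightarrow> (\<exists>v\<in>F (z t).
      (z has_vector_derivative ((1/2) *\<^sub>R f (z t) + (1/2) *\<^sub>R v)) (at t within {0..}))"
    using sol unfolding satisfies_inclusion_def
    by eventually_elim (auto simp: averaged_field_def)
  define Z where "Z n t = real (Suc n) *\<^sub>R (z (max 0 t + 1 / real (Suc n)) - z (max 0 t))" for n t
  define g where "g t = 2 *\<^sub>R (f (z (max 0 t)) - lim (\<lambda>n. Z n t))" for t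
  \<comment> \<open>Where the quotients diverge \<open>lim\<close> is arbitrary; cutting off at
    \<open>B\<close> bounds \<open>h\<close> everywhere and changes nothing at the good times in
    \<open>{0..T}\<close>.\<close>
  define h where "h t = (if norm (g t) \<le> B then g t else 0)" for t
  have zmax: "continuous_on UNIV (\<lambda>t. z (max 0 t + c))" if "0 \<le> c" for c
    by (rule continuous_on_compose2[OF zc]) (use that in \<open>auto intro!: continuous_intros\<close>)
  have Zm: "Z n \<in> borel_measurable borel" for n
    unfolding Z_def using zmax[of 0] zmax[of "1 / real (Suc n)"]
    by (intro borel_measurable_continuous_onI continuous_intros) auto
  have "(\<lambda>t. f (z (max 0 t))) \<in> borel_measurable borel"
    using zmax[of 0] by (intro borel_measurable_continuous_onI continuous_on_compose2[OF continuous_on_f]) auto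
  moreover have "(\<lambda>t. lim (\<lambda>n. Z n t)) \<in> borel_measurable borel"
    using Zm by (rule borel_measurable_lim_metric)
  ultimately have gm: "g \<in> borel_measurable borel"
    unfolding g_def by (intro borel_measurable_scaleR borel_measurable_const borel_measurable_diff)
  then have hm: "h \<in> borel_measurable borel"
    unfolding h_def by measurable
  have good: "AE t in lebesgue. t \<in> {0..T} \<longrightarrow> (\<exists>v\<in>F (z t). h t = f (z t) - v \<and>
      (z has_vector_derivative ((1/2) *\<^sub>R f (z t) + (1/2) *\<^sub>R v)) (at t within {0..T}))"
    using der
  proof eventually_elim
    case (elim t)
    show ?case
    proof
      assume t: "t \<in> {0..T}"
      with elim obtain v where v: "v \<in> F (z t)"
        "(z has_vector_derivative ((1/2) *\<^sub>R f (z t) + (1/2) *\<^sub>R v)) (at t within {0..})" by auto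
      have "(\<lambda>n. Z n t) \<longlonglongrightarrow> (1/2) *\<^sub>R f (z t) + (1/2) *\<^sub>R v"
        using difference_quotient_tendsto[OF v(2)] t by (simp add: Z_def)
      then have "g t = 2 *\<^sub>R (f (z t) - ((1/2) *\<^sub>R f (z t) + (1/2) *\<^sub>R v))"
        using t by (simp add: g_def limI)
      then have g: "g t = f (z t) - v" by (simp add: scaleR_diff_right scaleR_add_right scaleR_2)
      have "norm (g t) \<le> B"
        unfolding g using norm_triangle_ineq4[of "f (z t)" v] F_bounded[OF v(1)] fzB[OF t] by linarith
      then have "h t = f (z t) - v" by (simp add: h_def g)
      moreover have "(z has_vector_derivative ((1/2) *\<^sub>R f (z t) + (1/2) *\<^sub>R v)) (at t within {0..T})"
        by (rule has_vector_derivative_within_subset[OF v(2)]) auto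
      ultimately show "\<exists>v\<in>F (z t). h t = f (z t) - v \<and>
          (z has_vector_derivative ((1/2) *\<^sub>R f (z t) + (1/2) *\<^sub>R v)) (at t within {0..T})"
        using v(1) by blast
    qed
  qed
  have lip: "B-lipschitz_on {0..T} z"
  proof (rule lipschitz_on_of_bounded_derivative[OF ac B0])
    show "AE t in lebesgue. t \<in> {0..T} \<longrightarrow> (\<exists>v. norm v \<le> B \<and> (z has_vector_derivative v) (at t within {0..T}))"
      using good
    proof eventually_elim
      case (elim t)
      show ?case
      proof
        assume t: "t \<in> {0..T}"
        then obtain v where v: "v \<in> F (z t)"
          "(z has_vector_derivative ((1/2) *\<^sub>R f (z t) + (1/2) *\<^sub>R v)) (at t within {0..T})"
          using elim by blast
        have "norm ((1/2) *\<^sub>R f (z t) + (1/2) *\<^sub>R v) \<le> (1/2) * norm (f (z t)) + (1/2) * norm v"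
          using norm_triangle_ineq[of "(1/2) *\<^sub>R f (z t)" "(1/2) *\<^sub>R v"] by simp
        also have "\<dots> \<le> B"
          using F_bounded[OF v(1)] fzB[OF t] norm_ge_zero[of "f (z t)"] K_nonneg by linarith
        finally show "\<exists>v. norm v \<le> B \<and> (z has_vector_derivative v) (at t within {0..T})"
          using v(2) by blast
      qed
    qed
  qed
  have "averaged_flow f F K L z h T B R B"
    by unfold_locales (use T hm R lip good B0 in \<open>auto simp: h_def\<close>)
  then show thesis by (rule that)
qed

text \<open>The number of cells is chosen from the tolerance \<open>c\<close> alone. The remaining
  random term is a fixed finite sum of squared integrals, and each of their means tends to 0 as the
  rate grows.\<close>

theorem weakly_converges_switched:
  fixes M :: "real \<Rightarrow> 'w measure"
  assumes switching: "\<And>l. l > 0 \<Longrightarrow> markov_jump_process (M l) {0, 1} (switching_rates l) (i l)"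
    and X: "\<And>l. l > 0 \<Longrightarrow> stochastic_approximation (M l) (i l) switched_field (z 0) (X l)"
    and ac: "\<And>T. abs_continuous_on 0 T z"
    and sol: "satisfies_inclusion averaged_field {0..} z"
  shows "weakly_converges path_topology (\<lambda>l. path_law (M l) (X l)) (deterministic_path_law z) at_top"
proof (rule weakly_converges_deterministic)
  have process: "switching_process (M l) (i l) l" if "l > 0" for l
    using switching[OF that] unfolding switching_process_def switching_process_axioms_def
    by (auto simp: markov_jump_process_def)
  show "prob_space (M l)" if "l > 0" for l
    using switching[OF that] by (simp add: markov_jump_process_def)
  show "X l t \<in> borel_measurable (M l)" if "l > 0" "0 \<le> t" for l t
    using X[OF that(1)] that(2) by (simp add: stochastic_approximation_def)
  show cont: "continuous_on {0..} (\<lambda>t. X l t \<omega>)" if "l > 0" "\<omega> \<in> space (M l)" for l \<omega>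
    using X[OF that(1)] that(2) by (simp add: stochastic_approximation_def)
  show "continuous_on {0..} z"
    by (rule continuous_on_nonneg) (rule abs_continuous_on_imp_continuous_on[OF ac])
  fix T0 c :: real assume T0: "0 \<le> T0" and c: "0 < c"
  \<comment> \<open>The horizon \<open>T0\<close> may be 0, whereas the grid needs an interval of
    positive length.\<close>
  define T where "T = T0 + 1"
  have T: "0 < T" using T0 by (simp add: T_def)
  obtain h B R C where "averaged_flow f F K L z h T B R C"
    by (rule averaged_flow_exists[OF T ac sol])
  then interpret averaged_flow f F K L z h T B R C .
  define W where "W = rate_const"
  have W: "0 \<le> W" by (simp add: W_def rate_const_nonneg)
  \<comment> \<open>This fixes the part of the error due to the mesh before the rate is sent to
    infinity.\<close>
  obtain n :: nat where n: "0 < n" "W / real n \<le> c"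
  proof -
    obtain n where n: "real n > max 1 (W / c)" using reals_Archimedean2 by blast
    then have "0 < n" "W / c < real n" by (auto intro: Nat.gr0I)
    then have "W / real n \<le> c" using c by (simp add: field_simps)
    with \<open>0 < n\<close> show thesis by (rule that)
  qed
  define \<tau> where "\<tau> = T / real n"
  have \<tau>: "0 < \<tau>" using T n by (simp add: \<tau>_def)
  define J where "J l k \<omega> = (LINT t:{real k * \<tau>..real (Suc k) * \<tau>}|lborel. spin (i l t \<omega>) *\<^sub>R h t)"
    for l k \<omega>
  define Y where "Y l \<omega> = W * (real n)\<^sup>2 * (\<Sum>k<n. (norm (J l k \<omega>))\<^sup>2)" for l \<omega>
  have intJ: "integrable (M l) (\<lambda>\<omega>. (norm (J l k \<omega>))\<^sup>2)" if "l > 0" for l k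
  proof -
    interpret switching_process "M l" "i l" l by (rule process[OF that])
    show ?thesis unfolding J_def
      by (rule norm_sq_integral_spin(1)[OF _ h_measurable h_bounded]) (use \<tau> in simp)
  qed
  have limJ: "((\<lambda>l. \<integral>\<omega>. (norm (J l k \<omega>))\<^sup>2 \<partial>M l) \<longlongrightarrow> 0) at_top" for k
  proof (rule Lim_transform_eventually[OF integral_exp_decay_tendsto_0[OF h_measurable h_bounded,
          of "real k * \<tau>" "real (Suc k) * \<tau>"]])
    let ?N = "restrict_space lborel {real k * \<tau>..real (Suc k) * \<tau>}"
    show "\<forall>\<^sub>F l in at_top. (\<integral>p. exp (- 2 * l * \<bar>snd p - fst p\<bar>) / 4 * (h (fst p) \<bullet> h (snd p)) \<partial>(?N \<Otimes>\<^sub>M ?N))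
        = (\<integral>\<omega>. (norm (J l k \<omega>))\<^sup>2 \<partial>M l)"
      using eventually_gt_at_top[of 0]
    proof eventually_elim
      fix l :: real assume "0 < l"
      then interpret switching_process "M l" "i l" l by (rule process)
      show "(\<integral>p. exp (- 2 * l * \<bar>snd p - fst p\<bar>) / 4 * (h (fst p) \<bullet> h (snd p)) \<partial>(?N \<Otimes>\<^sub>M ?N))
        = (\<integral>\<omega>. (norm (J l k \<omega>))\<^sup>2 \<partial>M l)"
        unfolding J_def
        by (rule norm_sq_integral_spin(2)[OF _ h_measurable h_bounded, symmetric]) (use \<tau> in simp)
    qed
  qed
  have intY: "integrable (M l) (Y l)" if "l > 0" for l
    unfolding Y_def using intJ[OF that] by auto
  have "((\<lambda>l. W * (real n)\<^sup>2 * (\<Sum>k<n. \<integral>\<omega>. (norm (J l k \<omega>))\<^sup>2 \<partial>M l)) \<longlongrightarrow> W * (real n)\<^sup>2 * (\<Sum>k<n. 0)) at_top"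
    by (intro tendsto_intros limJ)
  then have limY: "((\<lambda>l. \<integral>\<omega>. Y l \<omega> \<partial>M l) \<longlongrightarrow> 0) at_top"
  proof (simp only: sum.neutral_const mult_zero_right, rule_tac Lim_transform_eventually)
    show "\<forall>\<^sub>F l in at_top. W * (real n)\<^sup>2 * (\<Sum>k<n. \<integral>\<omega>. (norm (J l k \<omega>))\<^sup>2 \<partial>M l) = (\<integral>\<omega>. Y l \<omega> \<partial>M l)"
      using eventually_gt_at_top[of 0]
      by eventually_elim (use intJ in \<open>simp add: Y_def\<close>)
  qed
  have near: "AE \<omega> in M l. \<forall>t\<in>{0..T0}. (dist (X l t \<omega>) (z t))\<^sup>2 \<le> c + Y l \<omega>" if l: "l > 0" for l
  proof -
    interpret switching_process "M l" "i l" l by (rule process[OF l])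
    have "AE \<omega> in M l. follows_switched switched_field (\<lambda>t. i l t \<omega>) (\<lambda>t. X l t \<omega>)"
      using X[OF l] by (simp add: stochastic_approximation_def)
    then show ?thesis
      using AE_space
    proof eventually_elim
      fix \<omega> assume fs: "follows_switched switched_field (\<lambda>t. i l t \<omega>) (\<lambda>t. X l t \<omega>)"
        and \<omega>: "\<omega> \<in> space (M l)"
      define \<sigma> where "\<sigma> t = spin (i l (max 0 t) \<omega>)" for t
      interpret path: switched_path f F K L z h T B R C "\<lambda>t. i l t \<omega>" "\<lambda>t. X l t \<omega>" \<sigma>
      proof
        show "\<forall>\<^sub>F s in at_right t. i l s \<omega> = i l t \<omega>" if "0 \<le> t" for t
          by (rule right_continuous_state[OF \<omega> that])
        show "continuous_on {0..} (\<lambda>t. X l t \<omega>)" by (rule cont[OF l \<omega>])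
        show "X l 0 \<omega> = z 0" using X[OF l] \<omega> by (simp add: stochastic_approximation_def)
        show "\<sigma> \<in> borel_measurable borel"
          unfolding \<sigma>_def by (rule borel_measurable_spin_path[OF \<omega>])
        show "\<sigma> t = (if i l t \<omega> = 0 then 1 / 2 else - 1 / 2)" if "0 \<le> t" for t
          using that by (simp add: \<sigma>_def spin_def)
      qed (rule fs)
      \<comment> \<open>The moments were computed for Lebesgue integrals, the path estimate for
        gauge integrals; for bounded measurable integrands both agree.\<close>
      have J: "J l k \<omega> = integral {real k * \<tau>..real (Suc k) * \<tau>} (\<lambda>t. \<sigma> t *\<^sub>R h t)" for k
      proof -
        have k0: "0 \<le> real k * \<tau>" using \<tau> by simp
        have "J l k \<omega> = (LINT t:{real k * \<tau>..real (Suc k) * \<tau>}|lborel. \<sigma> t *\<^sub>R h t)"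
          unfolding J_def
        proof (rule set_lebesgue_integral_cong)
          show "\<forall>t. t \<in> {real k * \<tau>..real (Suc k) * \<tau>} \<longrightarrow> spin (i l t \<omega>) *\<^sub>R h t = \<sigma> t *\<^sub>R h t"
            using k0 by (auto simp: \<sigma>_def max_def)
        qed simp
        also have "set_integrable lborel {real k * \<tau>..real (Suc k) * \<tau>} (\<lambda>t. \<sigma> t *\<^sub>R h t)"
          unfolding set_integrable_def
        proof (rule integrableI_bounded_set_indicator[where B = B])
          show "(\<lambda>t. \<sigma> t *\<^sub>R h t) \<in> borel_measurable lborel"
            using path.\<sigma>_measurable h_measurable by (simp add: borel_measurable_scaleR)
          show "AE t in lborel. t \<in> {real k * \<tau>..real (Suc k) * \<tau>} \<longrightarrow> norm (\<sigma> t *\<^sub>R h t) \<le> B"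
            using path.norm_forcing k0 by (intro AE_I2) auto
        qed (auto simp: emeasure_lborel_Icc_eq)
        from set_borel_integral_eq_integral(2)[OF this]
        have "(LINT t:{real k * \<tau>..real (Suc k) * \<tau>}|lborel. \<sigma> t *\<^sub>R h t)
            = integral {real k * \<tau>..real (Suc k) * \<tau>} (\<lambda>t. \<sigma> t *\<^sub>R h t)" .
        finally show ?thesis .
      qed
      show "\<forall>t\<in>{0..T0}. (dist (X l t \<omega>) (z t))\<^sup>2 \<le> c + Y l \<omega>"
      proof
        fix t assume "t \<in> {0..T0}"
        then have t: "t \<in> {0..T}" by (simp add: T_def)
        have "(dist (X l t \<omega>) (z t))\<^sup>2 \<le> W / real n + Y l \<omega>"
          using path.norm_e_sq_le[OF t n(1)]
          unfolding Y_def J W_def \<tau>_def path.e_def dist_norm .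
        then show "(dist (X l t \<omega>) (z t))\<^sup>2 \<le> c + Y l \<omega>" using n(2) by simp
      qed
    qed
  qed
  have "\<forall>l>0. integrable (M l) (Y l) \<and> (\<forall>\<omega>. 0 \<le> Y l \<omega>) \<and>
       (AE \<omega> in M l. \<forall>t\<in>{0..T0}. (dist (X l t \<omega>) (z t))\<^sup>2 \<le> c + Y l \<omega>)"
    using intY near W by (auto simp: Y_def intro!: mult_nonneg_nonneg sum_nonneg)
  with limY show "\<exists>Y. (\<forall>l>0. integrable (M l) (Y l) \<and> (\<forall>\<omega>. 0 \<le> Y l \<omega>) \<and>
       (AE \<omega> in M l. \<forall>t\<in>{0..T0}. (dist (X l t \<omega>) (z t))\<^sup>2 \<le> c + Y l \<omega>)) \<and>
       ((\<lambda>l. \<integral>\<omega>. Y l \<omega> \<partial>M l) \<longlongrightarrow> 0) at_top"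
    by blast
qed

end

section \<open>Sparse inversion and classification\<close>

lemma linear_lipschitz:
  fixes g :: "'a::euclidean_space \<Rightarrow> 'b::euclidean_space"
  assumes "linear g"
  shows "\<exists>C\<ge>0. \<forall>x y. norm (g x - g y) \<le> C * norm (x - y)"
proof -
  have "bounded_linear g" using assms by (simp add: linear_conv_bounded_linear)
  then obtain C where C: "0 \<le> C" "\<And>x. norm (g x) \<le> norm x * C"
    using bounded_linear.nonneg_bounded by blast
  then have "norm (g x - g y) \<le> C * norm (x - y)" for x y
    using C(2)[of "x - y"] by (simp add: linear_diff[OF assms] mult.commute)
  with C(1) show ?thesis by blast
qed

lemma norm_le_card_cart:
  fixes v :: "real^'n"
  assumes "\<And>c. \<bar>v $ c\<bar> \<le> 1"
  shows "norm v \<le> real CARD('n)"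
proof -
  have "norm v \<le> (\<Sum>c\<in>UNIV. \<bar>v $ c\<bar>)" by (rule norm_le_l1_cart)
  also have "\<dots> \<le> (\<Sum>c\<in>(UNIV::'n set). 1)" by (rule sum_mono) (rule assms)
  finally show ?thesis by simp
qed

lemma GDERIV_data_misfit: "GDERIV (data_misfit A b) x :> transpose A *v (A *v x - b)"
proof -
  have *: "data_misfit A b = (\<lambda>x. (1/2) * ((A *v x - b) \<bullet> (A *v x - b)))"
    by (simp add: data_misfit_def fun_eq_iff dot_square_norm)
  have "((\<lambda>x. A *v x - b) has_derivative (\<lambda>h. A *v h)) (at x)"
    using bounded_linear_imp_has_derivative[OF matrix_vector_mul_bounded_linear[of A], of "at x"]
    by (auto intro!: derivative_eq_intros)
  from has_derivative_inner[OF this this]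
  have "((\<lambda>x. (A *v x - b) \<bullet> (A *v x - b)) has_derivative
      (\<lambda>h. (A *v x - b) \<bullet> (A *v h) + (A *v h) \<bullet> (A *v x - b))) (at x)" .
  then have "((\<lambda>x. (1/2) * ((A *v x - b) \<bullet> (A *v x - b))) has_derivative
      (\<lambda>h. (1/2) * ((A *v x - b) \<bullet> (A *v h) + (A *v h) \<bullet> (A *v x - b)))) (at x)"
    by (rule has_derivative_mult_right)
  moreover have "(1/2) * ((A *v x - b) \<bullet> (A *v h) + (A *v h) \<bullet> (A *v x - b)) = h \<bullet> (transpose A *v (A *v x - b))" for h
  proof -
    have "(A *v h) \<bullet> y = h \<bullet> (transpose A *v y)" for y
      by simp (metis dot_lmul_matrix inner_commute)
    from this[of "A *v x - b"] show ?thesis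
      unfolding inner_commute[of "A *v x - b" "A *v h"] by simp
  qed
  ultimately show ?thesis unfolding gderiv_def * by simp
qed

lemma gradient_eq:
  assumes "GDERIV f x :> g"
  shows "gradient f x = g"
  unfolding gradient_def
proof (rule the_equality)
  show "GDERIV f x :> g" by (rule assms)
  fix g' assume "GDERIV f x :> g'"
  then have "(\<lambda>h. h \<bullet> g') = (\<lambda>h. h \<bullet> g)"
    using assms unfolding gderiv_def by (rule has_derivative_unique)
  then show "g' = g" by (metis inner_commute vector_eq_rdot)
qed

lemma gradient_data_misfit: "gradient (data_misfit A b) x = transpose A *v (A *v x - b)"
  by (rule gradient_eq[OF GDERIV_data_misfit])

lemma subdiff_abs_bounded: "v \<in> subdiff_abs s \<Longrightarrow> \<bar>v\<bar> \<le> 1"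
  by (auto simp: subdiff_abs_def split: if_splits)

text \<open>Monotonicity of the subdifferential of a convex function. After the change of sign in
  the flow it makes the field dissipative.\<close>

lemma subdiff_abs_mono:
  "u \<in> subdiff_abs s \<Longrightarrow> v \<in> subdiff_abs t \<Longrightarrow> 0 \<le> (u - v) * (s - t)"
  by (auto simp: subdiff_abs_def mult_nonneg_nonneg mult_nonpos_nonpos zero_le_mult_iff split: if_splits)

lemma subdiff_W1_bounded: "v \<in> subdiff_W1 s \<Longrightarrow> \<bar>v\<bar> \<le> 1"
  by (auto simp: subdiff_W1_def split: if_splits)

text \<open>\<open>W\<close> becomes convex after adding \<open>s\<^sup>2 / 2\<close>.\<close>

lemma subdiff_W1_weakly_mono:
  assumes "u \<in> subdiff_W1 s" "v \<in> subdiff_W1 t"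
  shows "- (s - t)\<^sup>2 \<le> (u - v) * (s - t)"
proof -
  \<comment> \<open>The sums \<open>u + s\<close> belong to the convex function: they are below -2
    left of -1, fill \<open>[-2, 0]\<close> at -1, vanish between -1 and 1, fill
    \<open>[0, 2]\<close> at 1 and exceed 2 beyond.\<close>
  have mono: "u + s \<le> v + t" if "s < t" "u \<in> subdiff_W1 s" "v \<in> subdiff_W1 t" for u v s t
    using that by (auto simp: subdiff_W1_def split: if_splits)
  have "0 \<le> ((u + s) - (v + t)) * (s - t)"
    using mono[of s t u v] mono[of t s v u] assms
    by (cases s t rule: linorder_cases) (auto simp: zero_le_mult_iff)
  then show ?thesis by (simp add: power2_eq_square algebra_simps)
qed

text \<open>The closest point is the element of \<open>V\<close> whose residual is orthogonal to
  \<open>V\<close>, and this characterisation is linear in \<open>x\<close>.\<close>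

lemma linear_closest_point:
  fixes V :: "'a::euclidean_space set"
  assumes V: "subspace V"
  shows "linear (closest_point V)"
proof -
  have cp: "closest_point V x = y" if y: "y \<in> V" "\<And>w. w \<in> V \<Longrightarrow> (x - y) \<bullet> w = 0" for x y
  proof (rule closest_point_unique[symmetric])
    show "convex V" "closed V" using V by (auto simp: subspace_imp_convex closed_subspace)
    show "\<forall>w\<in>V. dist x y \<le> dist x w"
    proof
      fix w assume w: "w \<in> V"
      have "(dist x w)\<^sup>2 = (norm ((x - y) + (y - w)))\<^sup>2" by (simp add: dist_norm)
      also have "\<dots> = (norm (x - y))\<^sup>2 + (norm (y - w))\<^sup>2"
        using y(2)[OF subspace_diff[OF V y(1) w]]
        by (intro norm_add_Pythagorean) (simp add: orthogonal_def)
      finally have "(dist x y)\<^sup>2 \<le> (dist x w)\<^sup>2" by (simp add: dist_norm)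
      then show "dist x y \<le> dist x w" by simp
    qed
  qed (rule y(1))
  have dec: "closest_point V x \<in> V \<and> (\<forall>w\<in>V. (x - closest_point V x) \<bullet> w = 0)" for x
  proof -
    obtain y r where yr: "y \<in> span V" "\<And>w. w \<in> span V \<Longrightarrow> orthogonal r w" "x = y + r"
      using orthogonal_subspace_decomp_exists[of V x] by blast
    have "closest_point V x = y"
      by (rule cp) (use yr V in \<open>auto simp: orthogonal_def span_eq_iff[THEN iffD2]\<close>)
    then show ?thesis using yr V by (auto simp: orthogonal_def span_eq_iff[THEN iffD2])
  qed
  show ?thesis
  proof (rule linearI)
    fix x y :: 'a and c :: real
    show "closest_point V (x + y) = closest_point V x + closest_point V y"
    proof (rule cp)
      show "closest_point V x + closest_point V y \<in> V" using dec V by (blast intro: subspace_add)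
      fix w assume w: "w \<in> V"
      have "(x + y - (closest_point V x + closest_point V y)) \<bullet> w
          = (x - closest_point V x) \<bullet> w + (y - closest_point V y) \<bullet> w" by (simp add: algebra_simps)
      then show "(x + y - (closest_point V x + closest_point V y)) \<bullet> w = 0" using dec w by simp
    qed
    show "closest_point V (c *\<^sub>R x) = c *\<^sub>R closest_point V x"
    proof (rule cp)
      show "c *\<^sub>R closest_point V x \<in> V" using dec V by (blast intro: subspace_scale)
      fix w assume w: "w \<in> V"
      have "(c *\<^sub>R x - c *\<^sub>R closest_point V x) \<bullet> w = c * ((x - closest_point V x) \<bullet> w)"
        by (simp add: algebra_simps)
      then show "(c *\<^sub>R x - c *\<^sub>R closest_point V x) \<bullet> w = 0" using dec w by simp
    qed
  qed
qed

lemma linear_observation_map: "subspace V \<Longrightarrow> linear (observation_map \<alpha> V)"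
  unfolding observation_map_def
  by (intro linear_compose_scale_right linear_compose[OF linear_closest_point adjoint_linear[OF linear_closest_point], unfolded o_def])

text \<open>Real induction on the right endpoint. Lipschitz intervals that share an endpoint can be
  concatenated, and the constant may grow at each stage since only its existence is claimed.\<close>

lemma locally_lipschitz_on_imp_lipschitz_on:
  fixes x :: "real \<Rightarrow> 'a::real_normed_vector"
  assumes x: "locally_lipschitz_on {0..} x" and T: "0 \<le> T"
  shows "\<exists>L. L-lipschitz_on {0..T} x"
proof -
  have concat: "\<exists>L. L-lipschitz_on {a..c} x" if "C-lipschitz_on {a..b} x" "D-lipschitz_on {b..c} x" for a b c C D
    using lipschitz_on_concat_max[OF that refl] by auto
  have "T \<in> {0..T}" using T by simp
  then show ?thesis
  proof (induction rule: interval_induct)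
    case (closed t)
    obtain r L where r: "r > 0" "L-lipschitz_on (cball t r \<inter> {0..}) x"
      using x[unfolded locally_lipschitz_on_def] closed(1) by (meson atLeastAtMost_iff atLeast_iff)
    have L: "L-lipschitz_on {max 0 (t - r)..t} x"
      by (rule lipschitz_on_mono[OF r(2) _ order_refl]) (auto simp: dist_real_def)
    show ?case
    proof (cases "t - r \<le> 0")
      case True
      then show ?thesis using L by (auto simp: max_absorb1)
    next
      case False
      then show ?thesis using closed(2)[of "t - r"] r(1) L concat by (auto simp: max_absorb2)
    qed
  next
    case (step t)
    obtain r L where r: "r > 0" "L-lipschitz_on (cball t r \<inter> {0..}) x"
      using x[unfolded locally_lipschitz_on_def] step(1) by (meson atLeast_iff)
    have "\<exists>L. L-lipschitz_on {0..s} x" if s: "s \<in> {t..t + r}" for s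
    proof -
      have "L-lipschitz_on {t..s} x"
        by (rule lipschitz_on_mono[OF r(2) _ order_refl]) (use s step(1) in \<open>auto simp: dist_real_def\<close>)
      then show ?thesis using step(3) concat by blast
    qed
    then show ?case using r(1) by (intro exI[of _ "t + r"]) auto
  qed
qed

text \<open>The interval is empty. The convergence theorem assumes absolute continuity for every
  real \<open>T\<close>, including negative ones.\<close>

lemma abs_continuous_on_degenerate: "T < 0 \<Longrightarrow> abs_continuous_on 0 T x"
  by (rule lipschitz_on_imp_abs_continuous_on[of 0]) simp

lemma splitting_sparse_inversion:
  fixes A :: "real^'n^'m" and b :: "real^'m"
  obtains K where "splitting (\<lambda>x. - gradient (data_misfit A b) x) (\<lambda>x. uminus ` subdiff_l1 x) K K"
proof -
  have "linear (\<lambda>x. transpose A *v (A *v x))"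
    using linear_compose[OF matrix_vector_mul_linear[of A] matrix_vector_mul_linear[of "transpose A"]]
    by (simp add: o_def)
  then obtain C where C: "0 \<le> C"
      "\<And>x y. norm (transpose A *v (A *v x) - transpose A *v (A *v y)) \<le> C * norm (x - y)"
    using linear_lipschitz by blast
  \<comment> \<open>Components of a subgradient lie in \<open>[-1, 1]\<close>, so its norm is at
    most the dimension. The same \<open>K\<close> serves as one-sided constant because the field is
    dissipative.\<close>
  define K where "K = max C (real CARD('n))"
  have "splitting (\<lambda>x. - gradient (data_misfit A b) x) (\<lambda>x. uminus ` subdiff_l1 x) K K"
  proof
    fix x y :: "real^'n"
    have "norm (- gradient (data_misfit A b) x - - gradient (data_misfit A b) y) \<le> C * norm (x - y)"
      using C(2)[of y x] by (simp add: gradient_data_misfit matrix_vector_mult_diff_distrib norm_minus_commute)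
    also have "\<dots> \<le> K * norm (x - y)" by (intro mult_right_mono) (auto simp: K_def)
    finally show "norm (- gradient (data_misfit A b) x - - gradient (data_misfit A b) y) \<le> K * norm (x - y)" .
    show "0 \<le> K" using C(1) by (simp add: K_def)
    show "norm v \<le> K" if v: "v \<in> uminus ` subdiff_l1 x" for v
    proof -
      obtain w where w: "w \<in> subdiff_l1 x" "v = - w" using v by blast
      have "\<bar>w $ c\<bar> \<le> 1" for c
        using w(1) subdiff_abs_bounded[of "w $ c" "x $ c"] by (simp add: subdiff_l1_def)
      then have "norm v \<le> real CARD('n)" using norm_le_card_cart[of w] by (simp add: w(2))
      then show ?thesis by (simp add: K_def)
    qed
    show "(u - v) \<bullet> (x - y) \<le> K * (norm (x - y))\<^sup>2"
      if uv0: "u \<in> uminus ` subdiff_l1 x" "v \<in> uminus ` subdiff_l1 y" for u v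
    proof -
      obtain u' v' where uv: "u = - u'" "v = - v'" "u' \<in> subdiff_l1 x" "v' \<in> subdiff_l1 y"
        using uv0 by blast
      have "0 \<le> (u' - v') \<bullet> (x - y)"
        unfolding inner_vec_def using uv(3,4)
        by (intro sum_nonneg) (auto simp: subdiff_l1_def intro: subdiff_abs_mono)
      moreover have "(u - v) \<bullet> (x - y) = - ((u' - v') \<bullet> (x - y))"
        by (simp add: uv inner_diff_left)
      moreover have "0 \<le> K * (norm (x - y))\<^sup>2" using C(1) by (simp add: K_def)
      ultimately show ?thesis by linarith
    qed
  qed simp
  then show thesis by (rule that)
qed

lemma splitting_allen_cahn:
  fixes G :: "real^'n^'k" and V :: "(real^'n) set"
  assumes V: "subspace V" and \<epsilon>: "\<epsilon> > 0"
  obtains K L where "splitting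
    (\<lambda>x. - observation_map \<alpha> V x + observation_data \<alpha> V d + \<epsilon> *\<^sub>R (discrete_laplacian G *v x))
    (\<lambda>x. (\<lambda>v. - (1/\<epsilon>) *\<^sub>R v) ` subdiff_W x) K L"
proof -
  define f where "f x = - observation_map \<alpha> V x + observation_data \<alpha> V d + \<epsilon> *\<^sub>R (discrete_laplacian G *v x)" for x
  \<comment> \<open>The linear part of \<open>f\<close>; the data term cancels in
    differences.\<close>
  define g where "g x = - observation_map \<alpha> V x + \<epsilon> *\<^sub>R (discrete_laplacian G *v x)" for x
  have "linear g" unfolding g_def
    by (intro linear_compose_add linear_compose_neg linear_compose_scale_right linear_observation_map[OF V] matrix_vector_mul_linear)
  then obtain C where C: "0 \<le> C" "\<And>x y. norm (g x - g y) \<le> C * norm (x - y)"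
    using linear_lipschitz by blast
  define K where "K = max C (real CARD('n) / \<epsilon>)"
  \<comment> \<open>\<open>1 / \<epsilon>\<close> is the defect of monotonicity caused by the
    concave part of the double well.\<close>
  define L where "L = max K (1 / \<epsilon>)"
  have "splitting f (\<lambda>x. (\<lambda>v. - (1/\<epsilon>) *\<^sub>R v) ` subdiff_W x) K L"
  proof
    fix x y :: "real^'n"
    have "norm (f x - f y) \<le> C * norm (x - y)"
      using C(2)[of x y] by (simp add: f_def g_def algebra_simps)
    also have "\<dots> \<le> K * norm (x - y)" by (intro mult_right_mono) (auto simp: K_def)
    finally show "norm (f x - f y) \<le> K * norm (x - y)" .
    show "0 \<le> K" "K \<le> L" using C(1) by (simp_all add: K_def L_def)
    show "norm v \<le> K" if v: "v \<in> (\<lambda>v. - (1/\<epsilon>) *\<^sub>R v) ` subdiff_W x" for v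
    proof -
      obtain w where w: "w \<in> subdiff_W x" "v = - (1/\<epsilon>) *\<^sub>R w" using v by blast
      have "\<bar>w $ c\<bar> \<le> 1" for c
        using w(1) subdiff_W1_bounded[of "w $ c" "x $ c"] by (simp add: subdiff_W_def)
      then have "norm w \<le> real CARD('n)" by (rule norm_le_card_cart)
      then have "norm v \<le> real CARD('n) / \<epsilon>" using \<epsilon> by (simp add: w(2) divide_right_mono)
      then show ?thesis by (simp add: K_def)
    qed
    show "(u - v) \<bullet> (x - y) \<le> L * (norm (x - y))\<^sup>2"
      if uv0: "u \<in> (\<lambda>v. - (1/\<epsilon>) *\<^sub>R v) ` subdiff_W x" "v \<in> (\<lambda>v. - (1/\<epsilon>) *\<^sub>R v) ` subdiff_W y" for u v
    proof -
      obtain u' v' where uv: "u = - (1/\<epsilon>) *\<^sub>R u'" "v = - (1/\<epsilon>) *\<^sub>R v'" "u' \<in> subdiff_W x" "v' \<in> subdiff_W y"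
        using uv0 by blast
      have "- (\<Sum>c\<in>UNIV. (x $ c - y $ c)\<^sup>2) \<le> (\<Sum>c\<in>UNIV. (u' $ c - v' $ c) * (x $ c - y $ c))"
        unfolding sum_negf[symmetric] using uv(3,4)
        by (intro sum_mono subdiff_W1_weakly_mono) (auto simp: subdiff_W_def)
      then have main: "- ((norm (x - y))\<^sup>2) \<le> (u' - v') \<bullet> (x - y)"
        unfolding power2_norm_eq_inner by (simp add: inner_vec_def power2_eq_square)
      have "(u - v) \<bullet> (x - y) = (1/\<epsilon>) * (- ((u' - v') \<bullet> (x - y)))"
        by (simp add: uv inner_diff_left algebra_simps)
      also have "\<dots> \<le> (1/\<epsilon>) * (norm (x - y))\<^sup>2"
        using main \<epsilon> by (intro mult_left_mono) auto
      also have "\<dots> \<le> L * (norm (x - y))\<^sup>2" by (intro mult_right_mono) (auto simp: L_def)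
      finally show ?thesis .
    qed
  qed
  then show thesis unfolding f_def by (rule that)
qed

theorem theorem6p4:
  fixes M :: "real \<Rightarrow> 'w measure" and i :: "real \<Rightarrow> real \<Rightarrow> 'w \<Rightarrow> nat"
    and A :: "real^'n^'m" and b :: "real^'m"
    and \<alpha> \<epsilon> :: real and V :: "(real^'n) set" and d :: "real^'n" and G :: "real^'n^'k"
    and \<theta>0 \<eta>0 :: "real^'n"
    and \<zeta> \<xi> :: "real \<Rightarrow> real^'n"
    and \<theta> \<eta> :: "real \<Rightarrow> real \<Rightarrow> 'w \<Rightarrow> real^'n"
  assumes switching:
      "\<And>l. l > 0 \<Longrightarrow> markov_jump_process (M l) {0, 1} (switching_rates l) (i l)"
    and rank_A: "rank A = CARD('n)"
    and sparse_flow: "sparse_inversion_flow A b \<theta>0 \<zeta>"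
    and sparse_approx:
      "\<And>l. l > 0 \<Longrightarrow>
         stochastic_approximation (M l) (i l) (sparse_inversion_split A b) \<theta>0 (\<theta> l)"
    and alpha: "\<alpha> > 0" and eps: "\<epsilon> > 0"
    and subspace_V: "subspace V" and d_in_V: "d \<in> V"
    and laplacian_sym: "transpose (discrete_laplacian G) = discrete_laplacian G"
    and laplacian_neg: "negative_definite (discrete_laplacian G)"
    and allen_cahn: "allen_cahn_flow \<alpha> \<epsilon> V d G \<eta>0 \<xi>"
    and allen_cahn_approx:
      "\<And>l. l > 0 \<Longrightarrow>
         stochastic_approximation (M l) (i l) (allen_cahn_split \<alpha> \<epsilon> V d G) \<eta>0 (\<eta> l)"
  shows "weakly_converges path_topology
           (\<lambda>l. path_law (M l) (\<theta> l)) (deterministic_path_law \<zeta>) at_top \<and>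
         weakly_converges path_topology
           (\<lambda>l. path_law (M l) (\<eta> l)) (deterministic_path_law \<xi>) at_top"
proof
  obtain K where "splitting (\<lambda>x. - gradient (data_misfit A b) x) (\<lambda>x. uminus ` subdiff_l1 x) K K"
    by (rule splitting_sparse_inversion)
  then interpret sp: splitting "\<lambda>x. - gradient (data_misfit A b) x" "\<lambda>x. uminus ` subdiff_l1 x" K K .
  have "sp.switched_field = sparse_inversion_split A b"
    by (intro ext) (simp only: sp.switched_field_def sparse_inversion_split_def)
  moreover have "sp.averaged_field = sparse_inversion_field A b"
    unfolding sp.averaged_field_def sparse_inversion_field_def setcompr_eq_image Collect_mem_eq image_image
    by (intro ext image_cong refl) simp
  moreover have "abs_continuous_on 0 T \<zeta>" for T
    using sparse_flow abs_continuous_on_degenerate[of T \<zeta>]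
    by (cases "0 \<le> T") (auto simp: sparse_inversion_flow_def locally_abs_continuous_on_def)
  ultimately show "weakly_converges path_topology
      (\<lambda>l. path_law (M l) (\<theta> l)) (deterministic_path_law \<zeta>) at_top"
    using sparse_flow sparse_approx
    by (intro sp.weakly_converges_switched[OF switching]) (auto simp: sparse_inversion_flow_def)
next
  obtain K L where "splitting
    (\<lambda>x. - observation_map \<alpha> V x + observation_data \<alpha> V d + \<epsilon> *\<^sub>R (discrete_laplacian G *v x))
    (\<lambda>x. (\<lambda>v. - (1/\<epsilon>) *\<^sub>R v) ` subdiff_W x) K L"
    by (rule splitting_allen_cahn[OF subspace_V eps])
  then interpret ac: splitting
    "\<lambda>x. - observation_map \<alpha> V x + observation_data \<alpha> V d + \<epsilon> *\<^sub>R (discrete_laplacian G *v x)"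
    "\<lambda>x. (\<lambda>v. - (1/\<epsilon>) *\<^sub>R v) ` subdiff_W x" K L .
  have "ac.switched_field = allen_cahn_split \<alpha> \<epsilon> V d G"
    by (intro ext) (simp only: ac.switched_field_def allen_cahn_split_def)
  moreover have "ac.averaged_field = allen_cahn_field \<alpha> \<epsilon> V d G"
    unfolding ac.averaged_field_def allen_cahn_field_def setcompr_eq_image Collect_mem_eq image_image
    by (intro ext image_cong refl) (simp add: algebra_simps)
  moreover have "abs_continuous_on 0 T \<xi>" for T
    using allen_cahn abs_continuous_on_degenerate[of T \<xi>] locally_lipschitz_on_imp_lipschitz_on[of \<xi> T]
      lipschitz_on_imp_abs_continuous_on[of _ 0 T \<xi>]
    by (cases "0 \<le> T") (auto simp: allen_cahn_flow_def)
  ultimately show "weakly_converges path_topology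
      (\<lambda>l. path_law (M l) (\<eta> l)) (deterministic_path_law \<xi>) at_top"
    using allen_cahn allen_cahn_approx
    by (intro ac.weakly_converges_switched[OF switching]) (auto simp: allen_cahn_flow_def)
qed

end
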